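(* Consider the two-dimensional (TE mode) leap-frog discontinuous Galerkin scheme described in the context, with one of the three types of discrete boundary conditions (PEC, PMC or Silver-Müller) imposed on $\partial\Omega$, with flux parameter $\alpha\in[0,1]$, polynomial degree $N$ and time step $\Delta t>0$. Set $\beta_1=\alpha$, $\beta_2=0$ for PEC; $\beta_1=0$, $\beta_2=1$, $\beta_3=\alpha$ for PMC; $\beta_1=\beta_2=\tfrac12$, $\beta_3=1$ for Silver-Müller (for PEC, $\beta_3$ only enters through the product $\beta_2\beta_3=0$). Let $$C_E=\tfrac12 C_{inv}N^2+C_\tau^2(N+1)(N+2)\left(2+\beta_2+\frac{2\alpha+\beta_1}{2\min\{Z_k\}}\right),$$ $$C_H=\tfrac12 C_{inv}N^2+C_\tau^2(N+1)(N+2)\left(2+\beta_2+\frac{\alpha+\beta_2\beta_3}{\min\{Y_k\}}\right),$$ with the constants $C_\tau$, $C_{inv}$ defined in the context. If $$\Delta t<\frac{\min\{\underline\epsilon,\underline\mu\}}{\max\{C_E,C_H\}}\,\min_k\{h_k\},$$ then the method is stable, i.e. there is a constant $C>0$, independent of the number of time steps $M\ge 1$ and of the initial data $(\tilde E_x^0,\tilde E_y^0,\tilde H_z^{1/2})\in V_N$, such that $$\|\tilde E^M\|_{L^2(\Omega)}^2+\|\tilde H_z^{M+1/2}\|_{L^2(\Omega)}^2\le C\left(\|\tilde E^0\|_{L^2(\Omega)}^2+\|\tilde H_z^{1/2}\|_{L^2(\Omega)}^2\right).$$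
   Context: Domain and coefficients: $\Omega\subset\mathbb R^2$ is a bounded polygonal domain; $\epsilon(x,y)$ is a symmetric $2\times2$ matrix with entries $\epsilon_{xx},\epsilon_{xy}=\epsilon_{yx},\epsilon_{yy}$, and $\mu(x,y)$ is scalar; there are constants $\underline\epsilon,\overline\epsilon,\underline\mu,\overline\mu>0$ with $\underline\epsilon|\xi|^2\le\xi^T\epsilon(x,y)\xi\le\overline\epsilon|\xi|^2$ for all $\xi\in\mathbb R^2$ and $\underline\mu\le\mu(x,y)\le\overline\mu$ for almost every $(x,y)\in\Omega$ (the coefficients are assumed to have traces on element edges wherever these are used). Mesh: $\mathcal T_h=\{T_1,\dots,T_K\}$ is a conforming partition of $\overline\Omega$ into triangles (two elements intersect in the empty set or an edge, or a common vertex); $h_k$ is the diameter of $T_k$; with $\tau_k$ the maximum diameter of a ball inscribed in $T_k$, there is $\tau>0$ with $h_k/\tau_k\le\tau$ for all $k$. $P_N(T_k)$ is the space of polynomials of degree at most $N$ on $T_k$ and $V_N=\{v\in L^2(\Omega)^3: v|_{T_k}\in P_N(T_k)^3\ \forall k\}$. Flux notation: on $\partial T_k$, $n=(n_x,n_y)$ is the unit outward normal, superscript $-$ denotes values from $T_k$ and $+$ values from the neighboring element; $[v]=v^--v^+$; $c^\pm=\sqrt{\dfrac{n^T\epsilon^\pm n}{\mu^\pm\det(\epsilon^\pm)}}$, $Z^\pm=\mu^\pm c^\pm$, $Y^\pm=1/Z^\pm$; on edges contained in $\partial\Omega$, $Z^+=Z^-$ (and $Y^+=Y^-$). $Z_k$,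 $Y_k$ denote the values of $Z$, $Y$ computed from $T_k$ on its edges, and $\min\{Z_k\}$, $\min\{Y_k\}$ are the minima (infima) over all elements and all their edges. Scheme: let $t^m=m\Delta t$, $T=M\Delta t$. Given $(\tilde E_x^0,\tilde E_y^0,\tilde H_z^{1/2})\in V_N$, for $m=0,\dots,M-1$ find $(\tilde E_x^{m+1},\tilde E_y^{m+1},\tilde H_z^{m+3/2})\in V_N$ such that for every $k$ and all $u_k,v_k,w_k\in P_N(T_k)$ (subscript $k$ denotes restriction to $T_k$; $(\cdot,\cdot)_{T_k}$, $(\cdot,\cdot)_{\partial T_k}$ are the $L^2$ inner products): $$\left(\epsilon_{xx}\tfrac{\tilde E_{x_k}^{m+1}-\tilde E_{x_k}^m}{\Delta t}+\epsilon_{xy}\tfrac{\tilde E_{y_k}^{m+1}-\tilde E_{y_k}^m}{\Delta t},u_k\right)_{T_k}=(\partial_y\tilde H_{z_k}^{m+1/2},u_k)_{T_k}+\left(\tfrac{-n_y}{Z^++Z^-}\big(Z^+[\tilde H_z^{m+1/2}]-\alpha(n_x[\tilde E_y^m]-n_y[\tilde E_x^m])\big),u_k\right)_{\partial T_k},$$ $$\left(\epsilon_{yx}\tfrac{\tilde E_{x_k}^{m+1}-\tilde E_{x_k}^m}{\Delta t}+\epsilon_{yy}\tfrac{\tilde E_{y_k}^{m+1}-\tilde E_{y_k}^m}{\Delta t},v_k\right)_{T_k}=-(\partial_x\tilde H_{z_k}^{m+1/2},v_k)_{T_k}+\left(\tfrac{n_x}{Z^++Z^-}\big(Z^+[\tilde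 H_z^{m+1/2}]-\alpha(n_x[\tilde E_y^m]-n_y[\tilde E_x^m])\big),v_k\right)_{\partial T_k},$$ $$\left(\mu\tfrac{\tilde H_{z_k}^{m+3/2}-\tilde H_{z_k}^{m+1/2}}{\Delta t},w_k\right)_{T_k}=(\partial_y\tilde E_{x_k}^{m+1}-\partial_x\tilde E_{y_k}^{m+1},w_k)_{T_k}+\left(\tfrac{1}{Y^++Y^-}\big(Y^+(n_x[\tilde E_y^{m+1}]-n_y[\tilde E_x^{m+1}])-\alpha[\tilde H_z^{m+1/2}]\big),w_k\right)_{\partial T_k}.$$ Here $\tilde E=(\tilde E_x,\tilde E_y)$. Discrete boundary conditions, on all edges contained in $\partial\Omega$: PEC: $[\tilde E_x]=2\tilde E_x^-$, $[\tilde E_y]=2\tilde E_y^-$, $[\tilde H_z]=0$. PMC: $[\tilde E_x]=[\tilde E_y]=0$, $[\tilde H_z]=2\tilde H_z^-$. Silver-Müller: $[\tilde E_x]=\tilde E_x^-$, $[\tilde E_y]=\tilde E_y^-$, $[\tilde H_z]=\tilde H_z^-$, and in the flux on the outer boundary edges $\alpha$ is replaced by $1$ (on interior edges $\alpha$ is unchanged). Constants: $C_\tau>0$ is a constant, independent of $h_k$ and $N$ (depending on the shape-regularity), such that for all $T_k\in\mathcal T_h$ and $u\in P_N(T_k)$, $\|u\|_{L^2(\partial T_k)}\le C_\tau\sqrt{(N+1)(N+2)}\,h_k^{-1/2}\|u\|_{L^2(T_k)}$. $C_{inv}>0$ is a constant, independent of $h_k$ and $N$, such that $\|u\|_{H^1(T_k)}\le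 C_{inv}N^2h_k^{-1}\|u\|_{L^2(T_k)}$ for all $T_k\in\mathcal T_h$ and $u\in P_N(T_k)$. *)

theory Defs
  imports "HOL-Analysis.Analysis" "HOL-Probability.Essential_Supremum"
begin

type_synonym point = "real^2"


subsection \<open>Domain and mesh\<close>

definition polygonal_domain :: "point set \<Rightarrow> bool" where
  "polygonal_domain \<Omega> \<longleftrightarrow>
     \<Omega> \<noteq> {} \<and> open \<Omega> \<and> connected \<Omega> \<and> bounded \<Omega> \<and>
     (\<exists>S. finite S \<and> frontier \<Omega> = (\<Union>(a, b)\<in>S. closed_segment a b))"

text \<open>The library's \<^const>\<open>triangulation\<close> is a finite set of simplices any two of which meet in a common
  face (possibly empty); the elements here are the full-dimensional simplices only.\<close>

definition conforming_mesh :: "point set \<Rightarrow> point set set \<Rightarrow> bool" where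
  "conforming_mesh \<Omega> \<T> \<longleftrightarrow> triangulation \<T> \<and> (\<forall>T\<in>\<T>. 2 simplex T) \<and> \<Union>\<T> = closure \<Omega>"

definition inscribed_diameter :: "point set \<Rightarrow> real" where
  "inscribed_diameter T = Sup {diameter (cball x r) | x r. r > 0 \<and> cball x r \<subseteq> T}"

definition shape_regular :: "real \<Rightarrow> point set set \<Rightarrow> bool" where
  "shape_regular \<tau> \<T> \<longleftrightarrow> (\<forall>T\<in>\<T>. diameter T / inscribed_diameter T \<le> \<tau>)"

text \<open>Arc-length measure of a segment; it does not depend on the chosen orientation.\<close>

definition edge_measure :: "point set \<Rightarrow> point measure" where
  "edge_measure e =
     (let p = (SOME p. e = closed_segment (fst p) (snd p)); a = fst p; b = snd p
      in distr (lebesgue_on {0..dist a b}) borel (\<lambda>s. a + s *\<^sub>R sgn (b - a)))"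

text \<open>Integral over the boundary of a triangle. The integrand may depend on the edge (through the normal
  and the neighbouring element).\<close>

definition boundary_integral :: "point set \<Rightarrow> (point set \<Rightarrow> point \<Rightarrow> real) \<Rightarrow> real" where
  "boundary_integral T f = (\<Sum>e | e edge_of T. LINT x|edge_measure e. f e x)"

text \<open>The condition forces the normal to be orthogonal to the edge, by exchanging two points of it.\<close>

definition outward_normal :: "point set \<Rightarrow> point set \<Rightarrow> point" where
  "outward_normal T e = (THE n. norm n = 1 \<and> (\<forall>x\<in>e. \<forall>y\<in>T. n \<bullet> (y - x) \<le> 0))"

definition neighbor :: "point set set \<Rightarrow> point set \<Rightarrow> point set \<Rightarrow> point set" where
  "neighbor \<T> T e = (THE T'. T' \<in> \<T> \<and> T' \<noteq> T \<and> e edge_of T')"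


subsection \<open>Norms and discrete spaces\<close>

definition square_integrable :: "point set \<Rightarrow> (point \<Rightarrow> real) \<Rightarrow> bool" where
  "square_integrable S f \<longleftrightarrow>
     f \<in> borel_measurable (lebesgue_on S) \<and> integrable (lebesgue_on S) (\<lambda>x. (f x)\<^sup>2)"

definition L2_norm :: "point set \<Rightarrow> (point \<Rightarrow> real) \<Rightarrow> real" where
  "L2_norm S f = sqrt (LINT x|lebesgue_on S. (f x)\<^sup>2)"

definition L2_boundary_norm :: "point set \<Rightarrow> (point \<Rightarrow> real) \<Rightarrow> real" where
  "L2_boundary_norm T f = sqrt (boundary_integral T (\<lambda>e x. (f x)\<^sup>2))"

definition partial :: "2 \<Rightarrow> (point \<Rightarrow> real) \<Rightarrow> point \<Rightarrow> real" where
  "partial i f x = frechet_derivative f (at x) (axis i 1)"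

definition H1_norm :: "point set \<Rightarrow> (point \<Rightarrow> real) \<Rightarrow> real" where
  "H1_norm S f =
     sqrt ((L2_norm S f)\<^sup>2 + (L2_norm S (partial 1 f))\<^sup>2 + (L2_norm S (partial 2 f))\<^sup>2)"

text \<open>Polynomials of total degree at most \<open>N\<close>, as functions on the whole plane; on a triangle such a
  function is determined by its restriction.\<close>

definition poly_space :: "nat \<Rightarrow> (point \<Rightarrow> real) set" where
  "poly_space N =
     {p. \<exists>c :: nat \<Rightarrow> nat \<Rightarrow> real. p = (\<lambda>x. \<Sum>i\<le>N. \<Sum>j\<le>N - i. c i j * (x $ 1) ^ i * (x $ 2) ^ j)}"

definition poly_on :: "nat \<Rightarrow> point set \<Rightarrow> (point \<Rightarrow> real) \<Rightarrow> (point \<Rightarrow> real) \<Rightarrow> bool" where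
  "poly_on N T v p \<longleftrightarrow> p \<in> poly_space N \<and> (AE x in lebesgue_on T. v x = p x)"

definition dg_scalar_space :: "point set \<Rightarrow> point set set \<Rightarrow> nat \<Rightarrow> (point \<Rightarrow> real) set" where
  "dg_scalar_space \<Omega> \<T> N = {v. square_integrable \<Omega> v \<and> (\<forall>T\<in>\<T>. \<exists>p. poly_on N T v p)}"

definition dg_space ::
    "point set \<Rightarrow> point set set \<Rightarrow> nat \<Rightarrow> ((point \<Rightarrow> real) \<times> (point \<Rightarrow> real) \<times> (point \<Rightarrow> real)) set" where
  "dg_space \<Omega> \<T> N =
     dg_scalar_space \<Omega> \<T> N \<times> dg_scalar_space \<Omega> \<T> N \<times> dg_scalar_space \<Omega> \<T> N"

text \<open>The polynomial \<open>v|\<^sub>T\<close>. Its values on the edges of \<open>T\<close> are the one-sided values of \<open>v\<close> from \<open>T\<close>.\<close>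

definition elem :: "nat \<Rightarrow> (point \<Rightarrow> real) \<Rightarrow> point set \<Rightarrow> point \<Rightarrow> real" where
  "elem N v T = (SOME p. poly_on N T v p)"


subsection \<open>Coefficients and their traces\<close>

text \<open>\<open>g\<close> is the trace on the edge \<open>e\<close> of \<open>f\<close> restricted to \<open>T\<close>: at almost every point of \<open>e\<close> it is the
  limit, in the mean, of \<open>f\<close> from inside \<open>T\<close>. Like \<open>f\<close> itself, it is determined almost everywhere.\<close>

definition edge_trace ::
    "(point \<Rightarrow> 'b::euclidean_space) \<Rightarrow> point set \<Rightarrow> point set \<Rightarrow> (point \<Rightarrow> 'b) \<Rightarrow> bool" where
  "edge_trace f T e g \<longleftrightarrow>
     g \<in> borel_measurable (edge_measure e) \<and>
     (AE x in edge_measure e.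
        ((\<lambda>r. (LINT y|lebesgue_on (T \<inter> ball x r). norm (f y - g x)) / measure lebesgue (T \<inter> ball x r))
           \<longlongrightarrow> 0) (at_right 0))"

definition wave_speed :: "real^2^2 \<Rightarrow> real \<Rightarrow> point \<Rightarrow> real" where
  "wave_speed A m n = sqrt ((n \<bullet> (A *v n)) / (m * det A))"

definition impedance :: "real^2^2 \<Rightarrow> real \<Rightarrow> point \<Rightarrow> real" where
  "impedance A m n = m * wave_speed A m n"

text \<open>In what follows \<open>\<epsilon>T T\<close> and \<open>\<mu>T T\<close> are the traces of the coefficients on the boundary of \<open>T\<close>.\<close>

definition Z_minus ::
    "(point set \<Rightarrow> point \<Rightarrow> real^2^2) \<Rightarrow> (point set \<Rightarrow> point \<Rightarrow> real)
      \<Rightarrow> point set \<Rightarrow> point set \<Rightarrow> point \<Rightarrow> real" where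
  "Z_minus \<epsilon>T \<mu>T T e x = impedance (\<epsilon>T T x) (\<mu>T T x) (outward_normal T e)"

definition Z_plus ::
    "point set \<Rightarrow> point set set \<Rightarrow> (point set \<Rightarrow> point \<Rightarrow> real^2^2) \<Rightarrow> (point set \<Rightarrow> point \<Rightarrow> real)
      \<Rightarrow> point set \<Rightarrow> point set \<Rightarrow> point \<Rightarrow> real" where
  "Z_plus \<Omega> \<T> \<epsilon>T \<mu>T T e x =
     (if e \<subseteq> frontier \<Omega> then Z_minus \<epsilon>T \<mu>T T e x
      else impedance (\<epsilon>T (neighbor \<T> T e) x) (\<mu>T (neighbor \<T> T e) x) (outward_normal T e))"

text \<open>Infimum over all elements and all their edges. Since the traces are determined only almost
  everywhere on an edge, the infimum over the points of an edge is the essential one.\<close>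

definition edge_inf :: "point set \<Rightarrow> (point \<Rightarrow> real) \<Rightarrow> real" where
  "edge_inf e f = real_of_ereal (- esssup (edge_measure e) (\<lambda>x. - ereal (f x)))"

definition mesh_inf :: "point set set \<Rightarrow> (point set \<Rightarrow> point set \<Rightarrow> point \<Rightarrow> real) \<Rightarrow> real" where
  "mesh_inf \<T> f = Min {edge_inf e (f T e) | T e. T \<in> \<T> \<and> e edge_of T}"

definition Z_min ::
    "point set set \<Rightarrow> (point set \<Rightarrow> point \<Rightarrow> real^2^2) \<Rightarrow> (point set \<Rightarrow> point \<Rightarrow> real) \<Rightarrow> real" where
  "Z_min \<T> \<epsilon>T \<mu>T = mesh_inf \<T> (Z_minus \<epsilon>T \<mu>T)"

definition Y_min ::
    "point set set \<Rightarrow> (point set \<Rightarrow> point \<Rightarrow> real^2^2) \<Rightarrow> (point set \<Rightarrow> point \<Rightarrow> real) \<Rightarrow> real" where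
  "Y_min \<T> \<epsilon>T \<mu>T = mesh_inf \<T> (\<lambda>T e x. 1 / Z_minus \<epsilon>T \<mu>T T e x)"


subsection \<open>Boundary conditions and numerical fluxes\<close>

datatype boundary_condition = PEC | PMC | Silver_Mueller

text \<open>On boundary edges the jump of a field is the factor below times its value from the element.\<close>

fun E_factor :: "boundary_condition \<Rightarrow> real" where
  "E_factor PEC = 2"
| "E_factor PMC = 0"
| "E_factor Silver_Mueller = 1"

fun H_factor :: "boundary_condition \<Rightarrow> real" where
  "H_factor PEC = 0"
| "H_factor PMC = 2"
| "H_factor Silver_Mueller = 1"

fun beta1 :: "boundary_condition \<Rightarrow> real \<Rightarrow> real" where
  "beta1 PEC \<alpha> = \<alpha>"
| "beta1 PMC \<alpha> = 0"
| "beta1 Silver_Mueller \<alpha> = 1/2"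

fun beta2 :: "boundary_condition \<Rightarrow> real" where
  "beta2 PEC = 0"
| "beta2 PMC = 1"
| "beta2 Silver_Mueller = 1/2"

text \<open>For \<open>PEC\<close> only the product \<open>\<beta>\<^sub>2 \<beta>\<^sub>3 = 0\<close> is used, so the value chosen here is immaterial.\<close>

fun beta3 :: "boundary_condition \<Rightarrow> real \<Rightarrow> real" where
  "beta3 PEC \<alpha> = 0"
| "beta3 PMC \<alpha> = \<alpha>"
| "beta3 Silver_Mueller \<alpha> = 1"

definition flux_param :: "point set \<Rightarrow> boundary_condition \<Rightarrow> real \<Rightarrow> point set \<Rightarrow> real" where
  "flux_param \<Omega> bc \<alpha> e = (if bc = Silver_Mueller \<and> e \<subseteq> frontier \<Omega> then 1 else \<alpha>)"

definition jump ::
    "point set \<Rightarrow> point set set \<Rightarrow> nat \<Rightarrow> real \<Rightarrow> (point \<Rightarrow> real)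
      \<Rightarrow> point set \<Rightarrow> point set \<Rightarrow> point \<Rightarrow> real" where
  "jump \<Omega> \<T> N \<kappa> v T e x =
     (if e \<subseteq> frontier \<Omega> then \<kappa> * elem N v T x
      else elem N v T x - elem N v (neighbor \<T> T e) x)"

definition tangential_jump ::
    "point set \<Rightarrow> point set set \<Rightarrow> nat \<Rightarrow> boundary_condition \<Rightarrow> (point \<Rightarrow> real) \<Rightarrow> (point \<Rightarrow> real)
      \<Rightarrow> point set \<Rightarrow> point set \<Rightarrow> point \<Rightarrow> real" where
  "tangential_jump \<Omega> \<T> N bc E1 E2 T e x =
     outward_normal T e $ 1 * jump \<Omega> \<T> N (E_factor bc) E2 T e x
     - outward_normal T e $ 2 * jump \<Omega> \<T> N (E_factor bc) E1 T e x"

definition E_flux ::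
    "point set \<Rightarrow> point set set \<Rightarrow> (point set \<Rightarrow> point \<Rightarrow> real^2^2) \<Rightarrow> (point set \<Rightarrow> point \<Rightarrow> real) \<Rightarrow> nat
      \<Rightarrow> boundary_condition \<Rightarrow> real \<Rightarrow> (point \<Rightarrow> real) \<Rightarrow> (point \<Rightarrow> real) \<Rightarrow> (point \<Rightarrow> real)
      \<Rightarrow> point set \<Rightarrow> point set \<Rightarrow> point \<Rightarrow> real" where
  "E_flux \<Omega> \<T> \<epsilon>T \<mu>T N bc \<alpha> E1 E2 Hz T e x =
     1 / (Z_plus \<Omega> \<T> \<epsilon>T \<mu>T T e x + Z_minus \<epsilon>T \<mu>T T e x) *
     (Z_plus \<Omega> \<T> \<epsilon>T \<mu>T T e x * jump \<Omega> \<T> N (H_factor bc) Hz T e x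
      - flux_param \<Omega> bc \<alpha> e * tangential_jump \<Omega> \<T> N bc E1 E2 T e x)"

definition H_flux ::
    "point set \<Rightarrow> point set set \<Rightarrow> (point set \<Rightarrow> point \<Rightarrow> real^2^2) \<Rightarrow> (point set \<Rightarrow> point \<Rightarrow> real) \<Rightarrow> nat
      \<Rightarrow> boundary_condition \<Rightarrow> real \<Rightarrow> (point \<Rightarrow> real) \<Rightarrow> (point \<Rightarrow> real) \<Rightarrow> (point \<Rightarrow> real)
      \<Rightarrow> point set \<Rightarrow> point set \<Rightarrow> point \<Rightarrow> real" where
  "H_flux \<Omega> \<T> \<epsilon>T \<mu>T N bc \<alpha> E1 E2 Hz T e x =
     (let Yp = 1 / Z_plus \<Omega> \<T> \<epsilon>T \<mu>T T e x; Ym = 1 / Z_minus \<epsilon>T \<mu>T T e x in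
      1 / (Yp + Ym) *
      (Yp * tangential_jump \<Omega> \<T> N bc E1 E2 T e x
       - flux_param \<Omega> bc \<alpha> e * jump \<Omega> \<T> N (H_factor bc) Hz T e x))"


subsection \<open>The leap-frog scheme\<close>

text \<open>\<open>E1\<close>, \<open>E2\<close> are the components \<open>E\<^sub>x\<close>, \<open>E\<^sub>y\<close> of the electric field. One step leads
  from \<open>(E1, E2, Hz)\<close> at times \<open>t\<^sup>m, t\<^sup>m, t\<^bsup>m+1/2\<^esup>\<close> to
  \<open>(E1', E2', Hz')\<close> at times \<open>t\<^bsup>m+1\<^esup>, t\<^bsup>m+1\<^esup>, t\<^bsup>m+3/2\<^esup>\<close>.\<close>

definition leapfrog_step ::
    "point set \<Rightarrow> point set set \<Rightarrow> (point \<Rightarrow> real^2^2) \<Rightarrow> (point \<Rightarrow> real)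
      \<Rightarrow> (point set \<Rightarrow> point \<Rightarrow> real^2^2) \<Rightarrow> (point set \<Rightarrow> point \<Rightarrow> real)
      \<Rightarrow> nat \<Rightarrow> boundary_condition \<Rightarrow> real \<Rightarrow> real
      \<Rightarrow> (point \<Rightarrow> real) \<Rightarrow> (point \<Rightarrow> real) \<Rightarrow> (point \<Rightarrow> real)
      \<Rightarrow> (point \<Rightarrow> real) \<Rightarrow> (point \<Rightarrow> real) \<Rightarrow> (point \<Rightarrow> real) \<Rightarrow> bool" where
  "leapfrog_step \<Omega> \<T> \<epsilon> \<mu> \<epsilon>T \<mu>T N bc \<alpha> \<Delta>t E1 E2 Hz E1' E2' Hz' \<longleftrightarrow>
   (\<forall>T\<in>\<T>. \<forall>u\<in>poly_space N. \<forall>v\<in>poly_space N. \<forall>w\<in>poly_space N.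
      (LINT x|lebesgue_on T.
         (\<epsilon> x $ 1 $ 1 * ((elem N E1' T x - elem N E1 T x) / \<Delta>t)
          + \<epsilon> x $ 1 $ 2 * ((elem N E2' T x - elem N E2 T x) / \<Delta>t)) * u x)
      = (LINT x|lebesgue_on T. partial 2 (elem N Hz T) x * u x)
        + boundary_integral T (\<lambda>e x.
            - (outward_normal T e $ 2) * E_flux \<Omega> \<T> \<epsilon>T \<mu>T N bc \<alpha> E1 E2 Hz T e x * u x)
    \<and>
      (LINT x|lebesgue_on T.
         (\<epsilon> x $ 2 $ 1 * ((elem N E1' T x - elem N E1 T x) / \<Delta>t)
          + \<epsilon> x $ 2 $ 2 * ((elem N E2' T x - elem N E2 T x) / \<Delta>t)) * v x)
      = - (LINT x|lebesgue_on T. partial 1 (elem N Hz T) x * v x)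
        + boundary_integral T (\<lambda>e x.
            outward_normal T e $ 1 * E_flux \<Omega> \<T> \<epsilon>T \<mu>T N bc \<alpha> E1 E2 Hz T e x * v x)
    \<and>
      (LINT x|lebesgue_on T. \<mu> x * ((elem N Hz' T x - elem N Hz T x) / \<Delta>t) * w x)
      = (LINT x|lebesgue_on T.
           (partial 2 (elem N E1' T) x - partial 1 (elem N E2' T) x) * w x)
        + boundary_integral T (\<lambda>e x. H_flux \<Omega> \<T> \<epsilon>T \<mu>T N bc \<alpha> E1' E2' Hz T e x * w x))"

text \<open>\<open>Hz m\<close> stands for the magnetic field at time \<open>t\<^bsup>m+1/2\<^esup>\<close>.\<close>

definition leapfrog_solution ::
    "point set \<Rightarrow> point set set \<Rightarrow> (point \<Rightarrow> real^2^2) \<Rightarrow> (point \<Rightarrow> real)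
      \<Rightarrow> (point set \<Rightarrow> point \<Rightarrow> real^2^2) \<Rightarrow> (point set \<Rightarrow> point \<Rightarrow> real)
      \<Rightarrow> nat \<Rightarrow> boundary_condition \<Rightarrow> real \<Rightarrow> real \<Rightarrow> nat
      \<Rightarrow> (nat \<Rightarrow> point \<Rightarrow> real) \<Rightarrow> (nat \<Rightarrow> point \<Rightarrow> real) \<Rightarrow> (nat \<Rightarrow> point \<Rightarrow> real) \<Rightarrow> bool" where
  "leapfrog_solution \<Omega> \<T> \<epsilon> \<mu> \<epsilon>T \<mu>T N bc \<alpha> \<Delta>t M E1 E2 Hz \<longleftrightarrow>
     (\<forall>m\<le>M. (E1 m, E2 m, Hz m) \<in> dg_space \<Omega> \<T> N) \<and>
     (\<forall>m<M. leapfrog_step \<Omega> \<T> \<epsilon> \<mu> \<epsilon>T \<mu>T N bc \<alpha> \<Delta>t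
               (E1 m) (E2 m) (Hz m) (E1 (Suc m)) (E2 (Suc m)) (Hz (Suc m)))"

end

theory Submission
  imports Defs
begin

text \<open>
  The scheme is explicit, so the energy \<open>(\<epsilon> E, E) + (\<mu> H, H)\<close> itself need not decrease. The proof finds a
  perturbed energy that does decrease, and shows that the bound on the time step makes the perturbation a
  proper fraction of the energy.

  Let \<open>E\<close> and \<open>H\<close> be the fields at the times \<open>t\<^sup>m\<close> and \<open>t\<^bsup>m+1/2\<^esup>\<close>, and \<open>E'\<close> and \<open>H'\<close> those one step later.
  Testing the electric equations with \<open>E + E'\<close> and the magnetic equation with \<open>H + H'\<close> turns the left
  sides into differences of the weighted energies. On the right there is a bilinear form \<open>a(H, E)\<close>
  (\<open>curl_form\<close>), made of the element integrals of \<open>\<partial>\<^sub>y H E\<^sub>x - \<partial>\<^sub>x H E\<^sub>y\<close> and of the part of the electric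
  flux with weight \<open>Z\<^sup>+\<close>, and there are the penalty terms \<open>s\<^sub>E\<close>, \<open>s\<^sub>H\<close> that carry the flux parameter. Two
  facts organise these terms.

  \<^item> The form in the magnetic equation is \<open>-a\<close> (\<open>curl_form_adjoint\<close>). This is integration by parts on every
    triangle (\<open>triangle_divergence\<close>) together with a cancellation on the edges: the normal changes sign
    and the impedances \<open>Z\<^sup>-\<close>, \<open>Z\<^sup>+\<close> change places when an interior edge is seen from its other element,
    and on the boundary the jump factors of the electric and the magnetic field add up to 2 for each of
    the three boundary conditions. Adding the two balances leaves \<open>\<Delta>t (a(H, E) - a(H', E'))\<close>, which
    telescopes.
  \<^item> The penalty forms are symmetric and nonnegative. The explicit terms \<open>s(E, E + E')\<close> have no sign, but
    \<open>2 s(E, E + E') = s(E + E', E + E') + s(E, E) - s(E', E')\<close>, again a nonnegative term plus one that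
    telescopes.

  Hence \<open>W = (\<epsilon> E, E) + (\<mu> H, H) + \<Delta>t a(H, E) - \<Delta>t/2 (s\<^sub>E(E, E) + s\<^sub>H(H, H))\<close> does not increase
  (\<open>discrete_energy_decreases\<close>). For coercivity (\<open>coercivity\<close>), the element integrals in \<open>a\<close> are bounded
  by the inverse inequality. All edge terms together are bounded, at almost every point of every edge, by
  the squares of the one-sided values with the bracketed factors of \<open>C\<^sub>E\<close> and \<open>C\<^sub>H\<close> (\<open>skeleton_bound\<close>);
  the trace inequality then brings them back to the elements. The result is that \<open>W\<close> falls below the
  weighted energy by at most \<open>\<Delta>t max{C\<^sub>E, C\<^sub>H} / min h\<^sub>k\<close> times the squared \<open>L\<^sup>2\<close> norm, and the condition
  on \<open>\<Delta>t\<close> says that this factor is smaller than the lower bounds of the coefficients.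

  Two preparations have no counterpart in these formulas. An edge that is not contained in the boundary of
  the domain has exactly one further element (\<open>neighbor_properties\<close>), so exchanging the elements at an
  interior edge is an involution on the sides of edges, and every sum over sides may be symmetrised
  (\<open>skeleton_mono_mirrored\<close>). The traces of the coefficients inherit the bounds of the coefficients
  (\<open>trace_in_closed\<close>), so the essential infima of \<open>Z\<close> and \<open>1/Z\<close> are positive and bound \<open>Z\<close> and \<open>1/Z\<close> from
  below almost everywhere.
\<close>

section \<open>Triangles in the plane\<close>

definition cross2 :: "point \<Rightarrow> point \<Rightarrow> real" where
  "cross2 u v = u $ 1 * v $ 2 - u $ 2 * v $ 1"

definition rot_right :: "point \<Rightarrow> point" where
  "rot_right u = vector [u $ 2, - (u $ 1)]"

lemma rot_right_nth [simp]: "rot_right u $ 1 = u $ 2" "rot_right u $ 2 = - (u $ 1)"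
  by (simp_all add: rot_right_def)

lemma inner_plane: "(u::point) \<bullet> v = u $ 1 * v $ 1 + u $ 2 * v $ 2"
  by (simp add: inner_vec_def sum_2)

lemma plane_eqI: "(u::point) $ 1 = v $ 1 \<Longrightarrow> u $ 2 = v $ 2 \<Longrightarrow> u = v"
  by (simp add: vec_eq_iff forall_2)

lemma inner_rot_right: "rot_right u \<bullet> v = - cross2 u v"
  by (simp add: inner_plane cross2_def)

lemma norm_rot_right [simp]: "norm (rot_right u) = norm u"
  by (simp add: norm_eq_sqrt_inner inner_plane algebra_simps)

lemma rot_right_minus [simp]: "rot_right (- u) = - rot_right u"
  by (rule plane_eqI) auto

lemma cross2_simps:
  "cross2 (u + v) w = cross2 u w + cross2 v w" "cross2 u (v + w) = cross2 u v + cross2 u w"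
  "cross2 (u - v) w = cross2 u w - cross2 v w" "cross2 u (v - w) = cross2 u v - cross2 u w"
  "cross2 (r *\<^sub>R u) w = r * cross2 u w" "cross2 u (r *\<^sub>R w) = r * cross2 u w"
  "cross2 u u = 0" "cross2 (-u) v = - cross2 u v" "cross2 u (-v) = - cross2 u v"
  by (simp_all add: cross2_def algebra_simps)

lemma cross2_swap: "cross2 v u = - cross2 u v"
  by (simp add: cross2_def)

lemma cramer2:
  assumes "cross2 u v \<noteq> 0"
  shows "w = (cross2 w v / cross2 u v) *\<^sub>R u + (cross2 u w / cross2 u v) *\<^sub>R v"
proof (rule plane_eqI)
  show "w $ 1 = ((cross2 w v / cross2 u v) *\<^sub>R u + (cross2 u w / cross2 u v) *\<^sub>R v) $ 1"
    using assms by (simp add: divide_simps) (simp add: cross2_def algebra_simps)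
  show "w $ 2 = ((cross2 w v / cross2 u v) *\<^sub>R u + (cross2 u w / cross2 u v) *\<^sub>R v) $ 2"
    using assms by (simp add: divide_simps) (simp add: cross2_def algebra_simps)
qed

text \<open>The vertices are listed counterclockwise. With this orientation, turning an edge vector by a right
  angle to the right gives the direction of the outward normal, and the formula is invariant under
  rotating the three vertices.\<close>

definition ccw_triangle :: "point \<Rightarrow> point \<Rightarrow> point \<Rightarrow> point set \<Rightarrow> bool" where
  "ccw_triangle a b c T \<longleftrightarrow> T = convex hull {a, b, c} \<and> cross2 (b - a) (c - a) > 0"

lemma ccw_triangle_rotate: "ccw_triangle a b c T \<Longrightarrow> ccw_triangle b c a T"
  unfolding ccw_triangle_def
  by (auto simp: insert_commute cross2_def algebra_simps)

lemma ccw_distinct: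
  assumes "ccw_triangle a b c T" shows "a \<noteq> b" "b \<noteq> c" "c \<noteq> a"
  using assms unfolding ccw_triangle_def by (auto simp: cross2_def)

lemma parallel_if_cross2_0:
  assumes "cross2 u v = 0" "u \<noteq> 0" shows "v = ((u \<bullet> v) / (u \<bullet> u)) *\<^sub>R u"
proof -
  have nz: "u \<bullet> u \<noteq> 0" using assms by simp
  have c: "u $ 1 * v $ 2 = u $ 2 * v $ 1" using assms by (simp add: cross2_def)
  have "(u \<bullet> u) *\<^sub>R v = (u \<bullet> v) *\<^sub>R u"
  proof (rule plane_eqI)
    show "((u \<bullet> u) *\<^sub>R v) $ 1 = ((u \<bullet> v) *\<^sub>R u) $ 1"
      using c unfolding inner_plane by simp algebra
    show "((u \<bullet> u) *\<^sub>R v) $ 2 = ((u \<bullet> v) *\<^sub>R u) $ 2"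
      using c unfolding inner_plane by simp algebra
  qed
  then have "(1 / (u \<bullet> u)) *\<^sub>R (u \<bullet> u) *\<^sub>R v = (1 / (u \<bullet> u)) *\<^sub>R (u \<bullet> v) *\<^sub>R u" by simp
  then show ?thesis using nz by simp
qed

lemma cross2_nonzero_not_affine_dependent:
  assumes "cross2 (b - a) (c - a) \<noteq> 0" shows "\<not> affine_dependent {a, b, c}"
proof
  assume ad: "affine_dependent {a, b, c}"
  have "collinear {a, b, c}" using ad collinear_3_eq_affine_dependent by blast
  then obtain u where u: "\<And>x y. x \<in> {a,b,c} \<Longrightarrow> y \<in> {a,b,c} \<Longrightarrow> \<exists>r. x - y = r *\<^sub>R u"
    unfolding collinear_def by blast
  obtain r s where "b - a = r *\<^sub>R u" "c - a = s *\<^sub>R u" using u[of b a] u[of c a] by auto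
  then show False using assms by (simp add: cross2_simps)
qed

lemma cross2_0_affine_dependent:
  assumes "cross2 (b - a) (c - a) = 0" "b \<noteq> a" "c \<noteq> a" "b \<noteq> c" shows "affine_dependent {a, b, c}"
proof -
  have "c - a = (((b-a) \<bullet> (c-a)) / ((b-a) \<bullet> (b-a))) *\<^sub>R (b - a)"
    using parallel_if_cross2_0[OF assms(1)] assms by simp
  then obtain r where r: "c - a = r *\<^sub>R (b - a)" by blast
  then have "c = (1 - r) *\<^sub>R a + r *\<^sub>R b" by (simp add: algebra_simps)
  moreover have "(1 - r) + r = 1" by simp
  ultimately have "c \<in> affine hull {a, b}" unfolding affine_hull_2 by blast
  then have "c \<in> affine hull ({a, b, c} - {c})"
    using assms by (simp add: insert_Diff_if)
  then show ?thesis unfolding affine_dependent_def by blast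
qed

lemma simplex_2_ccw:
  assumes "2 simplex (T :: point set)" obtains a b c where "ccw_triangle a b c T"
proof -
  obtain C where C: "\<not> affine_dependent C" "card C = 3" "T = convex hull C"
    using assms unfolding simplex_def by auto
  then obtain a b c where abc: "C = {a,b,c}" "a \<noteq> b" "b \<noteq> c" "c \<noteq> a"
    by (auto simp: card_3_iff)
  then have "cross2 (b - a) (c - a) \<noteq> 0" using cross2_0_affine_dependent[of b a c] C by auto
  then consider "cross2 (b - a) (c - a) > 0" | "cross2 (c - a) (b - a) > 0"
    using cross2_swap[of "c - a" "b - a"] by linarith
  then show thesis
  proof cases
    case 1 then show ?thesis using that[of a b c] C abc by (simp add: ccw_triangle_def)
  next
    case 2 then show ?thesis using that[of a c b] C abc
      by (simp add: ccw_triangle_def insert_commute)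
  qed
qed

text \<open>For affinely independent vertices the faces of the hull are the hulls of the subsets of the
  vertices.\<close>

lemma ccw_edges:
  assumes "ccw_triangle a b c T"
  shows "{e. e edge_of T} = {closed_segment a b, closed_segment b c, closed_segment c a}"
proof -
  have T: "T = convex hull {a,b,c}" and ind: "\<not> affine_dependent {a,b,c}"
    using assms cross2_nonzero_not_affine_dependent unfolding ccw_triangle_def by (auto simp: less_le)
  have d: "a \<noteq> b" "b \<noteq> c" "c \<noteq> a" using ccw_distinct[OF assms] by auto
  have "e edge_of T \<longleftrightarrow> (\<exists>C \<subseteq> {a,b,c}. e = convex hull C \<and> card C = 2)" for e
  proof -
    have "aff_dim (convex hull C) = 1 \<longleftrightarrow> card C = 2" if "C \<subseteq> {a,b,c}" for C
      using aff_dim_affine_independent[OF affine_independent_subset[OF ind that]]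
      by (auto simp: aff_dim_convex_hull)
    then show ?thesis
      unfolding edge_of_def T face_of_convex_hull_affine_independent[OF ind] by blast
  qed
  moreover have "C \<subseteq> {a,b,c} \<and> card C = 2 \<longleftrightarrow> C = {a,b} \<or> C = {b,c} \<or> C = {c,a}" for C
  proof
    assume "C \<subseteq> {a,b,c} \<and> card C = 2"
    then obtain x y where "C = {x,y}" "x \<noteq> y" "x \<in> {a,b,c}" "y \<in> {a,b,c}"
      by (auto simp: card_2_iff)
    then show "C = {a,b} \<or> C = {b,c} \<or> C = {c,a}" by (auto simp: insert_commute)
  qed (use d in auto)
  ultimately have "e edge_of T \<longleftrightarrow> e = convex hull {a,b} \<or> e = convex hull {b,c} \<or> e = convex hull {c,a}"
    for e by metis
  then show ?thesis unfolding segment_convex_hull by blast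
qed

lemma ccw_edges_distinct:
  assumes "ccw_triangle a b c T"
  shows "distinct [closed_segment a b, closed_segment b c, closed_segment c a]"
  using ccw_distinct[OF assms] by (auto simp: closed_segment_eq doubleton_eq_iff)

text \<open>Any edge may be taken as the first one, since the vertices can be rotated.\<close>

lemma edge_ccw:
  assumes "2 simplex T" "e edge_of T"
  obtains a b c where "ccw_triangle a b c T" "e = closed_segment a b"
proof -
  obtain a b c where abc: "ccw_triangle a b c T" using simplex_2_ccw assms by blast
  have bca: "ccw_triangle b c a T" using ccw_triangle_rotate abc by blast
  have cab: "ccw_triangle c a b T" using ccw_triangle_rotate bca by blast
  show thesis using assms(2) ccw_edges[OF abc] that[OF abc] that[OF bca] that[OF cab] by blast
qed

lemma ccw_mem_iff:
  assumes "ccw_triangle a b c T"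
  shows "x \<in> T \<longleftrightarrow> (\<exists>s t. 0 \<le> s \<and> 0 \<le> t \<and> s + t \<le> 1 \<and> x = a + s *\<^sub>R (b - a) + t *\<^sub>R (c - a))"
  using assms unfolding ccw_triangle_def convex_hull_3_alt by (auto)

lemma ccw_half_plane:
  assumes "ccw_triangle a b c T" "x \<in> closed_segment a b" "y \<in> T"
  shows "rot_right (b - a) \<bullet> (y - x) \<le> 0"
proof -
  obtain s t where st: "0 \<le> s" "0 \<le> t" "s + t \<le> 1" "y = a + s *\<^sub>R (b - a) + t *\<^sub>R (c - a)"
    using assms ccw_mem_iff by blast
  obtain r where r: "x = a + r *\<^sub>R (b - a)" using assms(2) unfolding closed_segment_def
    by (auto simp: algebra_simps)
  have "y - x = (s - r) *\<^sub>R (b - a) + t *\<^sub>R (c - a)" unfolding st r by (simp add: algebra_simps)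
  then have "cross2 (b - a) (y - x) = t * cross2 (b - a) (c - a)"
    unfolding \<open>y - x = _\<close> cross2_simps(2,6,7) by simp
  then show ?thesis using assms(1) st unfolding inner_rot_right ccw_triangle_def by simp
qed

text \<open>Exchanging the end points of the edge in the defining condition makes the normal orthogonal to the
  edge; the third vertex then fixes its sign.\<close>

lemma outward_normal_ccw:
  assumes "ccw_triangle a b c T"
  shows "outward_normal T (closed_segment a b) = sgn (rot_right (b - a))"
  unfolding outward_normal_def
proof (rule the_equality)
  have ne: "rot_right (b - a) \<noteq> 0" using ccw_distinct[OF assms] norm_rot_right[of "b - a"]
    by (metis eq_iff_diff_eq_0 norm_eq_zero)
  have "sgn (rot_right (b - a)) \<bullet> (y - x) \<le> 0" if "x \<in> closed_segment a b" "y \<in> T" for x y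
    using ccw_half_plane[OF assms that] ne by (simp add: sgn_div_norm mult_le_0_iff)
  then show "norm (sgn (rot_right (b - a))) = 1 \<and>
      (\<forall>x\<in>closed_segment a b. \<forall>y\<in>T. sgn (rot_right (b - a)) \<bullet> (y - x) \<le> 0)"
    using ne by (simp add: norm_sgn)
next
  fix n assume n: "norm n = 1 \<and> (\<forall>x\<in>closed_segment a b. \<forall>y\<in>T. n \<bullet> (y - x) \<le> 0)"
  have T: "T = convex hull {a,b,c}" and D: "cross2 (b - a) (c - a) > 0"
    using assms by (auto simp: ccw_triangle_def)
  have mem: "a \<in> T" "b \<in> T" "c \<in> T" unfolding T by (auto intro: hull_inc)
  have "n \<bullet> (b - a) \<le> 0" "n \<bullet> (a - b) \<le> 0" "n \<bullet> (c - a) \<le> 0" using n mem by auto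
  then have perp: "n \<bullet> (b - a) = 0" and neg: "n \<bullet> (c - a) \<le> 0"
    by (auto simp: inner_diff_right)
  define R where "R = rot_right (b - a)"
  have Rne: "R \<noteq> 0" using ccw_distinct[OF assms] norm_rot_right[of "b - a"] unfolding R_def
    by (metis eq_iff_diff_eq_0 norm_eq_zero)
  have "cross2 R n = 0" using perp by (simp add: R_def cross2_def inner_plane algebra_simps)
  from parallel_if_cross2_0[OF this Rne] obtain k where k: "n = k *\<^sub>R R" by blast
  have "n \<bullet> (c - a) = - k * cross2 (b - a) (c - a)" using k inner_rot_right[of "b - a" "c - a"]
      by (simp add: R_def)
  then have "k \<ge> 0" using neg D by (simp add: mult_le_0_iff zero_le_mult_iff)
  moreover have "\<bar>k\<bar> * norm R = 1" using n k by simp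
  ultimately show "n = sgn (rot_right (b - a))" unfolding k R_def[symmetric] sgn_div_norm
    using Rne by (simp add: divide_simps)
qed

lemma cross2_nonzero_aff_dim: 
  assumes "cross2 (b - a) (c - a) \<noteq> 0" shows "aff_dim {a, b, c} = 2"
proof -
  have "a \<noteq> b" "b \<noteq> c" "c \<noteq> a" using assms by (auto simp: cross2_def)
  then show ?thesis
  using aff_dim_affine_independent[OF cross2_nonzero_not_affine_dependent[OF assms]] by simp
qed

lemma simplex_convex: "n simplex T \<Longrightarrow> convex T"
  unfolding simplex_def by auto

text \<open>Two triangles on the same side of a common edge overlap: a point close to the midpoint of the edge,
  on the way to the third vertex of one of them, lies in both. The intersection is then a two-dimensional
  face of both, so both coincide with it.\<close>

lemma same_side_triangles_eq:
  assumes T: "ccw_triangle a b c T" and T': "ccw_triangle a b c' T'"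
    and f: "(T \<inter> T') face_of T" and f': "(T \<inter> T') face_of T'"
  shows "T = T'"
proof -
  define u v D where "u = b - a" and "v = c' - a" and "D = cross2 u v"
  have D: "D > 0" "cross2 u (c - a) > 0" using T T' by (auto simp: D_def u_def v_def ccw_triangle_def)
  \<comment> \<open>\<open>p l\<close> runs from the midpoint of the edge (\<open>l = 0\<close>) to \<open>c\<close>; \<open>s l\<close> and \<open>t l\<close> are its coordinates in the
    frame of the other triangle, which tend to \<open>1/2\<close> and \<open>0\<close>.\<close>
  define p where "p l = a + ((1 - l) / 2) *\<^sub>R u + l *\<^sub>R (c - a)" for l :: real
  define s where "s l = cross2 (p l - a) v / D" for l
  define t where "t l = cross2 u (p l - a) / D" for l
  have "s \<midarrow>0\<rightarrow> 1/2"
  proof -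
    have "s l = (1 - l) / 2 + l * cross2 (c - a) v / D" for l
      using D unfolding s_def p_def by (simp add: cross2_simps D_def add_divide_distrib)
    then have "s = (\<lambda>l. (1 - l) / 2 + l * cross2 (c - a) v / D)" by blast
    then show ?thesis using D by (auto intro!: tendsto_eq_intros)
  qed
  then have s0: "(s \<longlongrightarrow> 1/2) (at_right 0)" by (rule filterlim_mono) (auto intro: at_le)
  have tl: "t l = l * cross2 u (c - a) / D" for l
      using D unfolding t_def p_def by (simp add: cross2_simps D_def add_divide_distrib)
  have "t = (\<lambda>l. l * cross2 u (c - a) / D)" using tl by blast
  then have t0: "(t \<longlongrightarrow> 0) (at_right 0)" using D by (auto intro!: tendsto_eq_intros)
  have st0: "((\<lambda>l. s l + t l) \<longlongrightarrow> 1/2) (at_right 0)" using tendsto_add[OF s0 t0] by simp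
  have "eventually (\<lambda>l. s l > 0) (at_right 0)" "eventually (\<lambda>l. s l + t l < 1) (at_right 0)"
    using order_tendstoD(1)[OF s0, of 0] order_tendstoD(2)[OF st0, of 1] by auto
  moreover have "eventually (\<lambda>l. l > 0 \<and> l < 1) (at_right (0::real))" 
    by (intro eventually_conj eventually_at_right_less eventually_at_rightI[of 0 1]) auto
  ultimately have "eventually (\<lambda>l. (s l > 0 \<and> s l + t l < 1) \<and> (l > 0 \<and> l < 1)) (at_right (0::real))"
    by eventually_elim auto
  then obtain l where l: "s l > 0" "s l + t l < 1" "l > 0" "l < 1"
    using eventually_happens'[OF trivial_limit_at_right_real] by blast
  have pT: "p l \<in> T" unfolding ccw_mem_iff[OF T] p_def u_def
  proof (intro exI conjI)
    show "0 \<le> (1 - l) / 2" "0 \<le> l" "(1 - l) / 2 + l \<le> 1" using l by (auto simp: field_simps)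
  qed (rule refl)
  have "p l = a + s l *\<^sub>R u + t l *\<^sub>R v"
    using cramer2[of u v "p l - a"] D unfolding s_def t_def D_def
      by (metis add.assoc add_diff_cancel_left' add_diff_eq less_irrefl)
  then have pT': "p l \<in> T'" unfolding ccw_mem_iff[OF T'] u_def v_def
    using l D by (intro exI[of _ "s l"] exI[of _ "t l"]) (auto simp: tl)
  have ab: "a \<in> T" "b \<in> T" "a \<in> T'" "b \<in> T'"
    using T T' unfolding ccw_triangle_def by (auto intro: hull_inc)
  have "cross2 (b - a) (p l - a) \<noteq> 0" using l D unfolding p_def u_def by (simp add: cross2_simps)
  from cross2_nonzero_aff_dim[OF this] have "aff_dim (T \<inter> T') \<ge> 2"
    using aff_dim_subset[of "{a, b, p l}" "T \<inter> T'"] ab pT pT' by simp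
  moreover have "aff_dim T = 2" "aff_dim T' = 2" "convex T" "convex T'"
    using T T' cross2_nonzero_aff_dim by (auto simp: ccw_triangle_def aff_dim_convex_hull)
  ultimately have "T \<inter> T' = T" "T \<inter> T' = T'"
    using face_of_aff_dim_lt[OF _ f] face_of_aff_dim_lt[OF _ f'] by fastforce+
  then show ?thesis by blast
qed

section \<open>The two elements at an interior edge\<close>

definition shares_edge :: "point set set \<Rightarrow> point set \<Rightarrow> point set \<Rightarrow> point set \<Rightarrow> bool" where
  "shares_edge \<T> T e T' \<longleftrightarrow> T' \<in> \<T> \<and> T' \<noteq> T \<and> e edge_of T'"

lemma mesh_simplex: "conforming_mesh \<Omega> \<T> \<Longrightarrow> T \<in> \<T> \<Longrightarrow> 2 simplex T"
  by (simp add: conforming_mesh_def)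

lemma mesh_finite: "conforming_mesh \<Omega> \<T> \<Longrightarrow> finite \<T>"
  by (simp add: conforming_mesh_def triangulation_def)

lemma mesh_Int_face:
  assumes "conforming_mesh \<Omega> \<T>" "T \<in> \<T>" "T' \<in> \<T>"
  shows "(T \<inter> T') face_of T" "(T \<inter> T') face_of T'"
  using assms unfolding conforming_mesh_def triangulation_def by (metis Int_commute)+

lemma simplex_2_aff_dim: "2 simplex (T::point set) \<Longrightarrow> aff_dim T = 2"
  by (metis simplex_2_ccw ccw_triangle_def cross2_nonzero_aff_dim aff_dim_convex_hull less_irrefl)

lemma simplex_2_compact: "2 simplex (T::point set) \<Longrightarrow> compact T"
  by (metis simplex_2_ccw ccw_triangle_def compact_convex_hull finite.emptyI finite.insertI finite_imp_compact)

lemma diameter_simplex_pos: assumes "2 simplex (T::point set)" shows "diameter T > 0"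
proof -
  obtain a b c where abc: "ccw_triangle a b c T" using simplex_2_ccw assms by blast
  then have "a \<in> T" "b \<in> T" unfolding ccw_triangle_def by (auto intro: hull_inc)
  then have "dist a b \<le> diameter T"
    using diameter_bounded_bound compact_imp_bounded simplex_2_compact[OF assms] by blast
  then show ?thesis using ccw_distinct(1)[OF abc] by (metis dist_pos_lt less_le_trans)
qed

lemma mesh_Int_aff_dim:
  assumes "conforming_mesh \<Omega> \<T>" "T \<in> \<T>" "T' \<in> \<T>" "T \<noteq> T'"
  shows "aff_dim (T \<inter> T') < 2"
proof -
  have d: "aff_dim T = 2" "aff_dim T' = 2" "convex T" "convex T'"
    using mesh_simplex assms simplex_2_aff_dim simplex_convex by blast+
  show ?thesis
  proof (rule ccontr)
    assume "\<not> aff_dim (T \<inter> T') < 2"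
    then have "T \<inter> T' = T" "T \<inter> T' = T'"
      using face_of_aff_dim_lt[OF d(3) mesh_Int_face(1)[OF assms(1-3)]]
        face_of_aff_dim_lt[OF d(4) mesh_Int_face(2)[OF assms(1-3)]] d(1,2) by linarith+
    then show False using assms(4) by blast
  qed
qed

text \<open>The edge can be traversed in two directions. Traversed in the same direction, counterclockwise in
  both elements, it would have both on the same side, which is excluded by \<open>same_side_triangles_eq\<close>.\<close>

lemma edge_normals:
  assumes m: "conforming_mesh \<Omega> \<T>" and T: "T \<in> \<T>" "e edge_of T" and T': "T' \<in> \<T>" "e edge_of T'"
    and ne: "T \<noteq> T'"
  shows "outward_normal T' e = - outward_normal T e"
proof -
  obtain a b c where abc: "ccw_triangle a b c T" "e = closed_segment a b"
    using edge_ccw[OF mesh_simplex[OF m T(1)] T(2)] by blast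
  obtain a' b' c' where abc': "ccw_triangle a' b' c' T'" "e = closed_segment a' b'"
    using edge_ccw[OF mesh_simplex[OF m T'(1)] T'(2)] by blast
  have "{a,b} = {a',b'}" using abc(2) abc'(2) by (simp add: closed_segment_eq)
  then consider "a' = a" "b' = b" | "a' = b" "b' = a" by (auto simp: doubleton_eq_iff)
  then show ?thesis
  proof cases
    case 1
    then show ?thesis using same_side_triangles_eq[OF abc(1)] abc'(1) mesh_Int_face[OF m T(1) T'(1)] ne by blast
  next
    case 2
    have "rot_right (a - b) = - rot_right (b - a)" by (metis minus_diff_eq rot_right_minus)
    then show ?thesis
      using outward_normal_ccw[OF abc'(1)] outward_normal_ccw[OF abc(1)] 2 abc(2) abc'(2)
      by (simp add: closed_segment_commute sgn_minus)
  qed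
qed

lemma norm_outward_normal:
  assumes "2 simplex T" "e edge_of T" shows "norm (outward_normal T e) = 1"
proof -
  obtain a b c where abc: "ccw_triangle a b c T" "e = closed_segment a b"
    using edge_ccw assms by blast
  have "norm (rot_right (b - a)) \<noteq> 0" using ccw_distinct[OF abc(1)] by simp
  then show ?thesis 
    unfolding abc(2) outward_normal_ccw[OF abc(1)] norm_sgn by (metis norm_zero)
qed

text \<open>The domain is open, so it contains a point \<open>p\<close> of the relative interior of the edge, and points just
  outside the element next to \<open>p\<close>. Such a point lies in another element, and if it is close enough to \<open>p\<close>,
  that element contains \<open>p\<close>. The intersection of the two elements is a face that meets the relative
  interior of the edge, hence it is the edge.\<close>

lemma neighbor_exists:
  assumes dom: "open \<Omega>" and m: "conforming_mesh \<Omega> \<T>" and T: "T \<in> \<T>" "e edge_of T"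
    and int: "\<not> e \<subseteq> frontier \<Omega>"
  shows "\<exists>T'. shares_edge \<T> T e T'"
proof -
  obtain a b c where abc: "ccw_triangle a b c T" "e = closed_segment a b"
    using edge_ccw[OF mesh_simplex[OF m T(1)] T(2)] by blast
  have union: "\<Union>\<T> = closure \<Omega>" using m by (simp add: conforming_mesh_def)
  have eT: "e \<subseteq> T" using T(2) edge_of_imp_subset by blast
  then have "e \<subseteq> closure \<Omega>" using T union by blast
  then have "e \<inter> \<Omega> \<noteq> {}" using int dom by (auto simp: frontier_def interior_open)
  have ab: "a \<noteq> b" using ccw_distinct abc by blast
  then have "e = closure (open_segment a b)" unfolding abc by simp
  then have "open_segment a b \<inter> \<Omega> \<noteq> {}" using \<open>e \<inter> \<Omega> \<noteq> {}\<close> dom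
    by (metis Int_commute open_Int_closure_eq_empty)
  then obtain p where p: "p \<in> open_segment a b" "p \<in> \<Omega>" by blast
  \<comment> \<open>Staying away from \<open>K\<close> forces the element found below to contain \<open>p\<close>.\<close>
  define K where "K = \<Union>{T'\<in>\<T>. p \<notin> T'}"
  have "closed K" unfolding K_def
    using mesh_finite[OF m] mesh_simplex[OF m] simplex_2_compact compact_imp_closed
    by (intro closed_Union) auto
  then have "open (\<Omega> - K)" "p \<in> \<Omega> - K" using dom p by (auto simp: K_def)
  then obtain d where d: "d > 0" "ball p d \<subseteq> \<Omega> - K" using openE by metis
  define n where "n = outward_normal T e"
  have nn: "norm n = 1" unfolding n_def using norm_outward_normal[OF mesh_simplex[OF m T(1)] T(2)] .
  define q where "q = p + (d/2) *\<^sub>R n"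
  have "q \<in> ball p d" using d nn by (simp add: q_def dist_norm)
  then have q: "q \<in> \<Omega>" "q \<notin> K" using d by auto
  then obtain T' where T': "T' \<in> \<T>" "q \<in> T'" using union closure_subset by blast
  have pT': "p \<in> T'" using q T' unfolding K_def by blast
  have pe: "p \<in> e" using p abc open_closed_segment by blast
  have "q \<notin> T"
  proof
    assume "q \<in> T"
    then have "rot_right (b - a) \<bullet> (q - p) \<le> 0" using ccw_half_plane[OF abc(1)] pe abc(2) by blast
    moreover have "n = sgn (rot_right (b - a))" unfolding n_def abc(2) by (rule outward_normal_ccw[OF abc(1)])
    then have "rot_right (b - a) \<bullet> n = norm (b - a)"
      using ab by (simp add: sgn_div_norm dot_square_norm power2_eq_square)
    moreover have "rot_right (b - a) \<bullet> (q - p) = d / 2 * (rot_right (b - a) \<bullet> n)" by (simp add: q_def)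
    ultimately have "d * norm (b - a) \<le> 0" by simp
    then show False using d(1) ab by (simp add: mult_le_0_iff)
  qed
  then have ne: "T' \<noteq> T" using T' by blast
  have f: "(T \<inter> T') face_of T" "(T \<inter> T') face_of T'" using mesh_Int_face[OF m T(1) T'(1)] .
  have "a \<in> T" "b \<in> T" using eT abc(2) by auto
  then have "a \<in> T \<inter> T' \<and> b \<in> T \<inter> T'"
    using f(1) p(1) pe eT pT' unfolding face_of_def by blast
  then have sub: "e \<subseteq> T \<inter> T'"
    unfolding abc(2) by (intro closed_segment_subset) (auto intro: face_of_imp_convex[OF f(1)] 
      simp: convex_Int simplex_convex[OF mesh_simplex[OF m]] T T')
  have efT: "e face_of T" and ed: "aff_dim e = 1" using T(2) by (auto simp: edge_of_def)
  have eTT: "e face_of (T \<inter> T')" using face_of_subset[OF efT sub] by blast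
  have "aff_dim (T \<inter> T') < 2" using mesh_Int_aff_dim[OF m T(1) T'(1)] ne by blast
  then have "\<not> aff_dim e < aff_dim (T \<inter> T')" using ed by linarith
  then have "e = T \<inter> T'" using face_of_aff_dim_lt[OF _ eTT]
    by (metis convex_Int simplex_convex mesh_simplex m T(1) T'(1))
  then have "e edge_of T'" using f(2) ed by (simp add: edge_of_def)
  then show ?thesis using T' ne unfolding shares_edge_def by blast
qed

text \<open>Three elements at one edge would have pairwise opposite normals.\<close>

lemma neighbor_unique:
  assumes m: "conforming_mesh \<Omega> \<T>" and T: "T \<in> \<T>" "e edge_of T"
    and "shares_edge \<T> T e T1" "shares_edge \<T> T e T2" shows "T1 = T2"
proof (rule ccontr)
  assume ne: "T1 \<noteq> T2"
  note s = assms(4,5)[unfolded shares_edge_def]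
  have "outward_normal T1 e = - outward_normal T e" "outward_normal T2 e = - outward_normal T e"
       "outward_normal T2 e = - outward_normal T1 e"
    using edge_normals[OF m] T s ne by metis+
  then have "outward_normal T e = - outward_normal T e" by simp
  then have "outward_normal T e = 0"
    by (simp add: eq_neg_iff_add_eq_0 vec_eq_iff)
  then show False using norm_outward_normal[OF mesh_simplex[OF m T(1)] T(2)] by simp
qed

lemma neighbor_properties:
  assumes dom: "open \<Omega>" and m: "conforming_mesh \<Omega> \<T>" and T: "T \<in> \<T>" "e edge_of T"
    and int: "\<not> e \<subseteq> frontier \<Omega>"
  defines "T' \<equiv> neighbor \<T> T e"
  shows "T' \<in> \<T>" "e edge_of T'" "neighbor \<T> T' e = T" "outward_normal T' e = - outward_normal T e"
proof -
  have ex1: "\<exists>!T'. shares_edge \<T> T e T'"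
    using neighbor_exists[OF dom m T int] neighbor_unique[OF m T] by blast
  have s: "shares_edge \<T> T e T'" using theI'[OF ex1] unfolding T'_def neighbor_def shares_edge_def .
  then show T': "T' \<in> \<T>" "e edge_of T'" unfolding shares_edge_def by auto
  show "neighbor \<T> T' e = T" unfolding neighbor_def
  proof (rule the_equality)
    show "T \<in> \<T> \<and> T \<noteq> T' \<and> e edge_of T" using T s unfolding shares_edge_def by auto
    show "S = T" if "S \<in> \<T> \<and> S \<noteq> T' \<and> e edge_of S" for S
      using neighbor_unique[OF m T', of S T] that T s unfolding shares_edge_def by metis
  qed
  show "outward_normal T' e = - outward_normal T e"
    using edge_normals[OF m T T'] s unfolding shares_edge_def by blast
qed

section \<open>Edge integrals and the divergence theorem on a triangle\<close>

text \<open>The measure is defined through an arbitrary choice of the end points. A segment determines its end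
  points up to order, so the choice yields one of the two parametrisations.\<close>

lemma edge_measure_ex:
  obtains p q where "{p, q} = {a, b}" "closed_segment a b = closed_segment p q"
    "edge_measure (closed_segment a b) =
       distr (lebesgue_on {0..dist p q}) borel (\<lambda>s. p + s *\<^sub>R sgn (q - p))"
proof -
  define r where "r = (SOME p. closed_segment a b = closed_segment (fst p) (snd p))"
  have "closed_segment a b = closed_segment (fst r) (snd r)"
    unfolding r_def by (rule someI[of _ "(a, b)"]) simp
  then show thesis
    using that[of "fst r" "snd r"] unfolding edge_measure_def r_def[symmetric] Let_def
    by (simp add: closed_segment_eq)
qed

lemma segment_param_measurable [measurable]:
  "(\<lambda>s. p + s *\<^sub>R w) \<in> lebesgue_on {0..l::real} \<rightarrow>\<^sub>M (borel :: point measure)"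
  by (intro measurable_restrict_space1 measurable_completion)
    (simp add: borel_measurable_continuous_onI continuous_intros)

lemma sets_edge_measure [measurable_cong, simp]: "sets (edge_measure e) = sets borel"
  by (simp add: edge_measure_def Let_def)

lemma space_edge_measure [simp]: "space (edge_measure e) = UNIV"
  by (simp add: edge_measure_def Let_def)

lemma finite_edge_measure: "finite_measure (edge_measure e)"
  unfolding edge_measure_def Let_def
  by (intro finite_measure.finite_measure_distr segment_param_measurable finite_measure_lebesgue_on) auto

lemma AE_edge_measure_mem:
  shows "AE x in edge_measure (closed_segment a b). x \<in> closed_segment a b"
proof -
  obtain p q where pq: "closed_segment a b = closed_segment p q"
    "edge_measure (closed_segment a b) =
       distr (lebesgue_on {0..dist p q}) borel (\<lambda>s. p + s *\<^sub>R sgn (q - p))"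
    using edge_measure_ex by metis
  have "p + s *\<^sub>R sgn (q - p) \<in> closed_segment p q" if "0 \<le> s" "s \<le> dist p q" for s
  proof (cases "p = q")
    case False
    then have d: "dist p q > 0" by simp
    have "p + s *\<^sub>R sgn (q - p) = (1 - s / dist p q) *\<^sub>R p + (s / dist p q) *\<^sub>R q"
      by (simp add: sgn_div_norm dist_norm norm_minus_commute algebra_simps divide_inverse)
    then show ?thesis using that d by (auto simp: closed_segment_def intro!: exI[of _ "s / dist p q"])
  qed (use that in simp)
  moreover have "closed_segment p q \<in> sets borel" by (simp add: borel_closed)
  ultimately have "AE x in distr (lebesgue_on {0..dist p q}) borel (\<lambda>s. p + s *\<^sub>R sgn (q - p)).
      x \<in> closed_segment p q"
    by (subst AE_distr_iff) (auto intro!: AE_I2)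
  then show ?thesis unfolding pq(1)[symmetric] pq(2)[symmetric] .
qed

lemma emeasure_edge_measure_nonzero:
  assumes "a \<noteq> b" shows "emeasure (edge_measure (closed_segment a b)) UNIV \<noteq> 0"
proof -
  obtain p q where pq: "{p, q} = {a, b}"
    "edge_measure (closed_segment a b) =
       distr (lebesgue_on {0..dist p q}) borel (\<lambda>s. p + s *\<^sub>R sgn (q - p))"
    using edge_measure_ex by metis
  then have "dist p q > 0" using assms by (auto simp: doubleton_eq_iff)
  then show ?thesis unfolding pq(2)
    by (subst emeasure_distr) (auto simp: emeasure_restrict_space)
qed

text \<open>The mean value over the segment; in contrast to the edge measure it uses the end points as they are
  given.\<close>

definition segment_mean :: "(point \<Rightarrow> real) \<Rightarrow> point \<Rightarrow> point \<Rightarrow> real" where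
  "segment_mean f a b = integral {0..1} (\<lambda>s. f (a + s *\<^sub>R (b - a)))"

lemma segment_mean_commute:
  assumes "continuous_on UNIV f" shows "segment_mean f a b = segment_mean f b a"
proof -
  have "continuous_on {0..1} (\<lambda>s. f (a + s *\<^sub>R (b - a)))"
    by (intro continuous_on_compose2[OF assms] continuous_intros) auto
  then have "((\<lambda>s. f (a + s *\<^sub>R (b - a))) has_integral segment_mean f a b) (cbox 0 (1::real))"
    unfolding segment_mean_def by (simp add: integrable_continuous_real integrable_integral)
  from has_integral_affinity[OF this, of "-1" 1]
  have "((\<lambda>s. f (a + (1 - s) *\<^sub>R (b - a))) has_integral segment_mean f a b) ((\<lambda>x. 1 - x) ` {0..1})"
    by simp
  moreover have "(\<lambda>x. 1 - x) ` {0..1::real} = {0..1}" by (auto simp: image_iff intro!: bexI[of _ "1 - _"])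
  moreover have "a + (1 - s) *\<^sub>R (b - a) = b + s *\<^sub>R (a - b)" for s by (simp add: algebra_simps)
  ultimately show ?thesis unfolding segment_mean_def[of f b a] by (simp add: integral_unique)
qed

lemma integral_edge_measure:
  assumes f: "continuous_on UNIV f" and ab: "a \<noteq> b"
  shows "(LINT x|edge_measure (closed_segment a b). f x) = dist a b * segment_mean f a b"
proof -
  obtain p q where pq: "{p, q} = {a, b}"
    "edge_measure (closed_segment a b) =
       distr (lebesgue_on {0..dist p q}) borel (\<lambda>s. p + s *\<^sub>R sgn (q - p))"
    using edge_measure_ex by metis
  define L where "L = dist p q"
  have L: "L > 0" using pq ab by (auto simp: doubleton_eq_iff L_def)
  have fb: "f \<in> borel_measurable borel" using f by (rule borel_measurable_continuous_onI)
  define g where "g s = f (p + s *\<^sub>R sgn (q - p))" for s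
  have g: "continuous_on {0..L} g" unfolding g_def
    by (intro continuous_on_compose2[OF f] continuous_intros) auto
  have "(LINT x|edge_measure (closed_segment a b). f x) = (LINT s|lebesgue_on {0..L}. g s)"
    unfolding pq(2) L_def g_def by (rule integral_distr) (use fb in auto)
  also have "\<dots> = integral {0..L} g"
    by (rule lebesgue_integral_eq_integral) (use continuous_imp_integrable_real[OF g] in auto)
  also have "\<dots> = L * segment_mean f p q"
  proof -
    have "(g has_integral integral {0..L} g) (cbox 0 L)"
      using g by (simp add: integrable_continuous_real integrable_integral)
    from has_integral_affinity[OF this, of L 0] L
    have "((\<lambda>s. g (L * s)) has_integral integral {0..L} g / L) ((\<lambda>x. x / L) ` {0..L})"
      by (simp add: divide_inverse mult.commute)
    moreover have "(\<lambda>x. x / L) ` {0..L} = {0..1}"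
      using L by (auto simp: image_iff field_simps intro!: bexI[of _ "L * _"])
    moreover have "g (L * s) = f (p + s *\<^sub>R (q - p))" for s
    proof -
      have "L *\<^sub>R sgn (q - p) = q - p"
        using L by (simp add: L_def dist_norm norm_minus_commute[of q p] sgn_div_norm)
      then have "(L * s) *\<^sub>R sgn (q - p) = s *\<^sub>R (q - p)"
        by (metis mult.commute scaleR_scaleR)
      then show ?thesis unfolding g_def by simp
    qed
    ultimately have "segment_mean f p q = integral {0..L} g / L"
      unfolding segment_mean_def by (simp add: integral_unique)
    then show ?thesis using L by simp
  qed
  also have "\<dots> = dist a b * segment_mean f a b"
    using pq(1) segment_mean_commute[OF f] by (auto simp: doubleton_eq_iff L_def dist_commute)
  finally show ?thesis .
qed

lemma vector_2_axis: "vector [s, t] = s *\<^sub>R axis 1 1 + t *\<^sub>R (axis 2 1 :: point)"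
  by (rule plane_eqI) (auto simp: axis_def)

lemma Basis_plane: "(Basis :: point set) = {axis 1 1, axis 2 1}"
  unfolding Basis_vec_def by (auto simp: UNIV_2)

lemma continuous_vector_2: "continuous_on UNIV (\<lambda>(s::real, t::real). vector [s, t] :: point)"
  unfolding case_prod_beta vector_2_axis by (intro continuous_intros)

text \<open>Through this identity, integrals over the plane become iterated integrals.\<close>

lemma lborel_plane: "(lborel :: point measure) = distr lborel borel (\<lambda>(s::real, t::real). vector [s, t])"
proof (rule lborel_eqI)
  fix l u :: point assume le: "\<And>b. b \<in> Basis \<Longrightarrow> l \<bullet> b \<le> u \<bullet> b"
  have le': "l $ 1 \<le> u $ 1" "l $ 2 \<le> u $ 2"
    using le[of "axis 1 1"] le[of "axis 2 1"] by (auto simp: Basis_plane inner_axis)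
  have "emeasure (distr lborel borel (\<lambda>(s::real, t::real). vector [s, t] :: point)) (box l u)
     = emeasure lborel ((\<lambda>(s::real, t::real). vector [s, t]) -` box l u)"
    by (subst emeasure_distr) (auto intro: borel_measurable_continuous_onI continuous_vector_2)
  also have "(\<lambda>(s::real, t::real). vector [s, t]) -` box l u = {l$1<..<u$1} \<times> {l$2<..<u$2}"
    by (auto simp: mem_box_cart forall_2)
  also have "emeasure lborel \<dots> = emeasure lborel {l$1<..<u$1} * emeasure lborel {l$2<..<u$2}"
    unfolding lborel_prod[symmetric] by (rule lborel.emeasure_pair_measure_Times) auto
  also have "\<dots> = (\<Prod>b\<in>Basis. (u - l) \<bullet> b)"
    using le' by (simp add: Basis_plane axis_eq_axis inner_axis ennreal_mult)
  finally show "emeasure (distr lborel borel (\<lambda>(s::real, t::real). vector [s, t] :: point)) (box l u)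
    = (\<Prod>b\<in>Basis. (u - l) \<bullet> b)" .
qed simp

definition unit_triangle :: "(real \<times> real) set" where
  "unit_triangle = {(s, t). 0 \<le> s \<and> 0 \<le> t \<and> s + t \<le> 1}"

lemma closed_unit_triangle: "closed unit_triangle"
  unfolding unit_triangle_def case_prod_beta
  by (intro closed_Collect_conj closed_Collect_le continuous_intros)

lemma compact_unit_triangle: "compact unit_triangle"
proof -
  have "unit_triangle \<subseteq> cbox (0,0) (1,1)" by (auto simp: unit_triangle_def cbox_Pair_eq)
  then show ?thesis using closed_unit_triangle bounded_cbox bounded_subset compact_eq_bounded_closed by blast
qed

lemma continuous_integrable_compact:
  fixes h :: "'a::euclidean_space \<Rightarrow> 'b::euclidean_space"
  assumes h: "continuous_on UNIV h" and X: "compact X"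
  shows "h absolutely_integrable_on X" "integrable (lebesgue_on X) h"
    "(LINT x|lebesgue_on X. h x) = integral X h"
    "(LINT x|lebesgue_on X. h x) = (LINT x|lborel. indicator X x *\<^sub>R h x)"
proof -
  have i: "integrable lborel (\<lambda>x. indicator X x *\<^sub>R h x)"
    using borel_integrable_compact[OF X continuous_on_subset[OF h]] by simp
  have Xm: "X \<in> sets lebesgue" using X by (simp add: compact_imp_closed)
  show a: "h absolutely_integrable_on X"
    unfolding set_integrable_def using i by (simp add: integrable_completion borel_measurable_integrable)
  then show b: "integrable (lebesgue_on X) h"
    using Xm unfolding set_integrable_def by (simp add: integrable_restrict_space)
  show "(LINT x|lebesgue_on X. h x) = integral X h" using lebesgue_integral_eq_integral[OF b Xm] .
  show "(LINT x|lebesgue_on X. h x) = (LINT x|lborel. indicator X x *\<^sub>R h x)"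
    using Xm i by (simp add: integral_restrict_space integral_completion borel_measurable_integrable)
qed

text \<open>Change of variables to the unit triangle, carried out for functions from \<open>real^2\<close> to \<open>real^1\<close>. The
  last steps move to real functions and to the product type, where the integral can be iterated.\<close>

lemma integral_triangle_param:
  fixes f :: "point \<Rightarrow> real"
  assumes f: "continuous_on UNIV f" and D: "cross2 (b - a) (c - a) \<noteq> 0"
  shows "(LINT x|lebesgue_on (convex hull {a, b, c}). f x) =
    \<bar>cross2 (b - a) (c - a)\<bar> *
      (LINT z|lborel. indicator unit_triangle z *\<^sub>R f (a + fst z *\<^sub>R (b - a) + snd z *\<^sub>R (c - a)))"
proof -
  define u v where "u = b - a" and "v = c - a"
  define S :: "point set" where "S = {x. 0 \<le> x $ 1 \<and> 0 \<le> x $ 2 \<and> x $ 1 + x $ 2 \<le> 1}"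
  define g :: "point \<Rightarrow> point" where "g x = a + x $ 1 *\<^sub>R u + x $ 2 *\<^sub>R v" for x
  define g' :: "point \<Rightarrow> point" where "g' x = x $ 1 *\<^sub>R u + x $ 2 *\<^sub>R v" for x
  define T where "T = convex hull {a, b, c}"
  have T: "T = g ` S"
  proof -
    have "x \<in> T \<longleftrightarrow> (\<exists>s t. 0 \<le> s \<and> 0 \<le> t \<and> s + t \<le> 1 \<and> x = a + s *\<^sub>R u + t *\<^sub>R v)" for x
      unfolding T_def convex_hull_3_alt u_def v_def by auto
    moreover have "x \<in> g ` S \<longleftrightarrow> (\<exists>s t. 0 \<le> s \<and> 0 \<le> t \<and> s + t \<le> 1 \<and> x = a + s *\<^sub>R u + t *\<^sub>R v)" for x
    proof
      assume "\<exists>s t. 0 \<le> s \<and> 0 \<le> t \<and> s + t \<le> 1 \<and> x = a + s *\<^sub>R u + t *\<^sub>R v"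
      then obtain s t where "0 \<le> s" "0 \<le> t" "s + t \<le> 1" "x = a + s *\<^sub>R u + t *\<^sub>R v" by blast
      then show "x \<in> g ` S" by (intro image_eqI[of _ _ "vector [s, t]"]) (auto simp: g_def S_def)
    qed (auto simp: g_def S_def)
    ultimately show ?thesis by blast
  qed
  have cS: "compact S"
  proof -
    have "closed S" unfolding S_def by (intro closed_Collect_conj closed_Collect_le continuous_intros)
    moreover have "S \<subseteq> cbox 0 1" by (auto simp: S_def mem_box_cart forall_2)
    ultimately show ?thesis using bounded_cbox bounded_subset compact_eq_bounded_closed by blast
  qed
  have cg: "continuous_on UNIV g" unfolding g_def by (intro continuous_intros)
  have cT: "compact T" unfolding T using cS cg compact_continuous_image continuous_on_subset by blast
  have der: "(g has_derivative g') (at x within S)" for x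
    unfolding g_def g'_def
    by (auto intro!: derivative_eq_intros bounded_linear_imp_has_derivative bounded_linear_vec_nth)
  have inj: "inj_on g S"
  proof (rule inj_onI)
    fix x y assume eq: "g x = g y"
    then have "g' (x - y) = 0" by (simp add: g_def g'_def algebra_simps)
    then have "cross2 (g' (x - y)) v = 0" "cross2 u (g' (x - y)) = 0" by (simp_all add: cross2_def)
    then have "x $ 1 = y $ 1" "x $ 2 = y $ 2"
      using D unfolding g'_def by (simp_all add: cross2_simps u_def v_def)
    then show "x = y" by (rule plane_eqI)
  qed
  have dt: "det (matrix g') = cross2 u v"
    unfolding det_2 matrix_def g'_def cross2_def by (simp add: axis_def)
  define F :: "point \<Rightarrow> real^1" where "F x = vec (f x)" for x
  have cF: "continuous_on UNIV F" unfolding F_def vec_def by (intro continuous_on_vec_lambda f)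
  have cFg: "continuous_on UNIV (\<lambda>x. F (g x))" by (rule continuous_on_compose2[OF cF cg]) simp
  have cfg: "continuous_on UNIV (\<lambda>x. f (g x))" by (rule continuous_on_compose2[OF f cg]) simp
  have "integral (g ` S) F = integral S (\<lambda>x. \<bar>det (matrix g')\<bar> *\<^sub>R F (g x))"
    by (rule integral_change_of_variables[of _ _ "\<lambda>_. g'"])
      (use cS der inj continuous_integrable_compact(1)[OF cF cT] T in \<open>auto simp: compact_imp_closed\<close>)
  then have "integral T F = \<bar>cross2 u v\<bar> *\<^sub>R integral S (\<lambda>x. F (g x))" unfolding T dt by simp
  then have "integral T F $ 1 = \<bar>cross2 u v\<bar> * integral S (\<lambda>x. F (g x)) $ 1" by simp
  moreover have "integral T F $ 1 = integral T f"
    using integral_component_eq_cart[of F T 1, symmetric] continuous_integrable_compact(1)[OF cF cT]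
    by (simp add: F_def absolutely_integrable_on_def)
  moreover have "integral S (\<lambda>x. F (g x)) $ 1 = integral S (\<lambda>x. f (g x))"
    using integral_component_eq_cart[of "\<lambda>x. F (g x)" S 1, symmetric]
      continuous_integrable_compact(1)[OF cFg cS]
    by (simp add: F_def absolutely_integrable_on_def)
  ultimately have "(LINT x|lebesgue_on T. f x) = \<bar>cross2 u v\<bar> * (LINT x|lebesgue_on S. f (g x))"
    using continuous_integrable_compact(3)[OF f cT] continuous_integrable_compact(3)[OF cfg cS] by simp
  also have "(LINT x|lebesgue_on S. f (g x)) = (LINT x|lborel. indicator S x *\<^sub>R f (g x))"
    by (rule continuous_integrable_compact(4)[OF cfg cS])
  also have "\<dots> = (LINT z|lborel. indicator S (vector [fst z, snd z]) *\<^sub>R f (g (vector [fst z, snd z])))"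
  proof (subst lborel_plane, subst integral_distr)
    show "(\<lambda>x. indicator S x *\<^sub>R f (g x)) \<in> borel_measurable borel"
      using borel_measurable_continuous_onI[OF cfg] compact_imp_closed[OF cS] borel_closed[of S]
      by (intro borel_measurable_scaleR borel_measurable_indicator) auto
  qed (auto intro: borel_measurable_continuous_onI continuous_vector_2 simp: case_prod_beta)
  also have "\<dots> = (LINT z|lborel. indicator unit_triangle z *\<^sub>R f (a + fst z *\<^sub>R u + snd z *\<^sub>R v))"
    by (intro Bochner_Integration.integral_cong) (auto simp: S_def unit_triangle_def g_def indicator_def)
  finally show ?thesis unfolding T_def u_def v_def .
qed

text \<open>The integral of the derivative in the direction of an edge: on the unit triangle this is the
  fundamental theorem of calculus in the second coordinate, followed by integration in the first.\<close>

lemma integral_triangle_edge_derivative: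
  fixes f :: "point \<Rightarrow> real"
  assumes f: "\<And>x. (f has_derivative f' x) (at x)" and f': "\<And>w. continuous_on UNIV (\<lambda>x. f' x w)"
    and D: "cross2 (b - a) (c - a) \<noteq> 0"
  shows "(LINT x|lebesgue_on (convex hull {a, b, c}). f' x (c - a)) =
    \<bar>cross2 (b - a) (c - a)\<bar> * (segment_mean f c b - segment_mean f a b)"
proof -
  define u v where "u = b - a" and "v = c - a"
  define G where "G s t = f (a + s *\<^sub>R u + t *\<^sub>R v)" for s t
  define G' where "G' s t = f' (a + s *\<^sub>R u + t *\<^sub>R v) v" for s t
  have cf: "continuous_on UNIV f"
    using f has_derivative_continuous_on[of UNIV f f'] has_derivative_at_withinI by blast
  have dG: "((\<lambda>t. G s t) has_vector_derivative G' s t) (at t within X)" for s t X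
  proof -
    have "((\<lambda>t. G s t) has_derivative (\<lambda>h. f' (a + s *\<^sub>R u + t *\<^sub>R v) (h *\<^sub>R v))) (at t within X)"
      unfolding G_def
      by (rule has_derivative_compose[OF _ f]) (auto intro!: derivative_eq_intros)
    moreover have "linear (f' (a + s *\<^sub>R u + t *\<^sub>R v))" using f has_derivative_linear by blast
    ultimately show ?thesis unfolding has_vector_derivative_def G'_def by (simp add: linear_scale)
  qed
  have cG': "continuous_on UNIV (\<lambda>t. G' s t)" for s
    unfolding G'_def by (intro continuous_on_compose2[OF f'] continuous_intros) auto
  have inner: "(LINT t|lborel. indicator unit_triangle (s, t) *\<^sub>R G' s t)
      = indicator {0..1} s *\<^sub>R (G s (1 - s) - G s 0)" for s
  proof (cases "0 \<le> s \<and> s \<le> 1")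
    case True
    have "(LINT t|lborel. indicator unit_triangle (s, t) *\<^sub>R G' s t)
        = (LINT t|lborel. indicator {0..1-s} t *\<^sub>R G' s t)"
      using True by (intro Bochner_Integration.integral_cong) (auto simp: unit_triangle_def indicator_def)
    also have "\<dots> = G s (1 - s) - G s 0"
      using True by (intro integral_FTC_atLeastAtMost dG continuous_on_subset[OF cG']) auto
    finally show ?thesis using True by simp
  next
    case False
    then have "(\<lambda>t. indicator unit_triangle (s, t) *\<^sub>R G' s t) = (\<lambda>t. 0)"
      by (auto simp: unit_triangle_def indicator_def)
    then show ?thesis using False by simp
  qed
  have "continuous_on UNIV (\<lambda>z. G' (fst z) (snd z))"
    unfolding G'_def by (intro continuous_on_compose2[OF f'] continuous_intros) auto
  then have int: "integrable lborel (\<lambda>z. indicator unit_triangle z *\<^sub>R G' (fst z) (snd z))"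
    using borel_integrable_compact[OF compact_unit_triangle] continuous_on_subset by blast
  have "(LINT x|lebesgue_on (convex hull {a, b, c}). f' x v) =
      \<bar>cross2 u v\<bar> * (LINT z|lborel. indicator unit_triangle z *\<^sub>R G' (fst z) (snd z))"
    using integral_triangle_param[OF f' D, of v] unfolding G'_def u_def v_def .
  also have "(LINT z|lborel. indicator unit_triangle z *\<^sub>R G' (fst z) (snd z))
      = (LINT s|lborel. LINT t|lborel. indicator unit_triangle (s, t) *\<^sub>R G' s t)"
    using lborel_pair.integral_fst'[OF int[folded lborel_prod]] by (simp add: lborel_prod)
  also have "\<dots> = (LINT s|lborel. indicator {0..1} s *\<^sub>R (G s (1 - s) - G s 0))"
    unfolding inner ..
  also have "\<dots> = (LINT s|lebesgue_on {0..1}. G s (1 - s) - G s 0)"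
    unfolding G_def
    by (subst continuous_integrable_compact(4)) (auto intro!: continuous_on_compose2[OF cf] continuous_intros)
  also have "\<dots> = integral {0..1} (\<lambda>s. G s (1 - s) - G s 0)"
    unfolding G_def
    by (subst continuous_integrable_compact(3)) (auto intro!: continuous_on_compose2[OF cf] continuous_intros)
  also have "\<dots> = integral {0..1} (\<lambda>s. G s (1 - s)) - integral {0..1} (\<lambda>s. G s 0)"
    unfolding G_def
    by (intro integral_diff integrable_continuous_real continuous_on_compose2[OF cf] continuous_intros) auto
  also have "(\<lambda>s. G s (1 - s)) = (\<lambda>s. f (c + s *\<^sub>R (b - c)))"
    unfolding G_def u_def v_def by (simp add: algebra_simps)
  also have "integral {0..1} (\<lambda>s. G s 0) = segment_mean f a b" by (simp add: G_def u_def segment_mean_def)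
  finally show ?thesis unfolding u_def v_def segment_mean_def .
qed

lemma outward_normal_line_integral:
  assumes "ccw_triangle a b c T" "continuous_on UNIV f"
  shows "(LINT x|edge_measure (closed_segment a b). (outward_normal T (closed_segment a b) \<bullet> w) * f x)
    = - cross2 (b - a) w * segment_mean f a b"
proof -
  have ab: "a \<noteq> b" using ccw_distinct[OF assms(1)] by blast
  have "outward_normal T (closed_segment a b) \<bullet> w = - cross2 (b - a) w / dist a b"
    unfolding outward_normal_ccw[OF assms(1)]
    by (simp add: sgn_div_norm inner_rot_right dist_norm norm_minus_commute divide_inverse)
  then show ?thesis using integral_edge_measure[OF assms(2) ab] ab by simp
qed

text \<open>A direction \<open>w\<close> is a combination of two edge vectors, to which \<open>integral_triangle_edge_derivative\<close>
  applies. On the other side, the length of an edge times its outward normal is the edge vector turned to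
  the right, so both sides are combinations of the mean values over the three edges with the same
  coefficients.\<close>

theorem triangle_divergence:
  fixes f :: "point \<Rightarrow> real"
  assumes T: "2 simplex T"
    and f: "\<And>x. (f has_derivative f' x) (at x)" and f': "\<And>w. continuous_on UNIV (\<lambda>x. f' x w)"
  shows "(LINT x|lebesgue_on T. f' x w) = boundary_integral T (\<lambda>e x. (outward_normal T e \<bullet> w) * f x)"
proof -
  obtain a b c where abc: "ccw_triangle a b c T" using simplex_2_ccw T by blast
  define u v where "u = b - a" and "v = c - a"
  have D: "cross2 u v > 0" and Tc: "T = convex hull {a,b,c}"
    using abc unfolding ccw_triangle_def u_def v_def by auto
  have cf: "continuous_on UNIV f"
    using f has_derivative_continuous_on[of UNIV f f'] has_derivative_at_withinI by blast
  have "compact T" using simplex_2_compact T .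
  define \<alpha> \<beta> where "\<alpha> = cross2 w v / cross2 u v" and "\<beta> = cross2 u w / cross2 u v"
  have w: "w = \<alpha> *\<^sub>R u + \<beta> *\<^sub>R v" unfolding \<alpha>_def \<beta>_def by (rule cramer2) (use D in simp)
  have "f' x w = \<alpha> * f' x u + \<beta> * f' x v" for x
  proof -
    have "linear (f' x)" using f has_derivative_linear by blast
    then show ?thesis by (subst w) (simp add: linear_add linear_scale)
  qed
  then have "(LINT x|lebesgue_on T. f' x w) = \<alpha> * (LINT x|lebesgue_on T. f' x u)
      + \<beta> * (LINT x|lebesgue_on T. f' x v)"
    using continuous_integrable_compact(2)[OF f' \<open>compact T\<close>] by simp
  also have "(LINT x|lebesgue_on T. f' x v) = cross2 u v * (segment_mean f c b - segment_mean f a b)"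
    using integral_triangle_edge_derivative[OF f f', of b a c] D unfolding Tc u_def v_def by simp
  also have "(LINT x|lebesgue_on T. f' x u) = cross2 u v * (segment_mean f b c - segment_mean f a c)"
    using integral_triangle_edge_derivative[OF f f', of c a b] D cross2_swap[of v u]
    unfolding Tc u_def v_def by (simp add: insert_commute)
  also have "\<alpha> * (cross2 u v * (segment_mean f b c - segment_mean f a c))
      = cross2 w v * (segment_mean f b c - segment_mean f a c)" using D by (simp add: \<alpha>_def)
  also have "\<beta> * (cross2 u v * (segment_mean f c b - segment_mean f a b))
      = cross2 u w * (segment_mean f c b - segment_mean f a b)" using D by (simp add: \<beta>_def)
  finally have lhs: "(LINT x|lebesgue_on T. f' x w) =
     cross2 w v * (segment_mean f b c - segment_mean f a c) + cross2 u w * (segment_mean f c b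
         - segment_mean f a b)" .
  have "boundary_integral T (\<lambda>e x. (outward_normal T e \<bullet> w) * f x)
     = - cross2 (b - a) w * segment_mean f a b - cross2 (c - b) w * segment_mean f b c
       - cross2 (a - c) w * segment_mean f c a"
    unfolding boundary_integral_def ccw_edges[OF abc]
    using ccw_edges_distinct[OF abc] outward_normal_line_integral[OF abc cf, of w]
      outward_normal_line_integral[OF ccw_triangle_rotate[OF abc] cf, of w]
      outward_normal_line_integral[OF ccw_triangle_rotate[OF ccw_triangle_rotate[OF abc]] cf, of w]
    by simp
  also have "\<dots> = (LINT x|lebesgue_on T. f' x w)"
    unfolding lhs segment_mean_commute[OF cf, of c b] segment_mean_commute[OF cf, of c a]
    by (simp add: cross2_def u_def v_def algebra_simps)
  finally show ?thesis ..
qed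

section \<open>The mesh, the coefficients and their traces\<close>

lemma negligible_closed_segment: "negligible (closed_segment a (b::point))"
proof -
  have "aff_dim (closed_segment a b) \<le> 1"
    by (simp add: segment_convex_hull aff_dim_convex_hull aff_dim_2)
  then have "interior (closed_segment a b) = {}"
    using aff_dim_nonempty_interior[of "closed_segment a b"] by fastforce
  then show ?thesis using negligible_convex_interior convex_closed_segment by blast
qed

lemma negligible_frontier_polygonal:
  assumes "polygonal_domain \<Omega>" shows "negligible (frontier \<Omega>)"
proof -
  obtain S where "finite S" "frontier \<Omega> = (\<Union>(a, b)\<in>S. closed_segment a b)"
    using assms unfolding polygonal_domain_def by blast
  then show ?thesis by (auto intro!: negligible_Union negligible_closed_segment)
qed

lemma mesh_element_subset:
  assumes "polygonal_domain \<Omega>" "conforming_mesh \<Omega> \<T>" "T \<in> \<T>"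
  shows "T \<subseteq> \<Omega> \<union> frontier \<Omega>"
proof -
  have "T \<subseteq> closure \<Omega>" using assms unfolding conforming_mesh_def by blast
  then show ?thesis using closure_Un_frontier by blast
qed

lemma simplex_2_lebesgue: "2 simplex (T::point set) \<Longrightarrow> T \<in> sets lebesgue"
  using simplex_2_compact[of T] compact_imp_closed[of T] by auto

text \<open>Elements lie in the closure of the domain, and the boundary of a polygonal domain is a null set. The
  same reason gives the next lemma.\<close>

lemma AE_mesh_element:
  assumes dom: "polygonal_domain \<Omega>" and m: "conforming_mesh \<Omega> \<T>" and T: "T \<in> \<T>"
    and P: "AE x in lebesgue_on \<Omega>. P x"
  shows "AE x in lebesgue_on T. P x"
proof -
  have Om: "\<Omega> \<in> sets lebesgue" using dom unfolding polygonal_domain_def by auto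
  have Tm: "T \<in> sets lebesgue" using simplex_2_lebesgue mesh_simplex m T by blast
  have "AE x in lebesgue. x \<in> \<Omega> \<longrightarrow> P x" using P Om by (simp add: AE_restrict_space_iff)
  moreover have "AE x in lebesgue. x \<notin> frontier \<Omega>"
    using negligible_frontier_polygonal[OF dom] AE_not_in by (simp add: negligible_iff_null_sets)
  ultimately have "AE x in lebesgue. x \<in> T \<longrightarrow> P x"
    by eventually_elim (use mesh_element_subset[OF dom m T] in blast)
  then show ?thesis using Tm by (simp add: AE_restrict_space_iff)
qed

lemma measurable_mesh_element:
  fixes f :: "point \<Rightarrow> 'b::euclidean_space"
  assumes dom: "polygonal_domain \<Omega>" and m: "conforming_mesh \<Omega> \<T>" and T: "T \<in> \<T>"
    and f: "f \<in> borel_measurable (lebesgue_on \<Omega>)"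
  shows "f \<in> borel_measurable (lebesgue_on T)"
proof -
  have Tm: "T \<in> sets lebesgue" using simplex_2_lebesgue mesh_simplex m T by blast
  have "negligible (frontier \<Omega> \<inter> T)" using negligible_frontier_polygonal[OF dom] by (simp add: negligible_Int)
  then have "frontier \<Omega> \<inter> T \<in> null_sets (lebesgue_on T)"
    using Tm by (simp add: null_sets_restrict_space negligible_iff_null_sets)
  moreover have "T - (frontier \<Omega> \<inter> T) \<subseteq> \<Omega>" using mesh_element_subset[OF dom m T] by blast
  then have "f \<in> borel_measurable (lebesgue_on (T - (frontier \<Omega> \<inter> T)))"
    by (rule measurable_restrict_mono[OF f])
  ultimately show ?thesis using borel_measurable_diff_null[OF _ Tm] by blast
qed

lemma simplex_2_interior:
  assumes "2 simplex (T::point set)" shows "interior T \<noteq> {}"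
proof -
  have "aff_dim T = int (DIM(point))" using simplex_2_aff_dim[OF assms] by simp
  then have "interior T = rel_interior T" by (simp add: interior_rel_interior_gen)
  moreover have "T \<noteq> {}" using simplex_2_aff_dim[OF assms] by auto
  ultimately show ?thesis using rel_interior_eq_empty[OF simplex_convex[OF assms]] by simp
qed

text \<open>So the quotient that defines a trace never has a vanishing denominator.\<close>

lemma measure_simplex_ball_pos:
  assumes T: "2 simplex (T::point set)" and x: "x \<in> T" and r: "r > 0"
  shows "measure lebesgue (T \<inter> ball x r) > 0" "T \<inter> ball x r \<in> lmeasurable"
proof -
  show lm: "T \<inter> ball x r \<in> lmeasurable"
    using simplex_2_compact[OF T] by (simp add: fmeasurable_Int_fmeasurable lmeasurable_compact
      compact_imp_closed)
  have "x \<in> closure (interior T)"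
    using convex_closure_interior[OF simplex_convex[OF T] simplex_2_interior[OF T]] x closure_subset by blast
  then have "interior T \<inter> ball x r \<noteq> {}" using r
    by (meson centre_in_ball closure_iff_nhds_not_empty disjoint_iff open_ball subset_refl)
  then have "\<not> negligible (interior T \<inter> ball x r)" 
    by (intro open_not_negligible open_Int) auto
  then have "\<not> negligible (T \<inter> ball x r)"
    using interior_subset[of T] negligible_subset[of "T \<inter> ball x r" "interior T \<inter> ball x r"] by blast
  then show "measure lebesgue (T \<inter> ball x r) > 0"
    using lm by (metis measure_nonneg negligible_iff_measure order_le_less)
qed

text \<open>If a trace value \<open>g x\<close> had positive distance \<open>d\<close> to \<open>K\<close>, then every mean in the definition of the
  trace would be at least \<open>d\<close> and could not tend to zero. Boundedness of \<open>K\<close> makes the integrands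
  integrable, so that these means are the true ones and not the default value of a divergent integral.\<close>

lemma trace_in_closed:
  fixes f :: "point \<Rightarrow> 'b::euclidean_space"
  assumes T: "2 simplex T" and e: "e edge_of T" and tr: "edge_trace f T e g"
    and f: "f \<in> borel_measurable (lebesgue_on T)"
    and K: "closed K" "bounded K" "AE x in lebesgue_on T. f x \<in> K"
  shows "AE x in edge_measure e. g x \<in> K"
proof -
  obtain a b c where abc: "e = closed_segment a b" using edge_ccw[OF T e] by metis
  have "AE x in edge_measure e. x \<in> e" unfolding abc by (rule AE_edge_measure_mem)
  moreover have "AE x in edge_measure e.
        ((\<lambda>r. (LINT y|lebesgue_on (T \<inter> ball x r). norm (f y - g x)) / measure lebesgue (T \<inter> ball x r))
           \<longlongrightarrow> 0) (at_right 0)"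
    using tr unfolding edge_trace_def by blast
  ultimately show ?thesis
  proof eventually_elim
    fix x assume xe: "x \<in> e" and lim: "((\<lambda>r. (LINT y|lebesgue_on (T \<inter> ball x r). norm (f y
        - g x)) / measure lebesgue (T \<inter> ball x r)) \<longlongrightarrow> 0) (at_right 0)"
    show "g x \<in> K"
    proof (rule ccontr)
      assume "g x \<notin> K"
      then have "open (- K)" "g x \<in> - K" using K(1) by auto
      then obtain d where d: "d > 0" "ball (g x) d \<subseteq> - K" using openE by metis
      have xT: "x \<in> T" using xe edge_of_imp_subset[OF e] by blast
      obtain B where B: "\<And>y. y \<in> K \<Longrightarrow> norm y \<le> B" using K(2) by (auto simp: bounded_iff)
      have ge: "(LINT y|lebesgue_on (T \<inter> ball x r). norm (f y - g x)) / measure lebesgue (T \<inter> ball x r) \<ge> d"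
        if r: "r > 0" for r
      proof -
        let ?S = "T \<inter> ball x r"
        note pos = measure_simplex_ball_pos[OF T xT r]
        interpret finite_measure "lebesgue_on ?S" using finite_measure_lebesgue_on[OF pos(2)] .
        have Tm: "T \<in> sets lebesgue" using simplex_2_lebesgue T by blast
        have Sm: "?S \<in> sets lebesgue" using pos(2) by blast
        have "AE y in lebesgue. y \<in> T \<longrightarrow> f y \<in> K" using K(3) Tm by (simp add: AE_restrict_space_iff)
        then have ae: "AE y in lebesgue_on ?S. f y \<in> K"
          using Sm by (auto simp: AE_restrict_space_iff elim: eventually_mono)
        have fm: "f \<in> borel_measurable (lebesgue_on ?S)" using f by (rule measurable_restrict_mono) auto
        have "integrable (lebesgue_on ?S) (\<lambda>y. norm (f y - g x))"
        proof (rule integrable_const_bound)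
          show "AE y in lebesgue_on ?S. norm (norm (f y - g x)) \<le> B + norm (g x)"
            using ae
          proof eventually_elim
            fix y assume "f y \<in> K"
            then show "norm (norm (f y - g x)) \<le> B + norm (g x)"
              using B[of "f y"] norm_triangle_ineq4[of "f y" "g x"] by simp
          qed
        qed (use fm in measurable)
        moreover have "AE y in lebesgue_on ?S. d \<le> norm (f y - g x)"
          using ae
        proof eventually_elim
          fix y assume "f y \<in> K"
          then have "f y \<notin> ball (g x) d" using d by blast
          then show "d \<le> norm (f y - g x)" by (simp add: dist_norm norm_minus_commute)
        qed
        ultimately have "(LINT y|lebesgue_on ?S. d) \<le> (LINT y|lebesgue_on ?S. norm (f y - g x))"
          by (intro integral_mono_AE) auto
        moreover have "measure (lebesgue_on ?S) ?S = measure lebesgue ?S"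
          using Sm by (simp add: measure_restrict_space)
        ultimately show ?thesis using pos(1) by (simp add: field_simps)
      qed
      have "eventually (\<lambda>r. (LINT y|lebesgue_on (T \<inter> ball x r). norm (f y
          - g x)) / measure lebesgue (T \<inter> ball x r) < d) (at_right 0)"
        using order_tendstoD(2)[OF lim d(1)] .
      moreover have "eventually (\<lambda>r. r > 0) (at_right (0::real))" by (rule eventually_at_right_less)
      ultimately have "eventually (\<lambda>r::real. False) (at_right 0)"
        by eventually_elim (use ge in fastforce)
      then show False by simp
    qed
  qed
qed

text \<open>The symmetric matrices with all eigenvalues in \<open>[lo, hi]\<close>, written with the quadratic form. It is a
  compact set, as \<open>trace_in_closed\<close> requires.\<close>

definition admissible :: "real \<Rightarrow> real \<Rightarrow> (real^2^2) set" where
  "admissible lo hi = {A. transpose A = A \<and> 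
     (\<forall>\<xi>. lo * (norm \<xi>)\<^sup>2 \<le> \<xi> \<bullet> (A *v \<xi>) \<and> \<xi> \<bullet> (A *v \<xi>) \<le> hi * (norm \<xi>)\<^sup>2)}"

lemma matrix_vector_plane:
  "(A *v x) $ 1 = A $ 1 $ 1 * x $ 1 + A $ 1 $ 2 * x $ 2"
  "(A *v x) $ 2 = A $ 2 $ 1 * x $ 1 + A $ 2 $ 2 * x $ (2::2)"
  for A :: "real^2^2"
  by (simp_all add: matrix_vector_mult_def sum_2)

lemma norm_plane: "(norm (x::point))\<^sup>2 = (x $ 1)\<^sup>2 + (x $ 2)\<^sup>2"
  unfolding power2_norm_eq_inner inner_plane by (simp add: power2_eq_square)

lemma admissible_closed: "closed (admissible lo hi)"
proof -
  have 1: "continuous_on UNIV (\<lambda>A::real^2^2. \<xi> \<bullet> (A *v \<xi>))" for \<xi>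
    unfolding inner_plane matrix_vector_plane by (intro continuous_intros)
  have 2: "transpose A = A \<longleftrightarrow> A $ 1 $ 2 = A $ 2 $ 1" for A :: "real^2^2"
    by (auto simp: transpose_def vec_eq_iff forall_2)
  show ?thesis unfolding admissible_def 2
    by (intro closed_Collect_conj closed_Collect_all closed_Collect_le closed_Collect_eq continuous_intros 1)
qed

lemma admissible_entries:
  assumes A: "A \<in> admissible lo hi" and lo: "lo > 0"
  shows "A $ 1 $ 2 = A $ 2 $ 1" "lo \<le> A $ 1 $ 1" "A $ 1 $ 1 \<le> hi" "lo \<le> A $ 2 $ 2" "A $ 2 $ 2 \<le> hi"
    "\<bar>A $ 1 $ 2\<bar> \<le> hi" "lo\<^sup>2 \<le> det A" "det A \<le> hi\<^sup>2"
proof -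
  have q: "lo * ((x $ 1)\<^sup>2 + (x $ 2)\<^sup>2) \<le> x $ 1 * (A $ 1 $ 1 * x $ 1 + A $ 1 $ 2 * x $ 2)
      + x $ 2 * (A $ 2 $ 1 * x $ 1 + A $ 2 $ 2 * x $ 2)"
    "x $ 1 * (A $ 1 $ 1 * x $ 1 + A $ 1 $ 2 * x $ 2) + x $ 2 * (A $ 2 $ 1 * x $ 1 + A $ 2 $ 2 * x $ 2)
        \<le> hi * ((x $ 1)\<^sup>2 + (x $ 2)\<^sup>2)" for x :: point
    using A unfolding admissible_def by (auto simp: inner_plane matrix_vector_plane norm_plane)
  show s: "A $ 1 $ 2 = A $ 2 $ 1"
  proof -
    have "transpose A $ 2 $ 1 = A $ 2 $ 1" using A by (simp add: admissible_def)
    then show ?thesis by (simp add: transpose_def)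
  qed
  note q' = q[of "vector [s, t]" for s t, simplified]
  show a11: "lo \<le> A $ 1 $ 1" "A $ 1 $ 1 \<le> hi" using q'[of 1 0] by auto
  show a22: "lo \<le> A $ 2 $ 2" "A $ 2 $ 2 \<le> hi" using q'[of 0 1] by auto
  show "\<bar>A $ 1 $ 2\<bar> \<le> hi" using q'[of 1 1] q'[of 1 "-1"] s a11 a22 lo by (auto simp: abs_le_iff)
  have d: "det A = A $ 1 $ 1 * A $ 2 $ 2 - A $ 1 $ 2 * A $ 1 $ 2" unfolding det_2 using s by simp
  \<comment> \<open>The vector \<open>(-A\<^sub>1\<^sub>2, A\<^sub>1\<^sub>1)\<close> is mapped to \<open>(0, det A)\<close>.\<close>
  have "lo * ((A $ 1 $ 2)\<^sup>2 + (A $ 1 $ 1)\<^sup>2) \<le> A $ 1 $ 1 * det A"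
    using q'(1)[of "- A $ 1 $ 2" "A $ 1 $ 1"] s unfolding d by (simp add: algebra_simps power2_eq_square)
  moreover have "lo * (A $ 1 $ 1)\<^sup>2 \<le> lo * ((A $ 1 $ 2)\<^sup>2 + (A $ 1 $ 1)\<^sup>2)" using lo by simp
  ultimately have "A $ 1 $ 1 * (lo * A $ 1 $ 1) \<le> A $ 1 $ 1 * det A"
      by (simp add: power2_eq_square mult.left_commute)
  then have "lo * A $ 1 $ 1 \<le> det A" using a11 lo by simp
  moreover have "lo * lo \<le> lo * A $ 1 $ 1" using a11 lo by simp
  ultimately show "lo\<^sup>2 \<le> det A" by (simp add: power2_eq_square)
  have "det A \<le> A $ 1 $ 1 * A $ 2 $ 2" unfolding d by simp
  also have "\<dots> \<le> hi * hi" using a11 a22 lo by (intro mult_mono) auto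
  finally show "det A \<le> hi\<^sup>2" by (simp add: power2_eq_square)
qed

lemma admissible_bounded: assumes "lo > 0" shows "bounded (admissible lo hi)"
proof (rule boundedI)
  fix A assume A: "A \<in> admissible lo hi"
  have "\<bar>A $ i $ j\<bar> \<le> hi" for i j
    using admissible_entries[OF A assms] assms exhaust_2[of i] exhaust_2[of j] by auto
  note entry = this
  have row: "norm (A $ i) \<le> 2 * hi" for i
  proof -
    have "norm (A $ i) \<le> \<bar>A $ i $ 1\<bar> + \<bar>A $ i $ 2\<bar>"
      using norm_le_l1_cart[of "A $ i"] by (simp add: sum_2)
    then show ?thesis using entry[of i 1] entry[of i 2] by linarith
  qed
  have "norm A \<le> norm (A $ 1) + norm (A $ 2)"
    unfolding norm_vec_def[of A] using L2_set_le_sum[of UNIV "\<lambda>i. norm (A $ i)"] by (simp add: sum_2)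
  then show "norm A \<le> 4 * hi" using row[of 1] row[of 2] by linarith
qed

lemma impedance_bounds:
  assumes A: "A \<in> admissible lo hi" and lo: "lo > 0" and m: "mlo \<le> m" "m \<le> mhi" "mlo > 0" and n: "norm n = 1"
  shows "mlo * sqrt (lo / (mhi * hi\<^sup>2)) \<le> impedance A m n" "impedance A m n \<le> mhi * sqrt (hi / (mlo * lo\<^sup>2))"
proof -
  have q: "lo \<le> n \<bullet> (A *v n)" "n \<bullet> (A *v n) \<le> hi" 
    using A n unfolding admissible_def by (metis (mono_tags, lifting) mem_Collect_eq mult.right_neutral
      one_power2)+
  note d = admissible_entries(7,8)[OF A lo]
  have l2: "lo\<^sup>2 > 0" using lo by simp
  then have dp: "det A > 0" using d(1) by linarith
  have "0 < mlo * lo\<^sup>2" using m l2 by simp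
  moreover have "mlo * lo\<^sup>2 \<le> m * det A" using d(1) m l2 by (intro mult_mono) auto
  moreover have "m * det A \<le> mhi * hi\<^sup>2" using d(2) m dp by (intro mult_mono) auto
  ultimately have "lo / (mhi * hi\<^sup>2) \<le> (n \<bullet> (A *v n)) / (m * det A)"
    "(n \<bullet> (A *v n)) / (m * det A) \<le> hi / (mlo * lo\<^sup>2)"
    using q lo by (auto intro: frac_le)
  moreover have "0 \<le> lo / (mhi * hi\<^sup>2)" using lo m by simp
  ultimately show "mlo * sqrt (lo / (mhi * hi\<^sup>2)) \<le> impedance A m n"
     "impedance A m n \<le> mhi * sqrt (hi / (mlo * lo\<^sup>2))"
    unfolding impedance_def wave_speed_def using m by (auto intro!: mult_mono)
qed

lemma impedance_minus: "impedance A m (- n) = impedance A m n"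
  by (simp add: impedance_def wave_speed_def inner_plane matrix_vector_plane algebra_simps)

text \<open>The two-sided bound and the positive length of the edge keep the essential infimum finite, so the
  passage from extended to real numbers loses nothing.\<close>

lemma edge_inf_bounds:
  assumes ab: "a \<noteq> b" and e: "e = closed_segment a b" and f: "f \<in> borel_measurable (edge_measure e)"
    and b: "AE x in edge_measure e. l \<le> f x \<and> f x \<le> h"
  shows "l \<le> edge_inf e f" "AE x in edge_measure e. edge_inf e f \<le> f x"
proof -
  define s where "s = esssup (edge_measure e) (\<lambda>x. - ereal (f x))"
  have m: "(\<lambda>x. - ereal (f x)) \<in> borel_measurable (edge_measure e)" using f by simp
  have s1: "s \<le> - ereal l" unfolding s_def by (rule esssup_I[OF m]) (use b in \<open>auto elim: eventually_mono\<close>)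
  have ae: "AE x in edge_measure e. - ereal (f x) \<le> s" unfolding s_def by (rule esssup_AE)
  have s2: "- ereal h \<le> s"
  proof (rule ccontr)
    assume "\<not> - ereal h \<le> s"
    then have lt: "s < - ereal h" by simp
    have "AE x in edge_measure e. False"
      using ae b
    proof eventually_elim
      fix x assume "- ereal (f x) \<le> s" "l \<le> f x \<and> f x \<le> h"
      then have "- ereal h \<le> s" by (meson ereal_less_eq(3) ereal_minus_le_minus order_trans)
      then show False using lt by simp
    qed
    then have "ae_filter (edge_measure e) = bot" by (simp add: trivial_limit_def)
    then show False using emeasure_edge_measure_nonzero[OF ab] unfolding e by (simp add: ae_filter_eq_bot_iff)
  qed
  obtain r where r: "s = ereal r" using s1 s2 by (cases s) auto
  have E: "edge_inf e f = - r" unfolding edge_inf_def s_def[symmetric] r by simp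
  show "l \<le> edge_inf e f" using s1 unfolding E r by simp
  show "AE x in edge_measure e. edge_inf e f \<le> f x"
    using ae unfolding E r by eventually_elim simp
qed

section \<open>Bounded integrands, polynomials and integration by parts\<close>

text \<open>Coefficients, flux weights and piecewise polynomials are of this kind on elements and edges, and the
  class is closed under the ring operations. So every integrand of the scheme is integrable.\<close>

definition ess_bounded :: "'a measure \<Rightarrow> ('a \<Rightarrow> real) \<Rightarrow> bool" where
  "ess_bounded M f \<longleftrightarrow> f \<in> borel_measurable M \<and> (\<exists>B. AE x in M. \<bar>f x\<bar> \<le> B)"

lemma ess_bounded_const [intro]: "ess_bounded M (\<lambda>x. c)"
  by (auto simp: ess_bounded_def)

lemma ess_bounded_add [intro]:
  assumes "ess_bounded M f" "ess_bounded M g" shows "ess_bounded M (\<lambda>x. f x + g x)"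
proof -
  obtain A B where "AE x in M. \<bar>f x\<bar> \<le> A" "AE x in M. \<bar>g x\<bar> \<le> B" using assms by (auto simp: ess_bounded_def)
  then have "AE x in M. \<bar>f x + g x\<bar> \<le> A + B" by eventually_elim linarith
  then show ?thesis using assms by (auto simp: ess_bounded_def)
qed

lemma ess_bounded_mult [intro]:
  assumes "ess_bounded M f" "ess_bounded M g" shows "ess_bounded M (\<lambda>x. f x * g x)"
proof -
  obtain A B where "AE x in M. \<bar>f x\<bar> \<le> A" "AE x in M. \<bar>g x\<bar> \<le> B" using assms by (auto simp: ess_bounded_def)
  then have "AE x in M. \<bar>f x * g x\<bar> \<le> A * B"
    by eventually_elim (simp add: abs_mult mult_mono')
  then show ?thesis using assms by (auto simp: ess_bounded_def)
qed

lemma ess_bounded_minus [intro]: "ess_bounded M f \<Longrightarrow> ess_bounded M (\<lambda>x. - f x)"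
  using ess_bounded_mult[OF ess_bounded_const, of M f "-1"] by simp

lemma ess_bounded_diff [intro]: "ess_bounded M f \<Longrightarrow> ess_bounded M g \<Longrightarrow> ess_bounded M (\<lambda>x. f x - g x)"
  using ess_bounded_add[OF _ ess_bounded_minus, of M f g] by simp

lemma ess_bounded_divide_const [intro]: "ess_bounded M f \<Longrightarrow> ess_bounded M (\<lambda>x. f x / c)"
  using ess_bounded_mult[OF _ ess_bounded_const, of M f "1/c"] by simp

lemma ess_bounded_power2 [intro]: "ess_bounded M f \<Longrightarrow> ess_bounded M (\<lambda>x. (f x)\<^sup>2)"
  unfolding power2_eq_square by (rule ess_bounded_mult)

lemma ess_bounded_integrable:
  assumes "finite_measure M" "ess_bounded M f" shows "integrable M f"
  using finite_measure.integrable_const_bound[OF assms(1), of f] assms(2)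
  by (auto simp: ess_bounded_def)

lemma ess_bounded_integrable_edge: "ess_bounded (edge_measure e) f \<Longrightarrow> integrable (edge_measure e) f"
  using ess_bounded_integrable finite_edge_measure by blast

lemma ess_bounded_integrable_simplex:
  "2 simplex (T::point set) \<Longrightarrow> ess_bounded (lebesgue_on T) f \<Longrightarrow> integrable (lebesgue_on T) f"
  by (rule ess_bounded_integrable[OF finite_measure_lebesgue_on[OF lmeasurable_compact[OF simplex_2_compact]]])

lemma ess_bounded_edge_continuous:
  assumes f: "continuous_on UNIV f" and T: "2 simplex T" and e: "e edge_of T"
  shows "ess_bounded (edge_measure e) f"
proof -
  obtain a b c where ab: "e = closed_segment a b" using edge_ccw[OF T e] by metis
  have "compact (f ` e)" unfolding ab
    by (intro compact_continuous_image continuous_on_subset[OF f]) auto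
  then have "bounded (f ` e)" by (rule compact_imp_bounded)
  then obtain B where B: "\<And>x. x \<in> e \<Longrightarrow> \<bar>f x\<bar> \<le> B" unfolding bounded_iff by auto
  have "AE x in edge_measure e. \<bar>f x\<bar> \<le> B"
    using AE_edge_measure_mem[of a b] unfolding ab[symmetric] by eventually_elim (rule B)
  moreover have "f \<in> borel_measurable (edge_measure e)"
    using borel_measurable_continuous_onI[OF f] by (simp add: measurable_cong_sets[OF sets_edge_measure refl])
  ultimately show ?thesis by (auto simp: ess_bounded_def)
qed

lemma ess_bounded_simplex_continuous:
  assumes f: "continuous_on UNIV f" and T: "2 simplex (T :: point set)"
  shows "ess_bounded (lebesgue_on T) f"
proof -
  have "compact (f ` T)"
    using simplex_2_compact[OF T] by (intro compact_continuous_image continuous_on_subset[OF f]) auto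
  then have "bounded (f ` T)" by (rule compact_imp_bounded)
  then obtain B where B: "\<And>x. x \<in> T \<Longrightarrow> \<bar>f x\<bar> \<le> B" unfolding bounded_iff by auto
  have "AE x in lebesgue_on T. \<bar>f x\<bar> \<le> B" using B simplex_2_lebesgue[OF T] by (intro AE_I2) auto
  moreover have "f \<in> borel_measurable (lebesgue_on T)"
    using f by (intro measurable_restrict_space1 measurable_completion)
      (simp add: borel_measurable_continuous_onI)
  ultimately show ?thesis by (auto simp: ess_bounded_def)
qed

text \<open>Continuous differentiability. The derivative is asked to be continuous in each direction only, which
  is equivalent in finite dimension and easier to handle.\<close>

definition C1 :: "(point \<Rightarrow> real) \<Rightarrow> bool" where
  "C1 f \<longleftrightarrow> (\<exists>f'. (\<forall>x. (f has_derivative f' x) (at x)) \<and> (\<forall>w. continuous_on UNIV (\<lambda>x. f' x w)))"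

lemma C1_continuous: "C1 f \<Longrightarrow> continuous_on UNIV f"
  unfolding C1_def using has_derivative_continuous_on[of UNIV f] has_derivative_at_withinI by blast

lemma C1_has_derivative: "C1 f \<Longrightarrow> (f has_derivative frechet_derivative f (at x)) (at x)"
  unfolding C1_def by (metis frechet_derivative_at)

lemma C1_continuous_derivative: "C1 f \<Longrightarrow> continuous_on UNIV (\<lambda>x. frechet_derivative f (at x) w)"
proof -
  assume "C1 f"
  then obtain f' where f': "\<And>x. (f has_derivative f' x) (at x)" "\<And>w. continuous_on UNIV (\<lambda>x. f' x w)"
    unfolding C1_def by blast
  then have "frechet_derivative f (at x) = f' x" for x using frechet_derivative_at by metis
  then show ?thesis using f'(2) by simp
qed

lemma C1_continuous_partial: "C1 f \<Longrightarrow> continuous_on UNIV (partial i f)"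
  using C1_continuous_derivative[of f "axis i 1"] by (simp add: partial_def[abs_def])

lemma C1_const: "C1 (\<lambda>x. c)"
  unfolding C1_def by (rule exI[of _ "\<lambda>_ _. 0"]) auto

lemma C1_nth: "C1 (\<lambda>x. x $ i)"
  unfolding C1_def by (rule exI[of _ "\<lambda>_ w. w $ i"])
    (auto intro!: bounded_linear_imp_has_derivative bounded_linear_vec_nth)

lemma C1_add: assumes "C1 f" "C1 g" shows "C1 (\<lambda>x. f x + g x)"
proof -
  obtain f' g' where f: "\<forall>x. (f has_derivative f' x) (at x)" "\<forall>w. continuous_on UNIV (\<lambda>x. f' x w)"
    and g: "\<forall>x. (g has_derivative g' x) (at x)" "\<forall>w. continuous_on UNIV (\<lambda>x. g' x w)"
    using assms unfolding C1_def by blast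
  show ?thesis unfolding C1_def
    by (rule exI[of _ "\<lambda>x w. f' x w + g' x w"])
      (use f g in \<open>auto intro!: has_derivative_add continuous_intros\<close>)
qed

lemma C1_mult: assumes "C1 f" "C1 g" shows "C1 (\<lambda>x. f x * g x)"
proof -
  obtain f' g' where f: "\<forall>x. (f has_derivative f' x) (at x)" "\<forall>w. continuous_on UNIV (\<lambda>x. f' x w)"
    and g: "\<forall>x. (g has_derivative g' x) (at x)" "\<forall>w. continuous_on UNIV (\<lambda>x. g' x w)"
    using assms unfolding C1_def by blast
  show ?thesis unfolding C1_def
    by (rule exI[of _ "\<lambda>x w. f x * g' x w + f' x w * g x"])
      (use f g C1_continuous[OF assms(1)] C1_continuous[OF assms(2)]
        in \<open>auto intro!: has_derivative_mult continuous_intros\<close>)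
qed

lemma C1_power: "C1 f \<Longrightarrow> C1 (\<lambda>x. f x ^ n)"
  by (induction n) (auto intro: C1_const C1_mult)

lemma C1_sum: "(\<And>i. i \<in> I \<Longrightarrow> C1 (f i)) \<Longrightarrow> C1 (\<lambda>x. \<Sum>i\<in>I. f i x)"
  by (induction I rule: infinite_finite_induct) (auto intro: C1_const C1_add)

lemma poly_space_C1: "p \<in> poly_space N \<Longrightarrow> C1 p"
  unfolding poly_space_def mem_Collect_eq
  by (elim exE, hypsubst) (intro C1_sum C1_mult C1_power C1_nth C1_const)

lemma poly_space_add:
  assumes "p \<in> poly_space N" "q \<in> poly_space N" shows "(\<lambda>x. p x + q x) \<in> poly_space N"
proof -
  obtain c d where p: "p = (\<lambda>x. \<Sum>i\<le>N. \<Sum>j\<le>N - i. c i j * (x $ 1) ^ i * (x $ 2) ^ j)"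
    and q: "q = (\<lambda>x. \<Sum>i\<le>N. \<Sum>j\<le>N - i. d i j * (x $ 1) ^ i * (x $ 2) ^ j)"
    using assms unfolding poly_space_def by blast
  have "(\<lambda>x. p x + q x) = (\<lambda>x. \<Sum>i\<le>N. \<Sum>j\<le>N - i. (c i j + d i j) * (x $ 1) ^ i * (x $ 2) ^ j)"
    unfolding p q by (simp add: sum.distrib algebra_simps)
  then show ?thesis unfolding poly_space_def mem_Collect_eq by (rule exI[of _ "\<lambda>i j. c i j + d i j"])
qed

lemma poly_space_zero: "(\<lambda>x. 0) \<in> poly_space N"
  unfolding poly_space_def mem_Collect_eq by (rule exI[of _ "\<lambda>i j. 0"]) simp

lemma partial_add: "C1 f \<Longrightarrow> C1 g \<Longrightarrow> partial i (\<lambda>x. f x + g x) x = partial i f x + partial i g x"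
proof -
  assume "C1 f" "C1 g"
  then have "((\<lambda>x. f x + g x) has_derivative (\<lambda>w. frechet_derivative f (at x) w
      + frechet_derivative g (at x) w)) (at x)"
    by (intro has_derivative_add C1_has_derivative)
  from frechet_derivative_at[OF this, symmetric] show ?thesis by (simp add: partial_def)
qed

lemma partial_mult: "C1 f \<Longrightarrow> C1 g \<Longrightarrow> partial i (\<lambda>x. f x * g x) x = f x * partial i g x + partial i f x * g x"
proof -
  assume "C1 f" "C1 g"
  then have "((\<lambda>x. f x * g x) has_derivative (\<lambda>w. f x * frechet_derivative g (at x) w
      + frechet_derivative f (at x) w * g x)) (at x)"
    by (intro has_derivative_mult C1_has_derivative)
  from frechet_derivative_at[OF this, symmetric] show ?thesis by (simp add: partial_def)
qed

lemma integration_by_parts: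
  assumes T: "2 simplex T" and f: "C1 f" and g: "C1 g"
  shows "(LINT x|lebesgue_on T. partial i f x * g x) =
    boundary_integral T (\<lambda>e x. outward_normal T e $ i * (f x * g x))
        - (LINT x|lebesgue_on T. f x * partial i g x)"
proof -
  have fg: "C1 (\<lambda>x. f x * g x)" using f g by (rule C1_mult)
  have "boundary_integral T (\<lambda>e x. outward_normal T e $ i * (f x * g x))
      = (LINT x|lebesgue_on T. partial i (\<lambda>x. f x * g x) x)"
    using triangle_divergence[OF T C1_has_derivative[OF fg] C1_continuous_derivative[OF fg], of "axis i 1"]
    by (simp add: partial_def inner_axis)
  also have "\<dots> = (LINT x|lebesgue_on T. f x * partial i g x + partial i f x * g x)"
    by (simp add: partial_mult[OF f g])
  also have "\<dots> = (LINT x|lebesgue_on T. f x * partial i g x) + (LINT x|lebesgue_on T. partial i f x * g x)"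
    using f g by (intro Bochner_Integration.integral_add ess_bounded_integrable_simplex[OF T] ess_bounded_mult
      ess_bounded_simplex_continuous[OF _ T] C1_continuous C1_continuous_partial)
  finally show ?thesis by simp
qed

lemma L2_norm_square: "(L2_norm S f)\<^sup>2 = (LINT x|lebesgue_on S. (f x)\<^sup>2)"
  unfolding L2_norm_def by (simp add: integral_nonneg_AE)

lemma boundary_integral_square_nonneg: "0 \<le> boundary_integral T (\<lambda>e x. (f x)\<^sup>2)"
  unfolding boundary_integral_def by (intro sum_nonneg) (simp add: integral_nonneg_AE)

lemma L2_boundary_norm_square: "(L2_boundary_norm T f)\<^sup>2 = boundary_integral T (\<lambda>e x. (f x)\<^sup>2)"
  unfolding L2_boundary_norm_def using boundary_integral_square_nonneg by simp

abbreviation curl_integral :: "point set \<Rightarrow> (point \<Rightarrow> real) \<Rightarrow> (point \<Rightarrow> real) \<Rightarrow> (point \<Rightarrow> real) \<Rightarrow> real" where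
  "curl_integral T h p1 p2 \<equiv> (LINT x|lebesgue_on T. partial 2 h x * p1 x - partial 1 h x * p2 x)"

text \<open>Young's inequality under the integral, with the weight \<open>k\<close> that balances both terms. For \<open>k = 0\<close>
  (polynomials of degree 0) this weight is not allowed; slightly larger weights are, and the bound follows
  in the limit.\<close>

lemma curl_integral_bound:
  assumes T: "2 simplex T" and h: "C1 h" and p1: "C1 p1" and p2: "C1 p2" and k: "k \<ge> 0"
    and inv: "H1_norm T h \<le> k * L2_norm T h"
  shows "\<bar>curl_integral T h p1 p2\<bar>
    \<le> k / 2 * ((L2_norm T p1)\<^sup>2 + (L2_norm T p2)\<^sup>2 + (L2_norm T h)\<^sup>2)"
proof -
  note eb = ess_bounded_simplex_continuous[OF _ T] and int = ess_bounded_integrable_simplex[OF T]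
  have ebs: "ess_bounded (lebesgue_on T) (partial i h)" "ess_bounded (lebesgue_on T) h"
     "ess_bounded (lebesgue_on T) p1"  "ess_bounded (lebesgue_on T) p2" for i
    using eb h p1 p2 C1_continuous C1_continuous_partial by blast+
  let ?a = "\<lambda>x. partial 2 h x * p1 x - partial 1 h x * p2 x"
  define X where "X = (L2_norm T p1)\<^sup>2 + (L2_norm T p2)\<^sup>2 + (L2_norm T h)\<^sup>2"
  have weighted: "\<bar>LINT x|lebesgue_on T. ?a x\<bar> \<le> k / 2 * X" if k: "k > 0" and inv: "H1_norm T h
      \<le> k * L2_norm T h" for k
  proof -
    let ?b = "\<lambda>x. 1 / (2 * k) * ((partial 1 h x)\<^sup>2 + (partial 2 h x)\<^sup>2) + k / 2 * ((p1 x)\<^sup>2 + (p2 x)\<^sup>2)"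
    have pt: "\<bar>?a x\<bar> \<le> ?b x" for x
    proof -
      have y: "\<bar>u * v\<bar> \<le> 1 / (2 * k) * u\<^sup>2 + k / 2 * v\<^sup>2" for u v :: real
      proof -
        have "0 \<le> (\<bar>u\<bar> - k * \<bar>v\<bar>)\<^sup>2" by simp
        then have "2 * k * \<bar>u * v\<bar> \<le> u\<^sup>2 + k\<^sup>2 * v\<^sup>2"
          by (simp add: power2_diff power_mult_distrib abs_mult algebra_simps)
        then show ?thesis using k by (simp add: field_simps power2_eq_square)
      qed
      show ?thesis using y[of "partial 2 h x" "p1 x"] y[of "partial 1 h x" "p2 x"] by (simp add: algebra_simps)
    qed
    have ia: "integrable (lebesgue_on T) ?a" and ib: "integrable (lebesgue_on T) ?b"
      by (intro int ess_bounded_diff ess_bounded_add ess_bounded_mult ess_bounded_power2 ess_bounded_const ebs)+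
    have "\<bar>LINT x|lebesgue_on T. ?a x\<bar> \<le> (LINT x|lebesgue_on T. \<bar>?a x\<bar>)"
      by (rule integral_abs_bound)
    also have "\<dots> \<le> (LINT x|lebesgue_on T. ?b x)" using ia ib pt by (intro integral_mono) auto
    also have "\<dots> = 1 / (2 * k) * ((L2_norm T (partial 1 h))\<^sup>2 + (L2_norm T (partial 2 h))\<^sup>2)
         + k / 2 * ((L2_norm T p1)\<^sup>2 + (L2_norm T p2)\<^sup>2)"
      using int[OF ess_bounded_power2[OF ebs(1)]] int[OF ess_bounded_power2[OF ebs(3)]] int[OF
        ess_bounded_power2[OF ebs(4)]]
      by (simp add: L2_norm_square)
    also have "(L2_norm T (partial 1 h))\<^sup>2 + (L2_norm T (partial 2 h))\<^sup>2 \<le> (H1_norm T h)\<^sup>2"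
      unfolding H1_norm_def by simp
    also have "(H1_norm T h)\<^sup>2 \<le> (k * L2_norm T h)\<^sup>2"
      using inv by (intro power_mono) (auto simp: H1_norm_def)
    finally show ?thesis using k by (simp add: X_def power_mult_distrib field_simps power2_eq_square)
  qed
  have "\<bar>LINT x|lebesgue_on T. ?a x\<bar> \<le> k / 2 * X + d" if d: "d > 0" for d
  proof -
    have X: "X \<ge> 0" by (simp add: X_def)
    define k' where "k' = k + 2 * d / (X + 1)"
    have k': "k' > 0" "k \<le> k'" using k X d by (auto simp: k'_def intro!: add_nonneg_pos)
    have "H1_norm T h \<le> k' * L2_norm T h"
      using inv mult_right_mono[OF k'(2), of "L2_norm T h"] by (simp add: L2_norm_def integral_nonneg_AE)
    from weighted[OF k'(1) this] have "\<bar>LINT x|lebesgue_on T. ?a x\<bar> \<le> k / 2 * X + d * (X / (X + 1))"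
      by (simp add: k'_def field_simps)
    also have "d * (X / (X + 1)) \<le> d * 1" using X d by (intro mult_left_mono) auto
    finally show ?thesis by simp
  qed
  then show ?thesis unfolding X_def by (rule field_le_epsilon)
qed

section \<open>Inequalities for the two values at a point of an edge\<close>

text \<open>The weights \<open>t\<close> and \<open>1 - t\<close> are those of \<open>Z\<^sup>+\<close> and \<open>Z\<^sup>-\<close>, \<open>d\<close> is the jump of the magnetic field and
  \<open>a\<close>, \<open>b\<close> are the tangential components on both sides. By convexity the square of the weighted mean of
  \<open>a\<close> and \<open>-b\<close> is at most \<open>a\<^sup>2 + b\<^sup>2\<close>.\<close>

lemma weighted_average_product_le:
  fixes t :: real
  assumes "0 \<le> t" "t \<le> 1" "\<bar>s\<bar> \<le> 1"
  shows "s * (t * d * a - (1 - t) * d * b) \<le> (d\<^sup>2 + a\<^sup>2 + b\<^sup>2) / 2"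
proof -
  define m where "m = t * a - (1 - t) * b"
  have "t * a\<^sup>2 + (1 - t) * b\<^sup>2 - m\<^sup>2 = t * (1 - t) * (a + b)\<^sup>2"
    unfolding m_def by (simp add: power2_eq_square algebra_simps)
  moreover have "t * (1 - t) * (a + b)\<^sup>2 \<ge> 0" using assms by simp
  ultimately have "m\<^sup>2 \<le> t * a\<^sup>2 + (1 - t) * b\<^sup>2" by linarith
  also have "\<dots> \<le> a\<^sup>2 + b\<^sup>2" using assms by (intro add_mono mult_left_le_one_le) auto
  finally have m: "m\<^sup>2 \<le> a\<^sup>2 + b\<^sup>2" .
  have "s * (d * m) \<le> \<bar>s\<bar> * \<bar>d * m\<bar>" by (metis abs_ge_self abs_mult)
  also have "\<dots> \<le> \<bar>d * m\<bar>" using assms by (intro mult_left_le_one_le) auto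
  also have "\<dots> \<le> (d\<^sup>2 + m\<^sup>2) / 2"
    using sum_squares_bound[of "\<bar>d\<bar>" "\<bar>m\<bar>"] by (simp add: abs_mult)
  also have "s * (d * m) = s * (t * d * a - (1 - t) * d * b)" by (simp add: m_def algebra_simps)
  finally show ?thesis using m by simp
qed

lemma penalty_square_le:
  fixes c :: real
  assumes "0 \<le> f" "0 < c" "c \<le> u" "c \<le> v"
  shows "f / (u + v) * (a + b)\<^sup>2 \<le> f / c * (a\<^sup>2 + b\<^sup>2)"
proof -
  have "f / (u + v) \<le> f / (2 * c)" using assms by (intro frac_le) auto
  moreover have "(a + b)\<^sup>2 \<le> 2 * (a\<^sup>2 + b\<^sup>2)"
    using sum_squares_bound[of a b] by (simp add: power2_sum)
  ultimately have "f / (u + v) * (a + b)\<^sup>2 \<le> f / (2 * c) * (2 * (a\<^sup>2 + b\<^sup>2))"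
    using assms by (intro mult_mono) auto
  also have "f / (2 * c) * (2 * (a\<^sup>2 + b\<^sup>2)) = f / c * (a\<^sup>2 + b\<^sup>2)"
    using assms by (simp add: field_simps)
  finally show ?thesis .
qed

text \<open>Here \<open>x\<close>, \<open>y\<close> are the two values of the magnetic field and \<open>a\<close>, \<open>b\<close> the two tangential components of
  the electric field, each taken with the outward normal of its own element; then \<open>a + b\<close> is the
  tangential jump. The first line contains the coupling terms of both sides, the factors \<open>1/2\<close> belong to
  the penalty terms of the energy.\<close>

lemma interior_edge_bound:
  fixes zp zm :: real
  assumes s: "\<bar>s\<bar> \<le> 1" and f: "0 \<le> f" and Zc: "0 < Zc" "Zc \<le> zp" "Zc \<le> zm"
    and Yc: "0 < Yc" "Yc \<le> 1 / zp" "Yc \<le> 1 / zm"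
  shows "s * (zp / (zp + zm) * (x - y) * a + zm / (zm + zp) * (y - x) * b)
     + 1/2 * (f / (zp + zm) * (a + b)\<^sup>2) + 1/2 * (f / (1 / zp + 1 / zm) * (x - y)\<^sup>2)
     \<le> (1/2 + f / (2 * Zc)) * (a\<^sup>2 + b\<^sup>2) + (1 + f / (2 * Yc)) * (x\<^sup>2 + y\<^sup>2)"
proof -
  define t where "t = zp / (zp + zm)"
  have t: "0 \<le> t" "t \<le> 1" and t1: "zm / (zm + zp) = 1 - t" using Zc by (auto simp: t_def field_simps)
  have "s * (t * (x - y) * a - (1 - t) * (x - y) * b) \<le> ((x - y)\<^sup>2 + a\<^sup>2 + b\<^sup>2) / 2"
    using weighted_average_product_le[OF t s] .
  moreover have "(x - y)\<^sup>2 \<le> 2 * (x\<^sup>2 + y\<^sup>2)"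
    using sum_squares_bound[of x "- y"] by (simp add: power2_diff)
  ultimately have "s * (t * (x - y) * a + (1 - t) * (y - x) * b) \<le> (x\<^sup>2 + y\<^sup>2) + 1/2 * (a\<^sup>2 + b\<^sup>2)"
    by (simp add: algebra_simps)
  moreover have half: "f / (2 * c) * q = 1/2 * (f / c * q)" for c q :: real by simp
  have "1/2 * (f / (zp + zm) * (a + b)\<^sup>2) \<le> f / (2 * Zc) * (a\<^sup>2 + b\<^sup>2)"
    
    unfolding half by (intro mult_left_mono penalty_square_le f Zc) simp
  moreover have "1/2 * (f / (1 / zp + 1 / zm) * (x - y)\<^sup>2) \<le> f / (2 * Yc) * (x\<^sup>2 + y\<^sup>2)"
    unfolding half using penalty_square_le[OF f Yc, of x "- y"] by (intro mult_left_mono) simp_all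
  ultimately show ?thesis unfolding t_def[symmetric] t1 by (simp add: algebra_simps)
qed

section \<open>Sums over the sides of all edges\<close>

text \<open>A broken function has one function for every element; an edge function has one for every side of an
  edge, that is, for every pair of an element and one of its edges.\<close>

type_synonym broken_function = "point set \<Rightarrow> point \<Rightarrow> real"
type_synonym edge_function = "point set \<Rightarrow> point set \<Rightarrow> point \<Rightarrow> real"

text \<open>The data of the spatial discretisation. The trace and inverse inequalities are hypotheses of the
  coercivity estimate, and the time step belongs to the energy balance.\<close>

locale maxwell_dg =
  fixes \<Omega> :: "point set" and \<T> :: "point set set"
    and \<epsilon> :: "point \<Rightarrow> real^2^2" and \<mu> :: "point \<Rightarrow> real"
    and \<epsilon>T :: "point set \<Rightarrow> point \<Rightarrow> real^2^2" and \<mu>T :: "point set \<Rightarrow> point \<Rightarrow> real"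
    and N :: nat and bc :: boundary_condition
    and eps_lo eps_hi mu_lo mu_hi \<alpha> :: real
  assumes domain: "polygonal_domain \<Omega>"
    and mesh: "conforming_mesh \<Omega> \<T>"
    and coeff_meas: "\<epsilon> \<in> borel_measurable (lebesgue_on \<Omega>)" "\<mu> \<in> borel_measurable (lebesgue_on \<Omega>)"
    and coeff_pos: "eps_lo > 0" "eps_hi > 0" "mu_lo > 0" "mu_hi > 0"
    and eps_sym: "AE x in lebesgue_on \<Omega>. transpose (\<epsilon> x) = \<epsilon> x"
    and eps_bounds: "AE x in lebesgue_on \<Omega>. \<forall>\<xi>.
          eps_lo * (norm \<xi>)\<^sup>2 \<le> \<xi> \<bullet> (\<epsilon> x *v \<xi>) \<and> \<xi> \<bullet> (\<epsilon> x *v \<xi>) \<le> eps_hi * (norm \<xi>)\<^sup>2"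
    and mu_bounds: "AE x in lebesgue_on \<Omega>. mu_lo \<le> \<mu> x \<and> \<mu> x \<le> mu_hi"
    and eps_trace: "\<And>T e. T \<in> \<T> \<Longrightarrow> e edge_of T \<Longrightarrow> edge_trace \<epsilon> T e (\<epsilon>T T)"
    and mu_trace: "\<And>T e. T \<in> \<T> \<Longrightarrow> e edge_of T \<Longrightarrow> edge_trace \<mu> T e (\<mu>T T)"
    and alpha: "0 \<le> \<alpha>" "\<alpha> \<le> 1"
begin

lemma open_domain: "open \<Omega>"
  using domain by (simp add: polygonal_domain_def)

lemmas element = mesh_simplex[OF mesh]

lemma finite_edges: "T \<in> \<T> \<Longrightarrow> finite {e. e edge_of T}"
  using simplex_2_ccw[OF element] ccw_edges by (metis finite.emptyI finite.insertI)

lemma finite_mesh: "finite \<T>"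
  using mesh_finite[OF mesh] .

lemma mesh_nonempty: "\<T> \<noteq> {}"
proof
  assume "\<T> = {}"
  then have "closure \<Omega> = {}" using mesh by (simp add: conforming_mesh_def)
  then show False using domain by (simp add: polygonal_domain_def)
qed

lemma eps_admissible:
  assumes "T \<in> \<T>" shows "AE x in lebesgue_on T. \<epsilon> x \<in> admissible eps_lo eps_hi"
proof -
  have "AE x in lebesgue_on \<Omega>. \<epsilon> x \<in> admissible eps_lo eps_hi"
    using eps_sym eps_bounds by eventually_elim (simp add: admissible_def)
  then show ?thesis by (rule AE_mesh_element[OF domain mesh assms])
qed

lemma mu_bounds_element:
  assumes "T \<in> \<T>" shows "AE x in lebesgue_on T. mu_lo \<le> \<mu> x \<and> \<mu> x \<le> mu_hi"
  by (rule AE_mesh_element[OF domain mesh assms mu_bounds])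

lemma traces_admissible:
  assumes "T \<in> \<T>" "e edge_of T"
  shows "AE x in edge_measure e. \<epsilon>T T x \<in> admissible eps_lo eps_hi"
    "AE x in edge_measure e. mu_lo \<le> \<mu>T T x \<and> \<mu>T T x \<le> mu_hi"
proof -
  show "AE x in edge_measure e. \<epsilon>T T x \<in> admissible eps_lo eps_hi"
    by (rule trace_in_closed[OF element[OF assms(1)] assms(2) eps_trace[OF assms]
      measurable_mesh_element[OF domain mesh assms(1) coeff_meas(1)] admissible_closed
      admissible_bounded[OF coeff_pos(1)] eps_admissible[OF assms(1)]])
  have "AE x in edge_measure e. \<mu>T T x \<in> {mu_lo..mu_hi}"
    by (rule trace_in_closed[OF element[OF assms(1)] assms(2) mu_trace[OF assms]
      measurable_mesh_element[OF domain mesh assms(1) coeff_meas(2)]])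
      (use mu_bounds_element[OF assms(1)] in auto)
  then show "AE x in edge_measure e. mu_lo \<le> \<mu>T T x \<and> \<mu>T T x \<le> mu_hi" by simp
qed

abbreviation Z :: edge_function where
  "Z \<equiv> Z_minus \<epsilon>T \<mu>T"

abbreviation Zmin :: real where "Zmin \<equiv> Z_min \<T> \<epsilon>T \<mu>T"
abbreviation Ymin :: real where "Ymin \<equiv> Y_min \<T> \<epsilon>T \<mu>T"

definition Z_lo :: real where "Z_lo = mu_lo * sqrt (eps_lo / (mu_hi * eps_hi\<^sup>2))"
definition Z_hi :: real where "Z_hi = mu_hi * sqrt (eps_hi / (mu_lo * eps_lo\<^sup>2))"

lemma Z_lo_pos: "Z_lo > 0" and Z_hi_pos: "Z_hi > 0"
  using coeff_pos by (auto simp: Z_lo_def Z_hi_def)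

lemma Z_bounds:
  assumes "T \<in> \<T>" "e edge_of T"
  shows "AE x in edge_measure e. Z_lo \<le> Z T e x \<and> Z T e x \<le> Z_hi"
  using traces_admissible[OF assms]
proof eventually_elim
  fix x assume "\<epsilon>T T x \<in> admissible eps_lo eps_hi" "mu_lo \<le> \<mu>T T x \<and> \<mu>T T x \<le> mu_hi"
  then show "Z_lo \<le> Z T e x \<and> Z T e x \<le> Z_hi"
    unfolding Z_lo_def Z_hi_def Z_minus_def
    using impedance_bounds[of "\<epsilon>T T x" eps_lo eps_hi mu_lo "\<mu>T T x" mu_hi "outward_normal T e"]
      coeff_pos norm_outward_normal[OF element[OF assms(1)] assms(2)] by blast
qed

lemma Z_measurable:
  assumes "T \<in> \<T>" "e edge_of T" shows "Z T e \<in> borel_measurable (edge_measure e)"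
proof -
  have m: "\<epsilon>T T \<in> borel_measurable (edge_measure e)" "\<mu>T T \<in> borel_measurable (edge_measure e)"
    using eps_trace[OF assms] mu_trace[OF assms] by (auto simp: edge_trace_def)
  have ij: "(\<lambda>x. \<epsilon>T T x $ i $ j) \<in> borel_measurable (edge_measure e)" for i j
    by (rule measurable_compose[OF m(1)], rule borel_measurable_continuous_onI) (intro continuous_intros)
  show ?thesis
    unfolding Z_minus_def[abs_def] impedance_def wave_speed_def det_2 inner_plane matrix_vector_plane
    using m(2) ij by measurable
qed

lemma edge_ends:
  assumes "T \<in> \<T>" "e edge_of T" obtains a b where "a \<noteq> b" "e = closed_segment a b"
  using edge_ccw[OF element[OF assms(1)] assms(2)] ccw_distinct(1) by metis

lemma mesh_inf_bounds:
  assumes lo: "l > 0"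
    and f: "\<And>T e. T \<in> \<T> \<Longrightarrow> e edge_of T \<Longrightarrow> f T e \<in> borel_measurable (edge_measure e)"
    and b: "\<And>T e. T \<in> \<T> \<Longrightarrow> e edge_of T \<Longrightarrow> AE x in edge_measure e. l \<le> f T e x \<and> f T e x \<le> h"
  shows "mesh_inf \<T> f > 0"
    and "\<And>T e. T \<in> \<T> \<Longrightarrow> e edge_of T \<Longrightarrow> AE x in edge_measure e. mesh_inf \<T> f \<le> f T e x"
proof -
  let ?S = "{edge_inf e (f T e) | T e. T \<in> \<T> \<and> e edge_of T}"
  have "?S = (\<Union>T\<in>\<T>. (\<lambda>e. edge_inf e (f T e)) ` {e. e edge_of T})" by auto
  then have fin: "finite ?S" using finite_mesh finite_edges by auto
  have inf: "l \<le> edge_inf e (f T e)" "AE x in edge_measure e. edge_inf e (f T e) \<le> f T e x"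
    if "T \<in> \<T>" "e edge_of T" for T e
    using edge_ends[OF that] edge_inf_bounds[OF _ _ f[OF that] b[OF that]] by metis+
  obtain T where T: "T \<in> \<T>" using mesh_nonempty by blast
  then obtain e where "e edge_of T" using simplex_2_ccw[OF element] ccw_edges by (metis insertI1 mem_Collect_eq)
  then have "?S \<noteq> {}" using T by blast
  then have "l \<le> Min ?S" using fin inf(1) by (subst Min_ge_iff) auto
  then show "mesh_inf \<T> f > 0" using lo by (simp add: mesh_inf_def)
  show "AE x in edge_measure e. mesh_inf \<T> f \<le> f T e x" if "T \<in> \<T>" "e edge_of T" for T e
  proof -
    have "mesh_inf \<T> f \<le> edge_inf e (f T e)"
      unfolding mesh_inf_def using that by (intro Min_le[OF fin]) blast
    then show ?thesis using inf(2)[OF that] by (auto elim!: eventually_mono)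
  qed
qed

lemma Zmin_pos: "Zmin > 0" and Ymin_pos: "Ymin > 0"
  and Zmin_le: "\<And>T e. T \<in> \<T> \<Longrightarrow> e edge_of T \<Longrightarrow> AE x in edge_measure e. Zmin \<le> Z T e x"
  and Ymin_le: "\<And>T e. T \<in> \<T> \<Longrightarrow> e edge_of T \<Longrightarrow> AE x in edge_measure e. Ymin \<le> 1 / Z T e x"
proof -
  show "Zmin > 0" unfolding Z_min_def
    by (rule mesh_inf_bounds(1)[OF Z_lo_pos Z_measurable Z_bounds])
  show "\<And>T e. T \<in> \<T> \<Longrightarrow> e edge_of T \<Longrightarrow> AE x in edge_measure e. Zmin \<le> Z T e x" unfolding Z_min_def
    by (rule mesh_inf_bounds(2)[OF Z_lo_pos Z_measurable Z_bounds])
  have p: "1 / Z_hi > 0" using Z_hi_pos by simp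
  have m: "(\<lambda>x. 1 / Z T e x) \<in> borel_measurable (edge_measure e)" if "T \<in> \<T>" "e edge_of T" for T e
    using Z_measurable[OF that] by measurable
  have b: "AE x in edge_measure e. 1 / Z_hi \<le> 1 / Z T e x \<and> 1 / Z T e x \<le> 1 / Z_lo"
    if "T \<in> \<T>" "e edge_of T" for T e
    using Z_bounds[OF that]
  proof eventually_elim
    fix x assume "Z_lo \<le> Z T e x \<and> Z T e x \<le> Z_hi"
    then show "1 / Z_hi \<le> 1 / Z T e x \<and> 1 / Z T e x \<le> 1 / Z_lo"
      using Z_lo_pos by (auto intro!: frac_le)
  qed
  show "Ymin > 0" unfolding Y_min_def by (rule mesh_inf_bounds(1)[OF p m b])
  show "\<And>T e. T \<in> \<T> \<Longrightarrow> e edge_of T \<Longrightarrow> AE x in edge_measure e. Ymin \<le> 1 / Z T e x"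
    unfolding Y_min_def by (rule mesh_inf_bounds(2)[OF p m b])
qed

text \<open>The element on the other side of the edge. On the boundary it is the element itself, which makes
  \<open>(T, e) \<mapsto> (mirror T e, e)\<close> an involution on all sides of edges and agrees with the convention
  \<open>Z\<^sup>+ = Z\<^sup>-\<close> there.\<close>

definition mirror :: "point set \<Rightarrow> point set \<Rightarrow> point set" where
  "mirror T e = (if e \<subseteq> frontier \<Omega> then T else neighbor \<T> T e)"

lemma mirror_properties:
  assumes "T \<in> \<T>" "e edge_of T"
  shows "mirror T e \<in> \<T>" "e edge_of mirror T e" "mirror (mirror T e) e = T"
  using neighbor_properties[OF open_domain mesh assms] assms by (auto simp: mirror_def)

lemma Z_plus_mirror:
  assumes "T \<in> \<T>" "e edge_of T" shows "Z_plus \<Omega> \<T> \<epsilon>T \<mu>T T e x = Z (mirror T e) e x"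
  using neighbor_properties(4)[OF open_domain mesh assms]
  by (auto simp: Z_plus_def mirror_def Z_minus_def impedance_minus)

lemma Z_pair_bounds:
  assumes "T \<in> \<T>" "e edge_of T"
  shows "AE x in edge_measure e. Z_lo \<le> Z T e x \<and> Z T e x \<le> Z_hi \<and>
      Z_lo \<le> Z (mirror T e) e x \<and> Z (mirror T e) e x \<le> Z_hi \<and>
      Zmin \<le> Z T e x \<and> Zmin \<le> Z (mirror T e) e x \<and>
      Ymin \<le> 1 / Z T e x \<and> Ymin \<le> 1 / Z (mirror T e) e x"
  using Z_bounds[OF assms] Z_bounds[OF mirror_properties(1,2)[OF assms]]
    Zmin_le[OF assms] Zmin_le[OF mirror_properties(1,2)[OF assms]]
    Ymin_le[OF assms] Ymin_le[OF mirror_properties(1,2)[OF assms]]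
  by eventually_elim simp

definition skeleton :: "edge_function \<Rightarrow> real" where
  "skeleton F = (\<Sum>T\<in>\<T>. boundary_integral T (F T))"

definition edge_bounded :: "edge_function \<Rightarrow> bool" where
  "edge_bounded F \<longleftrightarrow> (\<forall>T\<in>\<T>. \<forall>e. e edge_of T \<longrightarrow> ess_bounded (edge_measure e) (F T e))"

abbreviation edge_pairs :: "(point set \<times> point set) set" where
  "edge_pairs \<equiv> SIGMA T:\<T>. {e. e edge_of T}"

lemma skeleton_pairs: "skeleton F = (\<Sum>(T, e)\<in>edge_pairs. LINT x|edge_measure e. F T e x)"
  unfolding skeleton_def boundary_integral_def
  by (subst sum.Sigma) (auto simp: finite_mesh finite_edges)

lemma skeleton_mirror: "skeleton (\<lambda>T e. F (mirror T e) e) = skeleton F"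
  unfolding skeleton_pairs
  by (rule sum.reindex_bij_witness[of _ "\<lambda>(T, e). (mirror T e, e)" "\<lambda>(T, e). (mirror T e, e)"])
    (auto simp: mirror_properties)

lemma edge_bounded_add: "edge_bounded F \<Longrightarrow> edge_bounded G \<Longrightarrow> edge_bounded (\<lambda>T e x. F T e x + G T e x)"
  and edge_bounded_diff: "edge_bounded F \<Longrightarrow> edge_bounded G \<Longrightarrow> edge_bounded (\<lambda>T e x. F T e x - G T e x)"
  and edge_bounded_mult: "edge_bounded F \<Longrightarrow> edge_bounded G \<Longrightarrow> edge_bounded (\<lambda>T e x. F T e x * G T e x)"
  and edge_bounded_minus: "edge_bounded F \<Longrightarrow> edge_bounded (\<lambda>T e x. - F T e x)"
  and edge_bounded_power2: "edge_bounded F \<Longrightarrow> edge_bounded (\<lambda>T e x. (F T e x)\<^sup>2)"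
  and edge_bounded_const: "edge_bounded (\<lambda>T e x. c T e)"
  unfolding edge_bounded_def by blast+

lemma edge_bounded_mirror: "edge_bounded F \<Longrightarrow> edge_bounded (\<lambda>T e. F (mirror T e) e)"
  unfolding edge_bounded_def using mirror_properties by blast

lemma edge_bounded_if:
  assumes "edge_bounded F" "edge_bounded G"
  shows "edge_bounded (\<lambda>T e x. if P e then F T e x else G T e x)"
proof -
  have "ess_bounded (edge_measure e) (\<lambda>x. if P e then F T e x else G T e x)"
    if "T \<in> \<T>" "e edge_of T" for T e
    using assms that by (cases "P e") (auto simp: edge_bounded_def)
  then show ?thesis unfolding edge_bounded_def by blast
qed

lemma skeleton_add:
  assumes "edge_bounded F" "edge_bounded G"
  shows "skeleton (\<lambda>T e x. F T e x + G T e x) = skeleton F + skeleton G"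
  unfolding skeleton_pairs sum.distrib[symmetric]
  using assms unfolding edge_bounded_def
  by (intro sum.cong) (auto intro!: Bochner_Integration.integral_add ess_bounded_integrable_edge)

lemma skeleton_cmult: "skeleton (\<lambda>T e x. c * F T e x) = c * skeleton F"
  unfolding skeleton_pairs sum_distrib_left by (intro sum.cong) auto

lemma skeleton_uminus: "skeleton (\<lambda>T e x. - F T e x) = - skeleton F"
  using skeleton_cmult[of "-1" F] by simp

lemma skeleton_cong:
  assumes "\<And>T e x. T \<in> \<T> \<Longrightarrow> e edge_of T \<Longrightarrow> F T e x = G T e x" shows "skeleton F = skeleton G"
  unfolding skeleton_pairs using assms by (intro sum.cong) (auto intro!: Bochner_Integration.integral_cong)

text \<open>The tool for all edge estimates: a sum over all sides does not change when every side is replaced by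
  its mirror image, so it suffices to compare the contributions of the two sides of an edge together.\<close>

lemma skeleton_mono_mirrored:
  assumes F: "edge_bounded F" and G: "edge_bounded G"
    and le: "\<And>T e. T \<in> \<T> \<Longrightarrow> e edge_of T \<Longrightarrow> AE x in edge_measure e.
      F T e x + F (mirror T e) e x \<le> G T e x + G (mirror T e) e x"
  shows "skeleton F \<le> skeleton G"
proof -
  note FF = edge_bounded_add[OF F edge_bounded_mirror[OF F]]
  note GG = edge_bounded_add[OF G edge_bounded_mirror[OF G]]
  have "skeleton (\<lambda>T e x. F T e x + F (mirror T e) e x) \<le> skeleton (\<lambda>T e x. G T e x + G (mirror T e) e x)"
    unfolding skeleton_pairs
  proof (intro sum_mono, clarify)
    fix T e assume "T \<in> \<T>" "e edge_of T"
    then show "(LINT x|edge_measure e. F T e x + F (mirror T e) e x)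
        \<le> (LINT x|edge_measure e. G T e x + G (mirror T e) e x)"
      using FF GG le unfolding edge_bounded_def
      by (intro integral_mono_AE ess_bounded_integrable_edge) auto
  qed
  then show ?thesis
    using skeleton_add[OF F edge_bounded_mirror[OF F]] skeleton_add[OF G edge_bounded_mirror[OF G]]
      skeleton_mirror[of F] skeleton_mirror[of G] by simp
qed

lemma skeleton_zero: "skeleton (\<lambda>T e x. 0) = 0"
  using skeleton_cmult[of 0 "\<lambda>T e x. 0"] by simp

text \<open>Contributions that cancel between the two sides of every edge have sum zero.\<close>

lemma skeleton_antisymmetric:
  assumes F: "edge_bounded F"
    and eq: "\<And>T e. T \<in> \<T> \<Longrightarrow> e edge_of T \<Longrightarrow> AE x in edge_measure e. F T e x + F (mirror T e) e x = 0"
  shows "skeleton F = 0"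
proof (rule antisym)
  have z: "edge_bounded (\<lambda>T e x. 0)" by (rule edge_bounded_const)
  show "skeleton F \<le> 0"
    using skeleton_mono_mirrored[OF F z] eq skeleton_zero by (force elim!: eventually_mono)
  show "0 \<le> skeleton F"
    using skeleton_mono_mirrored[OF z F] eq skeleton_zero by (force elim!: eventually_mono)
qed

section \<open>Jumps, weights and the bilinear forms of the scheme\<close>


definition broken_poly :: "broken_function \<Rightarrow> bool" where
  "broken_poly p \<longleftrightarrow> (\<forall>T\<in>\<T>. p T \<in> poly_space N)"

lemma broken_poly_C1: "broken_poly p \<Longrightarrow> T \<in> \<T> \<Longrightarrow> C1 (p T)"
  using poly_space_C1 by (auto simp: broken_poly_def)

lemma broken_poly_add: "broken_poly p \<Longrightarrow> broken_poly q \<Longrightarrow> broken_poly (\<lambda>T x. p T x + q T x)"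
  using poly_space_add by (auto simp: broken_poly_def)

lemma broken_poly_edge_bounded: "broken_poly p \<Longrightarrow> edge_bounded (\<lambda>T e. p T)"
  unfolding edge_bounded_def
  using ess_bounded_edge_continuous[OF C1_continuous[OF broken_poly_C1] element] by blast

lemma broken_poly_simplex:
  assumes "broken_poly p" "T \<in> \<T>"
  shows "ess_bounded (lebesgue_on T) (p T)" "ess_bounded (lebesgue_on T) (partial i (p T))"
  using ess_bounded_simplex_continuous[OF _ element[OF assms(2)]] broken_poly_C1[OF assms]
    C1_continuous C1_continuous_partial by blast+

definition broken_jump :: "real \<Rightarrow> broken_function \<Rightarrow> edge_function" where
  "broken_jump \<kappa> p T e x = (if e \<subseteq> frontier \<Omega> then \<kappa> * p T x else p T x - p (mirror T e) x)"

definition tangential :: "broken_function \<Rightarrow> broken_function \<Rightarrow> edge_function" where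
  "tangential p1 p2 T e x = outward_normal T e $ 1 * p2 T x - outward_normal T e $ 2 * p1 T x"

definition broken_tangential_jump :: "broken_function \<Rightarrow> broken_function \<Rightarrow> edge_function" where
  "broken_tangential_jump p1 p2 T e x =
     outward_normal T e $ 1 * broken_jump (E_factor bc) p2 T e x
     - outward_normal T e $ 2 * broken_jump (E_factor bc) p1 T e x"

abbreviation "hjump \<equiv> broken_jump (H_factor bc)"
abbreviation "tjump \<equiv> broken_tangential_jump"

lemma jump_eq: "jump \<Omega> \<T> N \<kappa> v T e x = broken_jump \<kappa> (elem N v) T e x"
  by (simp add: jump_def broken_jump_def mirror_def)

lemma tangential_jump_eq: "tangential_jump \<Omega> \<T> N bc v1 v2 T e x = tjump (elem N v1) (elem N v2) T e x"
  by (simp add: tangential_jump_def broken_tangential_jump_def jump_eq)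

lemma edge_bounded_jump: "broken_poly p \<Longrightarrow> edge_bounded (broken_jump \<kappa> p)"
  unfolding broken_jump_def[abs_def]
  by (intro edge_bounded_if edge_bounded_mult edge_bounded_diff edge_bounded_const broken_poly_edge_bounded
     edge_bounded_mirror[where F = "\<lambda>T e. p T"])

lemma edge_bounded_tangential: "broken_poly p1 \<Longrightarrow> broken_poly p2 \<Longrightarrow> edge_bounded (tangential p1 p2)"
  unfolding tangential_def[abs_def]
  by (intro edge_bounded_mult edge_bounded_diff edge_bounded_const broken_poly_edge_bounded)

lemma edge_bounded_tjump: "broken_poly p1 \<Longrightarrow> broken_poly p2 \<Longrightarrow> edge_bounded (tjump p1 p2)"
  unfolding broken_tangential_jump_def[abs_def]
  by (intro edge_bounded_mult edge_bounded_diff edge_bounded_const edge_bounded_jump)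

lemma jump_add: "broken_jump \<kappa> (\<lambda>T x. p T x + q T x) T e x = broken_jump \<kappa> p T e x + broken_jump \<kappa> q T e x"
  by (simp add: broken_jump_def algebra_simps)

lemma tangential_add:
  "tangential (\<lambda>T x. p1 T x + q1 T x) (\<lambda>T x. p2 T x + q2 T x) T e x
      = tangential p1 p2 T e x + tangential q1 q2 T e x"
  by (simp add: tangential_def algebra_simps)

lemma tjump_add:
  "tjump (\<lambda>T x. p1 T x + q1 T x) (\<lambda>T x. p2 T x + q2 T x) T e x = tjump p1 p2 T e x + tjump q1 q2 T e x"
  by (simp add: broken_tangential_jump_def jump_add algebra_simps)

lemma boundary_jumps:
  assumes "e \<subseteq> frontier \<Omega>"
  shows "mirror T e = T" "broken_jump \<kappa> p T e x = \<kappa> * p T x"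
    "tjump p1 p2 T e x = E_factor bc * tangential p1 p2 T e x"
  using assms
  by (auto simp: mirror_def broken_jump_def broken_tangential_jump_def tangential_def algebra_simps)

text \<open>The jump of a scalar is odd under the exchange of the two elements. The normal is odd as well, so the
  tangential jump is even and equals the sum of the two tangential components.\<close>

lemma interior_jumps:
  assumes "T \<in> \<T>" "e edge_of T" "\<not> e \<subseteq> frontier \<Omega>"
  shows "broken_jump \<kappa> p T e x = p T x - p (mirror T e) x"
    "broken_jump \<kappa> p (mirror T e) e x = p (mirror T e) x - p T x"
    "tjump p1 p2 T e x = tangential p1 p2 T e x + tangential p1 p2 (mirror T e) e x"
    "tjump p1 p2 (mirror T e) e x = tangential p1 p2 T e x + tangential p1 p2 (mirror T e) e x"
proof -
  have n: "outward_normal (mirror T e) e = - outward_normal T e"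
    using neighbor_properties(4)[OF open_domain mesh assms] assms(3) by (simp add: mirror_def)
  have mm: "mirror (mirror T e) e = T" using mirror_properties assms by blast
  show "broken_jump \<kappa> p T e x = p T x - p (mirror T e) x"
    "broken_jump \<kappa> p (mirror T e) e x = p (mirror T e) x - p T x"
    "tjump p1 p2 T e x = tangential p1 p2 T e x + tangential p1 p2 (mirror T e) e x"
    "tjump p1 p2 (mirror T e) e x = tangential p1 p2 T e x + tangential p1 p2 (mirror T e) e x"
    using assms(3) mm n
    by (simp_all add: broken_jump_def broken_tangential_jump_def tangential_def algebra_simps)
qed

text \<open>The impedances \<open>Z\<^sup>+\<close> are written as values of \<open>Z\<close> on the mirror side (\<open>Z_plus_mirror\<close>); this shows
  at once how the weights and penalty factors behave under the exchange of sides.\<close>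

definition E_weight :: edge_function where
  "E_weight T e x = Z (mirror T e) e x / (Z (mirror T e) e x + Z T e x)"

definition E_penalty :: edge_function where
  "E_penalty T e x = flux_param \<Omega> bc \<alpha> e / (Z (mirror T e) e x + Z T e x)"

definition H_weight :: edge_function where
  "H_weight T e x = (1 / Z (mirror T e) e x) / (1 / Z (mirror T e) e x + 1 / Z T e x)"

definition H_penalty :: edge_function where
  "H_penalty T e x = flux_param \<Omega> bc \<alpha> e / (1 / Z (mirror T e) e x + 1 / Z T e x)"

lemma flux_param_range: "0 \<le> flux_param \<Omega> bc \<alpha> e" "flux_param \<Omega> bc \<alpha> e \<le> 1"
  using alpha by (auto simp: flux_param_def)

lemma weights_bounded:
  "edge_bounded E_weight" "edge_bounded E_penalty" "edge_bounded H_weight" "edge_bounded H_penalty"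
proof -
  have "ess_bounded (edge_measure e) (E_weight T e) \<and> ess_bounded (edge_measure e) (E_penalty T e) \<and>
     ess_bounded (edge_measure e) (H_weight T e) \<and> ess_bounded (edge_measure e) (H_penalty T e)"
    if Te: "T \<in> \<T>" "e edge_of T" for T e
  proof -
    note zm [measurable] = Z_measurable[OF Te] Z_measurable[OF mirror_properties(1,2)[OF Te]]
    define f where "f = flux_param \<Omega> bc \<alpha> e"
    have f: "0 \<le> f" "f \<le> 1" using flux_param_range by (auto simp: f_def)
    have "AE x in edge_measure e. \<bar>E_weight T e x\<bar> \<le> 1 \<and> \<bar>E_penalty T e x\<bar> \<le> 1 / Z_lo \<and>
        \<bar>H_weight T e x\<bar> \<le> 1 \<and> \<bar>H_penalty T e x\<bar> \<le> Z_hi"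
      using Z_pair_bounds[OF Te]
    proof eventually_elim
      case (elim x)
      define a b where "a = Z T e x" and "b = Z (mirror T e) e x"
      have ab: "a > 0" "b > 0" "Z_lo \<le> a" "Z_lo \<le> b" "b \<le> Z_hi" using elim Z_lo_pos by (auto simp: a_def b_def)
      have "f / (b + a) \<le> 1 / Z_lo" using f ab Z_lo_pos by (intro frac_le) auto
      moreover have "f / (1 / b + 1 / a) \<le> 1 / (1 / Z_hi)"
      proof (rule frac_le)
        have "1 / Z_hi \<le> 1 / b" using ab by (intro frac_le) auto
        then show "1 / Z_hi \<le> 1 / b + 1 / a" using ab by (simp add: add_increasing2)
      qed (use f Z_hi_pos in auto)
      moreover have "1 / b / (1 / b + 1 / a) = a / (b + a)" using ab by (simp add: field_simps)
      ultimately show "\<bar>E_weight T e x\<bar> \<le> 1 \<and> \<bar>E_penalty T e x\<bar> \<le> 1 / Z_lo \<and>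
        \<bar>H_weight T e x\<bar> \<le> 1 \<and> \<bar>H_penalty T e x\<bar> \<le> Z_hi"
        unfolding E_weight_def E_penalty_def H_weight_def H_penalty_def f_def[symmetric] a_def[symmetric]
            b_def[symmetric]
        using f ab by (auto simp: abs_of_nonneg divide_le_eq_1 add_pos_pos)
    qed
    then have "AE x in edge_measure e. \<bar>E_weight T e x\<bar> \<le> 1"
        "AE x in edge_measure e. \<bar>E_penalty T e x\<bar> \<le> 1 / Z_lo"
      "AE x in edge_measure e. \<bar>H_weight T e x\<bar> \<le> 1" "AE x in edge_measure e. \<bar>H_penalty T e x\<bar> \<le> Z_hi"
      by (auto elim: eventually_mono)
    moreover have "E_weight T e \<in> borel_measurable (edge_measure e)"
        "E_penalty T e \<in> borel_measurable (edge_measure e)"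
      "H_weight T e \<in> borel_measurable (edge_measure e)" "H_penalty T e \<in> borel_measurable (edge_measure e)"
      unfolding E_weight_def[abs_def] E_penalty_def[abs_def] H_weight_def[abs_def] H_penalty_def[abs_def]
      by measurable
    ultimately show ?thesis unfolding ess_bounded_def by blast
  qed
  then show "edge_bounded E_weight" "edge_bounded E_penalty" "edge_bounded H_weight" "edge_bounded H_penalty"
    unfolding edge_bounded_def by blast+
qed

lemma E_flux_eq:
  assumes "T \<in> \<T>" "e edge_of T"
  shows "E_flux \<Omega> \<T> \<epsilon>T \<mu>T N bc \<alpha> E1 E2 Hz T e x =
    E_weight T e x * hjump (elem N Hz) T e x - E_penalty T e x * tjump (elem N E1) (elem N E2) T e x"
  unfolding E_flux_def E_weight_def E_penalty_def jump_eq tangential_jump_eq Z_plus_mirror[OF assms]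
  by (simp add: diff_divide_distrib)

lemma H_flux_eq:
  assumes "T \<in> \<T>" "e edge_of T"
  shows "H_flux \<Omega> \<T> \<epsilon>T \<mu>T N bc \<alpha> E1 E2 Hz T e x =
    H_weight T e x * tjump (elem N E1) (elem N E2) T e x - H_penalty T e x * hjump (elem N Hz) T e x"
  unfolding H_flux_def Let_def H_weight_def H_penalty_def jump_eq tangential_jump_eq Z_plus_mirror[OF assms]
  by (simp only: right_diff_distrib times_divide_eq_left mult_1)

abbreviation flux_coupling :: "broken_function \<Rightarrow> broken_function \<Rightarrow> broken_function \<Rightarrow> real" where
  "flux_coupling h p1 p2 \<equiv> skeleton (\<lambda>T e x. E_weight T e x * hjump h T e x * tangential p1 p2 T e x)"

text \<open>The right-hand side of the electric equations for the magnetic field \<open>h\<close>, tested with \<open>(p1, p2)\<close>,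
  without the penalty term.\<close>

definition curl_form where
  "curl_form h p1 p2 =
     (\<Sum>T\<in>\<T>. curl_integral T (h T) (p1 T) (p2 T))
     + flux_coupling h p1 p2"

definition E_dissipation where
  "E_dissipation p1 p2 q1 q2 = skeleton (\<lambda>T e x. E_penalty T e x * tjump p1 p2 T e x * tangential q1 q2 T e x)"

definition H_dissipation where
  "H_dissipation h g = skeleton (\<lambda>T e x. H_penalty T e x * hjump h T e x * g T x)"

lemma E_dissipation_add_right:
  assumes "broken_poly p1" "broken_poly p2" "broken_poly q1" "broken_poly q2" "broken_poly r1" "broken_poly r2"
  shows "E_dissipation r1 r2 (\<lambda>T x. p1 T x + q1 T x) (\<lambda>T x. p2 T x + q2 T x)
    = E_dissipation r1 r2 p1 p2 + E_dissipation r1 r2 q1 q2"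
  unfolding E_dissipation_def tangential_add distrib_left
  using assms
  by (intro skeleton_add edge_bounded_mult weights_bounded edge_bounded_tjump edge_bounded_tangential)

lemma H_dissipation_add_right:
  assumes "broken_poly h" "broken_poly g" "broken_poly f"
  shows "H_dissipation f (\<lambda>T x. h T x + g T x) = H_dissipation f h + H_dissipation f g"
  unfolding H_dissipation_def distrib_left
  using assms
  by (intro skeleton_add edge_bounded_mult weights_bounded edge_bounded_jump broken_poly_edge_bounded)

lemma penalty_mirror:
  assumes "T \<in> \<T>" "e edge_of T"
  shows "E_penalty (mirror T e) e x = E_penalty T e x" "H_penalty (mirror T e) e x = H_penalty T e x"
  using mirror_properties(3)[OF assms] by (simp_all add: E_penalty_def H_penalty_def add.commute)

text \<open>Under the exchange of sides the product of the two tangential jumps appears symmetrically; the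
  difference of both forms is odd.\<close>

lemma E_dissipation_commute:
  assumes "broken_poly p1" "broken_poly p2" "broken_poly q1" "broken_poly q2"
  shows "E_dissipation p1 p2 q1 q2 = E_dissipation q1 q2 p1 p2"
proof -
  define F where "F T e x = E_penalty T e x * tjump p1 p2 T e x * tangential q1 q2 T e x
    + (- (E_penalty T e x * tjump q1 q2 T e x * tangential p1 p2 T e x))" for T e x
  note b = edge_bounded_mult[OF edge_bounded_mult[OF weights_bounded(2) edge_bounded_tjump]
      edge_bounded_tangential]
  have "skeleton F = E_dissipation p1 p2 q1 q2 - E_dissipation q1 q2 p1 p2"
    unfolding F_def[abs_def] E_dissipation_def
    using skeleton_add[OF b edge_bounded_minus[OF b]] skeleton_uminus assms by simp
  moreover have "skeleton F = 0"
  proof (rule skeleton_antisymmetric)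
    show "edge_bounded F" unfolding F_def[abs_def]
      using assms by (intro edge_bounded_add edge_bounded_minus b)
    fix T e assume Te: "T \<in> \<T>" "e edge_of T"
    show "AE x in edge_measure e. F T e x + F (mirror T e) e x = 0"
    proof (cases "e \<subseteq> frontier \<Omega>")
      case True
      then show ?thesis unfolding F_def by (simp add: boundary_jumps)
    next
      case False
      then show ?thesis unfolding F_def by (simp add: interior_jumps[OF Te False] penalty_mirror[OF Te]
          algebra_simps)
    qed
  qed
  ultimately show ?thesis by simp
qed

lemma H_dissipation_commute:
  assumes "broken_poly h" "broken_poly g"
  shows "H_dissipation h g = H_dissipation g h"
proof -
  define F where "F T e x = H_penalty T e x * hjump h T e x * g T x
    + (- (H_penalty T e x * hjump g T e x * h T x))" for T e x
  note b = edge_bounded_mult[OF edge_bounded_mult[OF weights_bounded(4) edge_bounded_jump]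
      broken_poly_edge_bounded]
  have "skeleton F = H_dissipation h g - H_dissipation g h"
    unfolding F_def[abs_def] H_dissipation_def
    using skeleton_add[OF b edge_bounded_minus[OF b]] skeleton_uminus assms by simp
  moreover have "skeleton F = 0"
  proof (rule skeleton_antisymmetric)
    show "edge_bounded F" unfolding F_def[abs_def]
      using assms by (intro edge_bounded_add edge_bounded_minus b)
    fix T e assume Te: "T \<in> \<T>" "e edge_of T"
    show "AE x in edge_measure e. F T e x + F (mirror T e) e x = 0"
    proof (cases "e \<subseteq> frontier \<Omega>")
      case True
      then show ?thesis unfolding F_def by (simp add: boundary_jumps)
    next
      case False
      then show ?thesis unfolding F_def by (simp add: interior_jumps[OF Te False] penalty_mirror[OF Te]
          algebra_simps)
    qed
  qed
  ultimately show ?thesis by simp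
qed

lemma factors_nonneg: "0 \<le> E_factor bc" "0 \<le> H_factor bc" "E_factor bc + H_factor bc = 2"
  by (cases bc; simp)+

lemma penalty_nonneg:
  assumes "Z T e x > 0" "Z (mirror T e) e x > 0" shows "E_penalty T e x \<ge> 0" "H_penalty T e x \<ge> 0"
  using assms flux_param_range by (auto simp: E_penalty_def H_penalty_def)

text \<open>The two sides of an interior edge add up to a square.\<close>

lemma E_dissipation_nonneg:
  assumes "broken_poly p1" "broken_poly p2" shows "E_dissipation p1 p2 p1 p2 \<ge> 0"
proof -
  have "skeleton (\<lambda>T e x. 0) \<le> E_dissipation p1 p2 p1 p2"
    unfolding E_dissipation_def
  proof (rule skeleton_mono_mirrored)
    fix T e assume Te: "T \<in> \<T>" "e edge_of T"
    show "AE x in edge_measure e. 0 + 0 \<le> E_penalty T e x * tjump p1 p2 T e x * tangential p1 p2 T e x +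
       E_penalty (mirror T e) e x * tjump p1 p2 (mirror T e) e x * tangential p1 p2 (mirror T e) e x"
      using Z_pair_bounds[OF Te]
    proof eventually_elim
      case (elim x)
      then have k: "E_penalty T e x \<ge> 0" using penalty_nonneg Z_lo_pos by auto
      show ?case
      proof (cases "e \<subseteq> frontier \<Omega>")
        case True
        have "E_penalty T e x * tjump p1 p2 T e x * tangential p1 p2 T e x
            = E_factor bc * (E_penalty T e x * (tangential p1 p2 T e x)\<^sup>2)"
          by (simp add: boundary_jumps[OF True] power2_eq_square)
        moreover have "0 \<le> E_factor bc * (E_penalty T e x * (tangential p1 p2 T e x)\<^sup>2)"
          using k factors_nonneg by simp
        ultimately show ?thesis unfolding boundary_jumps(1)[OF True] by linarith
      next
        case False
        have "E_penalty T e x * tjump p1 p2 T e x * tangential p1 p2 T e x +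
           E_penalty (mirror T e) e x * tjump p1 p2 (mirror T e) e x * tangential p1 p2 (mirror T e) e x
          = E_penalty T e x * (tangential p1 p2 T e x + tangential p1 p2 (mirror T e) e x)\<^sup>2"
          by (simp add: interior_jumps[OF Te False] penalty_mirror[OF Te] algebra_simps power2_eq_square)
        then show ?thesis using k by simp
      qed
    qed
  qed (use assms in \<open>intro edge_bounded_const edge_bounded_mult weights_bounded edge_bounded_tjump
      edge_bounded_tangential\<close>)+
  then show ?thesis by (simp add: skeleton_zero)
qed

lemma H_dissipation_nonneg:
  assumes "broken_poly h" shows "H_dissipation h h \<ge> 0"
proof -
  have "skeleton (\<lambda>T e x. 0) \<le> H_dissipation h h"
    unfolding H_dissipation_def
  proof (rule skeleton_mono_mirrored)
    fix T e assume Te: "T \<in> \<T>" "e edge_of T"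
    show "AE x in edge_measure e. 0 + 0 \<le> H_penalty T e x * hjump h T e x * h T x +
       H_penalty (mirror T e) e x * hjump h (mirror T e) e x * h (mirror T e) x"
      using Z_pair_bounds[OF Te]
    proof eventually_elim
      case (elim x)
      then have k: "H_penalty T e x \<ge> 0" using penalty_nonneg Z_lo_pos by auto
      show ?case
      proof (cases "e \<subseteq> frontier \<Omega>")
        case True
        have "H_penalty T e x * hjump h T e x * h T x = H_factor bc * (H_penalty T e x * (h T x)\<^sup>2)"
          by (simp add: boundary_jumps[OF True] power2_eq_square)
        moreover have "0 \<le> H_factor bc * (H_penalty T e x * (h T x)\<^sup>2)"
          using k factors_nonneg by simp
        ultimately show ?thesis unfolding boundary_jumps(1)[OF True] by linarith
      next
        case False
        have "H_penalty T e x * hjump h T e x * h T x +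
           H_penalty (mirror T e) e x * hjump h (mirror T e) e x * h (mirror T e) x
          = H_penalty T e x * (h T x - h (mirror T e) x)\<^sup>2"
          by (simp add: interior_jumps[OF Te False] penalty_mirror[OF Te] algebra_simps power2_eq_square)
        then show ?thesis using k by simp
      qed
    qed
  qed (use assms in \<open>intro edge_bounded_const edge_bounded_mult weights_bounded edge_bounded_jump
      broken_poly_edge_bounded\<close>)+
  then show ?thesis by (simp add: skeleton_zero)
qed

section \<open>Estimates on the edges and the discrete adjoint identity\<close>


text \<open>The factors of \<open>C_tau\<^sup>2 (N + 1) (N + 2)\<close> in the constants \<open>C_E\<close> and \<open>C_H\<close> of the theorem.\<close>

definition E_constant :: real where
  "E_constant = 2 + beta2 bc + (2 * \<alpha> + beta1 bc \<alpha>) / (2 * Zmin)"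

definition H_constant :: real where
  "H_constant = 2 + beta2 bc + (\<alpha> + beta2 bc * beta3 bc \<alpha>) / Ymin"

lemma beta_nonneg: "0 \<le> beta1 bc \<alpha>" "0 \<le> beta2 bc" "0 \<le> beta2 bc * beta3 bc \<alpha>"
  using alpha by (cases bc; simp)+

lemma edge_constants:
  "1/2 + \<alpha> / (2 * Zmin) \<le> E_constant" "1 + \<alpha> / (2 * Ymin) \<le> H_constant" "2 \<le> E_constant" "2 \<le> H_constant"
proof -
  have "\<alpha> / (2 * Zmin) \<le> (2 * \<alpha> + beta1 bc \<alpha>) / (2 * Zmin)"
    using Zmin_pos alpha beta_nonneg by (intro divide_right_mono) auto
  then show "1/2 + \<alpha> / (2 * Zmin) \<le> E_constant" using beta_nonneg by (simp add: E_constant_def)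
  have "\<alpha> / (2 * Ymin) \<le> (\<alpha> + beta2 bc * beta3 bc \<alpha>) / Ymin"
    using Ymin_pos alpha beta_nonneg by (intro frac_le) auto
  then show "1 + \<alpha> / (2 * Ymin) \<le> H_constant" using beta_nonneg by (simp add: H_constant_def)
  show "2 \<le> E_constant" "2 \<le> H_constant"
    using Zmin_pos Ymin_pos alpha beta_nonneg by (auto simp: E_constant_def H_constant_def)
qed

text \<open>The same estimate for a boundary edge, where both sides coincide. For each
  of the three boundary conditions the terms with \<open>\<beta>\<close> dominate the penalty terms.\<close>

lemma boundary_edge_bound:
  fixes z :: real
  assumes e: "e \<subseteq> frontier \<Omega>" and s: "\<bar>s\<bar> \<le> 1" and z: "Zmin \<le> z" "Ymin \<le> 1 / z"
  shows "s * (1/2 * (H_factor bc * x) * a) + 1/2 * (flux_param \<Omega> bc \<alpha> e / (z + z) * (E_factor bc * a) * a)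
     + 1/2 * (flux_param \<Omega> bc \<alpha> e / (1 / z + 1 / z) * (H_factor bc * x) * x)
     \<le> E_constant * a\<^sup>2 + H_constant * x\<^sup>2"
proof -
  have zp: "z > 0" using z Zmin_pos by linarith
  have inv: "1 / z \<le> 1 / Zmin" "z \<le> 1 / Ymin"
    using z zp Zmin_pos Ymin_pos by (auto simp: field_simps)
  define xa where "xa = s * (x * a)"
  have "xa \<le> \<bar>s\<bar> * \<bar>x * a\<bar>" unfolding xa_def by (metis abs_ge_self abs_mult)
  also have "\<dots> \<le> \<bar>x * a\<bar>" using s by (intro mult_left_le_one_le) auto
  also have "\<dots> \<le> (x\<^sup>2 + a\<^sup>2) / 2"
    using sum_squares_bound[of "\<bar>x\<bar>" "\<bar>a\<bar>"] by (simp add: abs_mult)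
  finally have xa: "xa \<le> (x\<^sup>2 + a\<^sup>2) / 2" .
  have "H_factor bc * xa \<le> H_factor bc * ((x\<^sup>2 + a\<^sup>2) / 2)"
    using xa factors_nonneg by (intro mult_left_mono) auto
  also have "\<dots> \<le> 2 * ((x\<^sup>2 + a\<^sup>2) / 2)" using factors_nonneg by (intro mult_right_mono) auto
  finally have 1: "s * (1/2 * (H_factor bc * x) * a) \<le> 1/2 * x\<^sup>2 + 1/2 * a\<^sup>2"
    unfolding xa_def by (simp add: algebra_simps)
  define f where "f = flux_param \<Omega> bc \<alpha> e"
  have f: "f = (if bc = Silver_Mueller then 1 else \<alpha>)" using e by (simp add: f_def flux_param_def)
  have "1/2 * (f / (z + z) * (E_factor bc * a) * a) = f * E_factor bc / 4 * (1 / z) * a\<^sup>2"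
    by (simp add: power2_eq_square)
  also have "\<dots> \<le> f * E_factor bc / 4 * (1 / Zmin) * a\<^sup>2"
    using inv f alpha factors_nonneg by (intro mult_right_mono mult_left_mono) auto
  also have "\<dots> \<le> (2 * \<alpha> + beta1 bc \<alpha>) / 2 * (1 / Zmin) * a\<^sup>2"
    using alpha Zmin_pos f by (intro mult_right_mono) (cases bc; simp)+
  finally have 2: "1/2 * (f / (z + z) * (E_factor bc * a) * a) \<le> (E_constant - 1/2) * a\<^sup>2"
  proof (rule order_trans)
    show "(2 * \<alpha> + beta1 bc \<alpha>) / 2 * (1 / Zmin) * a\<^sup>2 \<le> (E_constant - 1/2) * a\<^sup>2"
      using beta_nonneg by (intro mult_right_mono) (auto simp: E_constant_def)
  qed
  have "1/2 * (f / (1 / z + 1 / z) * (H_factor bc * x) * x) = f * H_factor bc / 4 * z * x\<^sup>2"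
    using zp by (simp add: power2_eq_square)
  also have "\<dots> \<le> f * H_factor bc / 4 * (1 / Ymin) * x\<^sup>2"
    using inv f alpha factors_nonneg by (intro mult_right_mono mult_left_mono) auto
  also have "\<dots> \<le> (\<alpha> + beta2 bc * beta3 bc \<alpha>) * (1 / Ymin) * x\<^sup>2"
    using alpha Ymin_pos f by (intro mult_right_mono) (cases bc; simp)+
  finally have 3: "1/2 * (f / (1 / z + 1 / z) * (H_factor bc * x) * x) \<le> (H_constant - 1/2) * x\<^sup>2"
  proof (rule order_trans)
    show "(\<alpha> + beta2 bc * beta3 bc \<alpha>) * (1 / Ymin) * x\<^sup>2 \<le> (H_constant - 1/2) * x\<^sup>2"
      using beta_nonneg by (intro mult_right_mono) (auto simp: H_constant_def)
  qed
  show ?thesis using 1 2 3 unfolding f_def by (simp add: algebra_simps)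
qed

lemma tangential_square_le:
  assumes "T \<in> \<T>" "e edge_of T"
  shows "(tangential p1 p2 T e x)\<^sup>2 \<le> (p1 T x)\<^sup>2 + (p2 T x)\<^sup>2"
proof -
  define n where "n = outward_normal T e"
  have "(n $ 1)\<^sup>2 + (n $ 2)\<^sup>2 = 1"
    using norm_outward_normal[OF element[OF assms(1)] assms(2)] norm_plane[of n] by (simp add: n_def)
  then have "(p1 T x)\<^sup>2 + (p2 T x)\<^sup>2 = ((n $ 1)\<^sup>2 + (n $ 2)\<^sup>2) * ((p1 T x)\<^sup>2 + (p2 T x)\<^sup>2)" by simp
  also have "\<dots> = (n $ 1 * p2 T x - n $ 2 * p1 T x)\<^sup>2 + (n $ 1 * p1 T x + n $ 2 * p2 T x)\<^sup>2"
    by (simp add: power2_eq_square algebra_simps)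
  finally show ?thesis by (simp add: tangential_def n_def)
qed

text \<open>The sign \<open>s\<close> gives both bounds for the coupling term at once.\<close>

lemma skeleton_bound:
  assumes h: "broken_poly h" and p: "broken_poly p1" "broken_poly p2" and s: "\<bar>s\<bar> \<le> 1"
  shows "s * flux_coupling h p1 p2
      + 1/2 * E_dissipation p1 p2 p1 p2 + 1/2 * H_dissipation h h
    \<le> skeleton (\<lambda>T e x. E_constant * ((p1 T x)\<^sup>2 + (p2 T x)\<^sup>2) + H_constant * (h T x)\<^sup>2)"
proof -
  note eb = weights_bounded edge_bounded_jump[OF h] edge_bounded_tangential[OF p] edge_bounded_tjump[OF p]
    broken_poly_edge_bounded[OF h] broken_poly_edge_bounded[OF p(1)] broken_poly_edge_bounded[OF p(2)]
  define F where "F T e x = s * (E_weight T e x * hjump h T e x * tangential p1 p2 T e x)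
     + (1/2 * (E_penalty T e x * tjump p1 p2 T e x * tangential p1 p2 T e x)
     + 1/2 * (H_penalty T e x * hjump h T e x * h T x))" for T e x
  define G where "G T e x = E_constant * ((p1 T x)\<^sup>2 + (p2 T x)\<^sup>2) + H_constant * (h T x)\<^sup>2"
      for T and e :: "point set" and x
  have "skeleton F = s * flux_coupling h p1 p2
      + (1/2 * E_dissipation p1 p2 p1 p2 + 1/2 * H_dissipation h h)"
    unfolding F_def[abs_def] E_dissipation_def H_dissipation_def skeleton_cmult[symmetric]
    by (subst skeleton_add, (intro edge_bounded_add edge_bounded_mult edge_bounded_const eb)+,
        subst skeleton_add, (intro edge_bounded_add edge_bounded_mult edge_bounded_const eb)+) simp
  moreover have "skeleton F \<le> skeleton G"
  proof (rule skeleton_mono_mirrored)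
    show "edge_bounded F" unfolding F_def[abs_def]
      by (intro edge_bounded_add edge_bounded_mult edge_bounded_const eb)
    show "edge_bounded G" unfolding G_def[abs_def]
      by (intro edge_bounded_add edge_bounded_mult edge_bounded_const edge_bounded_power2 eb)
    fix T e assume Te: "T \<in> \<T>" "e edge_of T"
    note Te' = mirror_properties(1,2)[OF Te]
    show "AE x in edge_measure e. F T e x + F (mirror T e) e x \<le> G T e x + G (mirror T e) e x"
      using Z_pair_bounds[OF Te]
    proof eventually_elim
      case (elim x)
      define a b where "a = tangential p1 p2 T e x" and "b = tangential p1 p2 (mirror T e) e x"
      have a: "a\<^sup>2 \<le> (p1 T x)\<^sup>2 + (p2 T x)\<^sup>2"
        and b: "b\<^sup>2 \<le> (p1 (mirror T e) x)\<^sup>2 + (p2 (mirror T e) x)\<^sup>2"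
        unfolding a_def b_def by (rule tangential_square_le[OF Te] tangential_square_le[OF Te'])+
      have Ga: "E_constant * a\<^sup>2 + H_constant * (h T x)\<^sup>2 \<le> G T e x"
        unfolding G_def using a edge_constants(3) by simp
      have Gb: "E_constant * b\<^sup>2 + H_constant * (h (mirror T e) x)\<^sup>2 \<le> G (mirror T e) e x"
        unfolding G_def using b edge_constants(3) by simp
      show ?case
      proof (cases "e \<subseteq> frontier \<Omega>")
        case True
        have w: "E_weight T e x = 1/2"
          using elim Zmin_pos by (auto simp: E_weight_def boundary_jumps(1)[OF True])
        have "F T e x \<le> E_constant * a\<^sup>2 + H_constant * (h T x)\<^sup>2"
          using boundary_edge_bound[OF True s, of "Z T e x" "h T x" a] elim
          unfolding F_def w E_penalty_def H_penalty_def boundary_jumps[OF True] a_def[symmetric]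
          by (simp only: add.assoc)
        then show ?thesis using Ga boundary_jumps(1)[OF True] by simp
      next
        case False
        have "F T e x + F (mirror T e) e x
          = s * (E_weight T e x * (h T x - h (mirror T e) x) * a
              + E_weight (mirror T e) e x * (h (mirror T e) x - h T x) * b)
          + 1/2 * (E_penalty T e x * (a + b)\<^sup>2) + 1/2 * (H_penalty T e x * (h T x - h (mirror T e) x)\<^sup>2)"
          unfolding F_def interior_jumps[OF Te False] penalty_mirror[OF Te] a_def[symmetric] b_def[symmetric]
          by (simp add: power2_eq_square algebra_simps)
        also have "\<dots> \<le> (1/2 + \<alpha> / (2 * Zmin)) * (a\<^sup>2 + b\<^sup>2)
            + (1 + \<alpha> / (2 * Ymin)) * ((h T x)\<^sup>2 + (h (mirror T e) x)\<^sup>2)"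
          unfolding E_weight_def E_penalty_def H_penalty_def mirror_properties(3)[OF Te]
          using interior_edge_bound[OF s alpha(1) Zmin_pos _ _ Ymin_pos, of "Z (mirror T e) e x"
            "Z T e x"] elim False
          by (simp add: flux_param_def)
        also have "\<dots> \<le> E_constant * (a\<^sup>2 + b\<^sup>2) + H_constant * ((h T x)\<^sup>2 + (h (mirror T e) x)\<^sup>2)"
          using edge_constants by (intro add_mono mult_right_mono) auto
        finally show ?thesis using Ga Gb by (simp add: algebra_simps)
      qed
    qed
  qed
  ultimately show ?thesis unfolding G_def[abs_def] by simp
qed

text \<open>Integration by parts replaces the element integrals by those of \<open>curl_form\<close> and leaves the edge
  terms collected in \<open>F\<close>. With \<open>t\<close> for the weight of \<open>Z\<^sup>+\<close>, the two flux weights on one side are \<open>t\<close> and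
  \<open>1 - t\<close> and on the other side \<open>1 - t\<close> and \<open>t\<close>. With this, \<open>F\<close> cancels between the sides; on the boundary
  it vanishes because the jump factors add up to 2.\<close>

lemma curl_form_adjoint:
  assumes h: "broken_poly h" and p: "broken_poly p1" "broken_poly p2"
  shows "(\<Sum>T\<in>\<T>. LINT x|lebesgue_on T. (partial 2 (p1 T) x - partial 1 (p2 T) x) * h T x)
      + skeleton (\<lambda>T e x. H_weight T e x * tjump p1 p2 T e x * h T x) = - curl_form h p1 p2"
proof -
  note eb = weights_bounded edge_bounded_jump[OF h] edge_bounded_tangential[OF p] edge_bounded_tjump[OF p]
    broken_poly_edge_bounded[OF h] broken_poly_edge_bounded[OF p(1)] broken_poly_edge_bounded[OF p(2)]
  have vol: "(LINT x|lebesgue_on T. (partial 2 (p1 T) x - partial 1 (p2 T) x) * h T x)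
     = boundary_integral T (\<lambda>e x. - (tangential p1 p2 T e x * h T x))
       - curl_integral T (h T) (p1 T) (p2 T)"
    if T: "T \<in> \<T>" for T
  proof -
    note int = ess_bounded_integrable_simplex[OF element[OF T] ess_bounded_mult[OF broken_poly_simplex(2)
        broken_poly_simplex(1)]]
    have swap: "(LINT x|lebesgue_on T. p T x * partial i (h T) x)
        = (LINT x|lebesgue_on T. partial i (h T) x * p T x)" for p i
      by (simp add: mult.commute)
    note ibp = integration_by_parts[OF element[OF T] broken_poly_C1[OF _ T] broken_poly_C1[OF h T]]
    have b: "boundary_integral T (\<lambda>e x. - (tangential p1 p2 T e x * h T x))
      = boundary_integral T (\<lambda>e x. outward_normal T e $ 2 * (p1 T x * h T x))
        - boundary_integral T (\<lambda>e x. outward_normal T e $ 1 * (p2 T x * h T x))"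
      unfolding boundary_integral_def sum_subtractf[symmetric]
    proof (intro sum.cong refl)
      fix e assume "e \<in> {e. e edge_of T}"
      then have e: "ess_bounded (edge_measure e) (h T)" "ess_bounded (edge_measure e) (p1 T)"
          "ess_bounded (edge_measure e) (p2 T)"
        using eb(8-10) T unfolding edge_bounded_def by auto
      have "(LINT x|edge_measure e. - (tangential p1 p2 T e x * h T x))
         = (LINT x|edge_measure e. outward_normal T e $ 2 * (p1 T x * h T x)
             - outward_normal T e $ 1 * (p2 T x * h T x))"
        by (intro Bochner_Integration.integral_cong) (auto simp: tangential_def algebra_simps)
      also have "\<dots> = (LINT x|edge_measure e. outward_normal T e $ 2 * (p1 T x * h T x))
          - (LINT x|edge_measure e. outward_normal T e $ 1 * (p2 T x * h T x))"
        by (intro Bochner_Integration.integral_diff ess_bounded_integrable_edge ess_bounded_mult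
          ess_bounded_const e)
      finally show "(LINT x|edge_measure e. - (tangential p1 p2 T e x * h T x))
        = (LINT x|edge_measure e. outward_normal T e $ 2 * (p1 T x * h T x))
          - (LINT x|edge_measure e. outward_normal T e $ 1 * (p2 T x * h T x))" .
    qed
    have "(LINT x|lebesgue_on T. (partial 2 (p1 T) x - partial 1 (p2 T) x) * h T x)
      = (LINT x|lebesgue_on T. partial 2 (p1 T) x * h T x) - (LINT x|lebesgue_on T. partial 1 (p2 T) x * h T x)"
      unfolding left_diff_distrib
      by (rule Bochner_Integration.integral_diff[OF int[OF p(1) T h T] int[OF p(2) T h T]])
    moreover have "curl_integral T (h T) (p1 T) (p2 T)
      = (LINT x|lebesgue_on T. partial 2 (h T) x * p1 T x) - (LINT x|lebesgue_on T. partial 1 (h T) x * p2 T x)"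
      by (rule Bochner_Integration.integral_diff[OF int[OF h T p(1) T] int[OF h T p(2) T]])
    ultimately show ?thesis
      using b ibp[OF p(1), of 2] ibp[OF p(2), of 1] swap[of p1 2] swap[of p2 1] by linarith
  qed
  define F where "F T e x = - (tangential p1 p2 T e x * h T x)
     + (H_weight T e x * tjump p1 p2 T e x * h T x
         + E_weight T e x * hjump h T e x * tangential p1 p2 T e x)" for T e x
  have "skeleton F = skeleton (\<lambda>T e x. - (tangential p1 p2 T e x * h T x))
     + (skeleton (\<lambda>T e x. H_weight T e x * tjump p1 p2 T e x * h T x)
     + flux_coupling h p1 p2)"
    unfolding F_def[abs_def]
    by (subst skeleton_add, (intro edge_bounded_minus edge_bounded_add edge_bounded_mult eb)+,
        subst skeleton_add, (intro edge_bounded_mult eb)+) simp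
  moreover have "skeleton F = 0"
  proof (rule skeleton_antisymmetric)
    show "edge_bounded F" unfolding F_def[abs_def]
      by (intro edge_bounded_minus edge_bounded_add edge_bounded_mult eb)
    fix T e assume Te: "T \<in> \<T>" "e edge_of T"
    show "AE x in edge_measure e. F T e x + F (mirror T e) e x = 0"
      using Z_pair_bounds[OF Te]
    proof eventually_elim
      case (elim x)
      define zm zp where "zm = Z T e x" and "zp = Z (mirror T e) e x"
      have z: "zm > 0" "zp > 0" using elim Zmin_pos by (auto simp: zm_def zp_def)
      define t where "t = zp / (zp + zm)"
      have t: "zm / (zm + zp) = 1 - t" "1 / zp / (1 / zp + 1 / zm) = 1 - t" "1 / zm / (1 / zm + 1 / zp) = t"
        using z unfolding t_def by (simp_all add: field_simps)
      have w: "E_weight T e x = t" "H_weight T e x = 1 - t" "E_weight (mirror T e) e x = 1 - t"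
          "H_weight (mirror T e) e x = t"
        unfolding E_weight_def H_weight_def mirror_properties(3)[OF Te] zm_def[symmetric] zp_def[symmetric] t
        by (simp_all add: t_def)
      show ?case
      proof (cases "e \<subseteq> frontier \<Omega>")
        case True
        have "zp = zm" using boundary_jumps(1)[OF True] by (simp add: zp_def zm_def)
        then have t2: "t = 1/2" using z by (simp add: t_def)
        have "F T e x = (E_factor bc + H_factor bc - 2) / 2 * (tangential p1 p2 T e x * h T x)"
          unfolding F_def w boundary_jumps[OF True] t2 by (simp add: field_simps)
        then have "F T e x = 0" using factors_nonneg by simp
        then show ?thesis using boundary_jumps(1)[OF True] by simp
      next
        case False
        show ?thesis unfolding F_def w interior_jumps[OF Te False] by (simp add: algebra_simps)
      qed
    qed
  qed
  ultimately show ?thesis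
    by (simp add: vol sum_subtractf curl_form_def skeleton_def)
qed

section \<open>Norms and energies\<close>


lemma elem_poly_on:
  assumes "v \<in> dg_scalar_space \<Omega> \<T> N" "T \<in> \<T>"
  shows "elem N v T \<in> poly_space N" "AE x in lebesgue_on T. v x = elem N v T x"
proof -
  have "poly_on N T v (elem N v T)"
    using assms someI_ex[of "poly_on N T v"] unfolding dg_scalar_space_def elem_def by auto
  then show "elem N v T \<in> poly_space N" "AE x in lebesgue_on T. v x = elem N v T x"
    by (auto simp: poly_on_def)
qed

lemma broken_poly_elem: "v \<in> dg_scalar_space \<Omega> \<T> N \<Longrightarrow> broken_poly (elem N v)"
  using elem_poly_on(1) by (simp add: broken_poly_def)

definition mesh_L2 :: "broken_function \<Rightarrow> real" where
  "mesh_L2 p = (\<Sum>T\<in>\<T>. (L2_norm T (p T))\<^sup>2)"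

lemma mesh_L2_nonneg: "mesh_L2 p \<ge> 0"
  unfolding mesh_L2_def by (intro sum_nonneg) simp

text \<open>Different elements meet in a face of dimension at most one, so almost every point of the
  domain lies in exactly one element.\<close>

lemma AE_mesh_indicator:
  "AE x in lebesgue. (\<Sum>T\<in>\<T>. indicator T x :: real) = indicator \<Omega> x"
proof -
  have "negligible (T \<inter> T')" if "T \<in> \<T>" "T' \<in> \<T>" "T \<noteq> T'" for T T'
  proof -
    have c: "convex (T \<inter> T')" 
      using simplex_convex[OF element] that by (intro convex_Int) auto
    have "aff_dim (T \<inter> T') < 2" using mesh_Int_aff_dim[OF mesh that] .
    then have "interior (T \<inter> T') = {}" using aff_dim_nonempty_interior[of "T \<inter> T'"] by fastforce
    then show ?thesis using negligible_convex_interior[OF c] by simp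
  qed
  note neg = this
  define I where "I = {(T, T'). T \<in> \<T> \<and> T' \<in> \<T> \<and> T \<noteq> T'}"
  have fin: "finite I" by (rule finite_subset[of _ "\<T> \<times> \<T>"]) (auto simp: I_def finite_mesh)
  have "negligible (\<Union>(T, T')\<in>I. T \<inter> T')"
  proof (rule negligible_Union)
    show "finite ((\<lambda>(T, T'). T \<inter> T') ` I)" using fin by (rule finite_imageI)
    fix S assume "S \<in> (\<lambda>(T, T'). T \<inter> T') ` I"
    then show "negligible S" using neg by (auto simp: I_def)
  qed
  then have "AE x in lebesgue. x \<notin> (\<Union>(T, T')\<in>I. T \<inter> T')"
    unfolding negligible_iff_null_sets by (rule AE_not_in)
  moreover have "AE x in lebesgue. x \<notin> frontier \<Omega>"
    using negligible_frontier_polygonal[OF domain] AE_not_in by (simp add: negligible_iff_null_sets)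
  ultimately show ?thesis
  proof eventually_elim
    case (elim x)
    have cl: "\<Union>\<T> = closure \<Omega>" using mesh by (simp add: conforming_mesh_def)
    show ?case
    proof (cases "x \<in> \<Omega>")
      case True
      then obtain T where T: "T \<in> \<T>" "x \<in> T" using cl closure_subset by blast
      have "(\<Sum>T'\<in>\<T>. indicator T' x :: real) = (\<Sum>T'\<in>\<T>. if T' = T then 1 else 0)"
        using elim(1) T by (intro sum.cong) (auto simp: indicator_def I_def)
      then show ?thesis using finite_mesh T True by simp
    next
      case False
      then have "x \<notin> closure \<Omega>" using elim(2) closure_Un_frontier by blast
      then have "\<And>T. T \<in> \<T> \<Longrightarrow> x \<notin> T" using cl by blast
      then show ?thesis using False by simp
    qed
  qed
qed

lemma L2_norm_mesh:
  assumes v: "v \<in> dg_scalar_space \<Omega> \<T> N"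
  shows "(L2_norm \<Omega> v)\<^sup>2 = mesh_L2 (elem N v)"
proof -
  have Om: "\<Omega> \<in> sets lebesgue" using open_domain by simp
  have vm: "v \<in> borel_measurable (lebesgue_on \<Omega>)"
    using v by (simp add: dg_scalar_space_def square_integrable_def)
  have T: "integrable lebesgue (\<lambda>x. indicator T x * (v x)\<^sup>2)"
     "(L2_norm T (elem N v T))\<^sup>2 = (LINT x|lebesgue. indicator T x * (v x)\<^sup>2)" if T: "T \<in> \<T>" for T
  proof -
    have Tm: "T \<in> sets lebesgue" using simplex_2_lebesgue element T by blast
    have vT: "v \<in> borel_measurable (lebesgue_on T)" by (rule measurable_mesh_element[OF domain mesh T vm])
    note eb = broken_poly_simplex(1)[OF broken_poly_elem[OF v] T]
    have ae: "AE x in lebesgue_on T. (elem N v T x)\<^sup>2 = (v x)\<^sup>2"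
      using elem_poly_on(2)[OF v T] by eventually_elim simp
    have "integrable (lebesgue_on T) (\<lambda>x. (elem N v T x)\<^sup>2)"
      by (intro ess_bounded_integrable_simplex[OF element[OF T]] ess_bounded_power2 eb)
    moreover have em: "(\<lambda>x. (elem N v T x)\<^sup>2) \<in> borel_measurable (lebesgue_on T)"
        "(\<lambda>x. (v x)\<^sup>2) \<in> borel_measurable (lebesgue_on T)"
      using eb vT unfolding ess_bounded_def by auto
    ultimately have "integrable (lebesgue_on T) (\<lambda>x. (v x)\<^sup>2)"
      using integrable_cong_AE[OF em ae] by simp
    then show "integrable lebesgue (\<lambda>x. indicator T x * (v x)\<^sup>2)"
      using Tm by (simp add: integrable_restrict_space)
    have "(L2_norm T (elem N v T))\<^sup>2 = (LINT x|lebesgue_on T. (v x)\<^sup>2)"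
      unfolding L2_norm_square by (rule integral_cong_AE[OF em ae])
    then show "(L2_norm T (elem N v T))\<^sup>2 = (LINT x|lebesgue. indicator T x * (v x)\<^sup>2)"
      using Tm by (simp add: integral_restrict_space)
  qed
  have iO: "integrable lebesgue (\<lambda>x. indicator \<Omega> x * (v x)\<^sup>2)"
    using v Om by (simp add: dg_scalar_space_def square_integrable_def integrable_restrict_space)
  have "mesh_L2 (elem N v) = (\<Sum>T\<in>\<T>. LINT x|lebesgue. indicator T x * (v x)\<^sup>2)"
    unfolding mesh_L2_def by (intro sum.cong refl T(2))
  also have "\<dots> = (LINT x|lebesgue. (\<Sum>T\<in>\<T>. indicator T x * (v x)\<^sup>2))"
    by (rule Bochner_Integration.integral_sum[symmetric]) (rule T(1))
  also have "\<dots> = (LINT x|lebesgue. indicator \<Omega> x * (v x)\<^sup>2)"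
  proof (rule integral_cong_AE)
    show "AE x in lebesgue. (\<Sum>T\<in>\<T>. indicator T x * (v x)\<^sup>2) = indicator \<Omega> x * (v x)\<^sup>2"
      using AE_mesh_indicator by eventually_elim (simp add: sum_distrib_right[symmetric])
    show "(\<lambda>x. \<Sum>T\<in>\<T>. indicator T x * (v x)\<^sup>2) \<in> borel_measurable lebesgue"
      using T(1) by (intro borel_measurable_sum borel_measurable_integrable) auto
  qed (use iO in auto)
  also have "\<dots> = (L2_norm \<Omega> v)\<^sup>2"
    unfolding L2_norm_square using Om by (simp add: integral_restrict_space)
  finally show ?thesis ..
qed

definition eps_energy where
  "eps_energy p1 p2 = (\<Sum>T\<in>\<T>. LINT x|lebesgue_on T.
     (\<epsilon> x $ 1 $ 1 * p1 T x + \<epsilon> x $ 1 $ 2 * p2 T x) * p1 T x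
     + (\<epsilon> x $ 2 $ 1 * p1 T x + \<epsilon> x $ 2 $ 2 * p2 T x) * p2 T x)"

definition mu_energy where
  "mu_energy h = (\<Sum>T\<in>\<T>. LINT x|lebesgue_on T. \<mu> x * (h T x)\<^sup>2)"

lemma eps_ess_bounded: assumes T: "T \<in> \<T>" shows "ess_bounded (lebesgue_on T) (\<lambda>x. \<epsilon> x $ i $ j)"
proof -
  have "(\<lambda>x. \<epsilon> x $ i $ j) \<in> borel_measurable (lebesgue_on T)"
    by (rule measurable_compose[OF measurable_mesh_element[OF domain mesh T coeff_meas(1)]],
        rule borel_measurable_continuous_onI) (intro continuous_intros)
  moreover have "AE x in lebesgue_on T. \<bar>\<epsilon> x $ i $ j\<bar> \<le> eps_hi"
    using eps_admissible[OF T]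
  proof eventually_elim
    case (elim x)
    then show ?case
      using admissible_entries[OF elim coeff_pos(1)] coeff_pos exhaust_2[of i] exhaust_2[of j] by auto
  qed
  ultimately show ?thesis by (auto simp: ess_bounded_def)
qed

lemma mu_ess_bounded: assumes T: "T \<in> \<T>" shows "ess_bounded (lebesgue_on T) \<mu>"
proof -
  have "AE x in lebesgue_on T. \<bar>\<mu> x\<bar> \<le> mu_hi"
    using mu_bounds_element[OF T] by eventually_elim (use coeff_pos in auto)
  then show ?thesis using measurable_mesh_element[OF domain mesh T coeff_meas(2)]
      by (auto simp: ess_bounded_def)
qed

lemma eps_energy_bounds:
  assumes p: "broken_poly p1" "broken_poly p2"
  shows "eps_lo * (mesh_L2 p1 + mesh_L2 p2) \<le> eps_energy p1 p2"
    "eps_energy p1 p2 \<le> eps_hi * (mesh_L2 p1 + mesh_L2 p2)"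
proof -
  let ?q = "\<lambda>T x. (\<epsilon> x $ 1 $ 1 * p1 T x + \<epsilon> x $ 1 $ 2 * p2 T x) * p1 T x
     + (\<epsilon> x $ 2 $ 1 * p1 T x + \<epsilon> x $ 2 $ 2 * p2 T x) * p2 T x"
  have "eps_lo * ((L2_norm T (p1 T))\<^sup>2 + (L2_norm T (p2 T))\<^sup>2) \<le> (LINT x|lebesgue_on T. ?q T x) \<and>
    (LINT x|lebesgue_on T. ?q T x) \<le> eps_hi * ((L2_norm T (p1 T))\<^sup>2 + (L2_norm T (p2 T))\<^sup>2)" if T: "T \<in> \<T>" for T
  proof -
    note eb = eps_ess_bounded[OF T] broken_poly_simplex(1)[OF p(1) T] broken_poly_simplex(1)[OF p(2) T]
    note int = ess_bounded_integrable_simplex[OF element[OF T]]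
    have i1: "integrable (lebesgue_on T) (?q T)"
      by (intro int ess_bounded_add ess_bounded_mult eb)
    have i2: "integrable (lebesgue_on T) (\<lambda>x. c * ((p1 T x)\<^sup>2 + (p2 T x)\<^sup>2))" for c
      by (intro int ess_bounded_add ess_bounded_mult ess_bounded_const ess_bounded_power2 eb)
    have c: "(LINT x|lebesgue_on T. c * ((p1 T x)\<^sup>2 + (p2 T x)\<^sup>2))
        = c * ((L2_norm T (p1 T))\<^sup>2 + (L2_norm T (p2 T))\<^sup>2)" for c
      using int[OF ess_bounded_power2[OF eb(2)]] int[OF ess_bounded_power2[OF eb(3)]]
      by (simp add: L2_norm_square)
    have ae: "AE x in lebesgue_on T. eps_lo * ((p1 T x)\<^sup>2 + (p2 T x)\<^sup>2) \<le> ?q T x \<and> ?q T x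
        \<le> eps_hi * ((p1 T x)\<^sup>2 + (p2 T x)\<^sup>2)"
      using eps_admissible[OF T]
    proof eventually_elim
      case (elim x)
      define \<xi> :: point where "\<xi> = vector [p1 T x, p2 T x]"
      have "eps_lo * (norm \<xi>)\<^sup>2 \<le> \<xi> \<bullet> (\<epsilon> x *v \<xi>) \<and> \<xi> \<bullet> (\<epsilon> x *v \<xi>) \<le> eps_hi * (norm \<xi>)\<^sup>2"
        using elim by (simp add: admissible_def)
      then show ?case unfolding norm_plane inner_plane matrix_vector_plane by (simp add: \<xi>_def mult.commute)
    qed
    have "(LINT x|lebesgue_on T. eps_lo * ((p1 T x)\<^sup>2 + (p2 T x)\<^sup>2)) \<le> (LINT x|lebesgue_on T. ?q T x)"
      using ae by (intro integral_mono_AE i1 i2) (auto elim: eventually_mono)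
    moreover have "(LINT x|lebesgue_on T. ?q T x) \<le> (LINT x|lebesgue_on T. eps_hi * ((p1 T x)\<^sup>2 + (p2 T x)\<^sup>2))"
      using ae by (intro integral_mono_AE i1 i2) (auto elim: eventually_mono)
    ultimately show ?thesis unfolding c by blast
  qed
  then show "eps_lo * (mesh_L2 p1 + mesh_L2 p2) \<le> eps_energy p1 p2"
    "eps_energy p1 p2 \<le> eps_hi * (mesh_L2 p1 + mesh_L2 p2)"
    unfolding eps_energy_def mesh_L2_def sum.distrib[symmetric] sum_distrib_left
    by (auto intro!: sum_mono)
qed

lemma mu_energy_bounds:
  assumes h: "broken_poly h"
  shows "mu_lo * mesh_L2 h \<le> mu_energy h" "mu_energy h \<le> mu_hi * mesh_L2 h"
proof -
  have "mu_lo * (L2_norm T (h T))\<^sup>2 \<le> (LINT x|lebesgue_on T. \<mu> x * (h T x)\<^sup>2) \<and>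
    (LINT x|lebesgue_on T. \<mu> x * (h T x)\<^sup>2) \<le> mu_hi * (L2_norm T (h T))\<^sup>2" if T: "T \<in> \<T>" for T
  proof -
    note eb = mu_ess_bounded[OF T] broken_poly_simplex(1)[OF h T]
    have i1: "integrable (lebesgue_on T) (\<lambda>x. \<mu> x * (h T x)\<^sup>2)"
      by (intro ess_bounded_integrable_simplex[OF element[OF T]] ess_bounded_mult ess_bounded_power2 eb)
    have i2: "integrable (lebesgue_on T) (\<lambda>x. c * (h T x)\<^sup>2)" for c
      by (intro ess_bounded_integrable_simplex[OF element[OF T]] ess_bounded_mult ess_bounded_const
        ess_bounded_power2 eb)
    have c: "(LINT x|lebesgue_on T. c * (h T x)\<^sup>2) = c * (L2_norm T (h T))\<^sup>2" for c
      by (simp add: L2_norm_square)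
    have ae: "AE x in lebesgue_on T. mu_lo * (h T x)\<^sup>2 \<le> \<mu> x * (h T x)\<^sup>2 \<and> \<mu> x * (h T x)\<^sup>2 \<le> mu_hi * (h T x)\<^sup>2"
      using mu_bounds_element[OF T] by eventually_elim (auto intro: mult_right_mono)
    have "(LINT x|lebesgue_on T. mu_lo * (h T x)\<^sup>2) \<le> (LINT x|lebesgue_on T. \<mu> x * (h T x)\<^sup>2)"
      using ae by (intro integral_mono_AE i1 i2) (auto elim: eventually_mono)
    moreover have "(LINT x|lebesgue_on T. \<mu> x * (h T x)\<^sup>2) \<le> (LINT x|lebesgue_on T. mu_hi * (h T x)\<^sup>2)"
      using ae by (intro integral_mono_AE i1 i2) (auto elim: eventually_mono)
    ultimately show ?thesis unfolding c by blast
  qed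
  then show "mu_lo * mesh_L2 h \<le> mu_energy h" "mu_energy h \<le> mu_hi * mesh_L2 h"
    unfolding mu_energy_def mesh_L2_def sum_distrib_left by (auto intro!: sum_mono)
qed

lemma curl_form_add_right:
  assumes h: "broken_poly h" and p: "broken_poly p1" "broken_poly p2" and q: "broken_poly q1" "broken_poly q2"
  shows "curl_form h (\<lambda>T x. p1 T x + q1 T x) (\<lambda>T x. p2 T x + q2 T x) = curl_form h p1 p2 + curl_form h q1 q2"
proof -
  have v: "(LINT x|lebesgue_on T. partial 2 (h T) x * (p1 T x + q1 T x) - partial 1 (h T) x * (p2 T x + q2 T x))
    = curl_integral T (h T) (p1 T) (p2 T)
     + curl_integral T (h T) (q1 T) (q2 T)" if T: "T \<in> \<T>" for T
  proof -
    note eb = broken_poly_simplex(2)[OF h T] broken_poly_simplex(1)[OF p(1) T] broken_poly_simplex(1)[OF p(2) T]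
      broken_poly_simplex(1)[OF q(1) T] broken_poly_simplex(1)[OF q(2) T]
    have "(LINT x|lebesgue_on T. partial 2 (h T) x * (p1 T x + q1 T x) - partial 1 (h T) x * (p2 T x + q2 T x))
      = (LINT x|lebesgue_on T. (partial 2 (h T) x * p1 T x - partial 1 (h T) x * p2 T x)
         + (partial 2 (h T) x * q1 T x - partial 1 (h T) x * q2 T x))"
      by (simp add: algebra_simps)
    also have "\<dots> = curl_integral T (h T) (p1 T) (p2 T)
     + curl_integral T (h T) (q1 T) (q2 T)"
      by (intro Bochner_Integration.integral_add ess_bounded_integrable_simplex[OF element[OF T]]
         ess_bounded_diff ess_bounded_mult eb)
    finally show ?thesis .
  qed
  have s: "skeleton (\<lambda>T e x. E_weight T e x * hjump h T e x *
        tangential (\<lambda>T x. p1 T x + q1 T x) (\<lambda>T x. p2 T x + q2 T x) T e x)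
    = flux_coupling h p1 p2
     + flux_coupling h q1 q2"
    unfolding tangential_add distrib_left
    by (intro skeleton_add edge_bounded_mult weights_bounded edge_bounded_jump edge_bounded_tangential h p q)
  show ?thesis unfolding curl_form_def s by (simp add: v sum.distrib)
qed

lemma curl_form_add_left:
  assumes h: "broken_poly h" "broken_poly g" and p: "broken_poly p1" "broken_poly p2"
  shows "curl_form (\<lambda>T x. h T x + g T x) p1 p2 = curl_form h p1 p2 + curl_form g p1 p2"
proof -
  have v: "(LINT x|lebesgue_on T. partial 2 (\<lambda>x. h T x + g T x) x * p1 T x - partial 1 (\<lambda>x. h T x
      + g T x) x * p2 T x)
    = curl_integral T (h T) (p1 T) (p2 T)
     + curl_integral T (g T) (p1 T) (p2 T)" if T: "T \<in> \<T>" for T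
  proof -
    note eb = broken_poly_simplex(2)[OF h(1) T] broken_poly_simplex(2)[OF h(2) T]
      broken_poly_simplex(1)[OF p(1) T] broken_poly_simplex(1)[OF p(2) T]
    have "(LINT x|lebesgue_on T. partial 2 (\<lambda>x. h T x + g T x) x * p1 T x - partial 1 (\<lambda>x. h T x
        + g T x) x * p2 T x)
      = (LINT x|lebesgue_on T. (partial 2 (h T) x * p1 T x - partial 1 (h T) x * p2 T x)
         + (partial 2 (g T) x * p1 T x - partial 1 (g T) x * p2 T x))"
      by (simp add: partial_add broken_poly_C1[OF h(1) T] broken_poly_C1[OF h(2) T] algebra_simps)
    also have "\<dots> = curl_integral T (h T) (p1 T) (p2 T)
     + curl_integral T (g T) (p1 T) (p2 T)"
      by (intro Bochner_Integration.integral_add ess_bounded_integrable_simplex[OF element[OF T]]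
         ess_bounded_diff ess_bounded_mult eb)
    finally show ?thesis .
  qed
  have s: "skeleton (\<lambda>T e x. E_weight T e x * hjump (\<lambda>T x. h T x + g T x) T e x * tangential p1 p2 T e x)
    = flux_coupling h p1 p2
     + flux_coupling g p1 p2"
    unfolding jump_add distrib_left distrib_right
    by (intro skeleton_add edge_bounded_mult weights_bounded edge_bounded_jump edge_bounded_tangential h p)
  show ?thesis unfolding curl_form_def s by (simp add: v sum.distrib)
qed

section \<open>The energy balance of one time step\<close>


text \<open>Testing with the sum of the new and the old field. Since \<open>\<epsilon>\<close> is symmetric, the mixed terms on the
  left cancel.\<close>

lemma E_step:
  assumes v: "E1 \<in> dg_scalar_space \<Omega> \<T> N" "E2 \<in> dg_scalar_space \<Omega> \<T> N" "Hz \<in> dg_scalar_space \<Omega> \<T> N"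
    "E1' \<in> dg_scalar_space \<Omega> \<T> N" "E2' \<in> dg_scalar_space \<Omega> \<T> N"
    and dt: "\<Delta>t > 0"
    and step: "leapfrog_step \<Omega> \<T> \<epsilon> \<mu> \<epsilon>T \<mu>T N bc \<alpha> \<Delta>t E1 E2 Hz E1' E2' Hz'"
  defines "p1 \<equiv> elem N E1" and "p2 \<equiv> elem N E2" and "h \<equiv> elem N Hz" and "q1 \<equiv> elem N E1'" and "q2 \<equiv> elem N E2'"
  defines "s1 \<equiv> \<lambda>T x. p1 T x + q1 T x" and "s2 \<equiv> \<lambda>T x. p2 T x + q2 T x"
  shows "eps_energy q1 q2 - eps_energy p1 p2 = \<Delta>t * (curl_form h s1 s2 - E_dissipation p1 p2 s1 s2)"
proof -
  have bp: "broken_poly p1" "broken_poly p2" "broken_poly q1" "broken_poly q2" "broken_poly h"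
    using v broken_poly_elem by (auto simp: p1_def p2_def q1_def q2_def h_def)
  have bs: "broken_poly s1" "broken_poly s2" unfolding s1_def s2_def by (intro broken_poly_add bp)+
  define Ef where "Ef T e x = E_weight T e x * hjump h T e x - E_penalty T e x * tjump p1 p2 T e x" for T e x
  have Ef_b: "edge_bounded Ef" unfolding Ef_def[abs_def]
    by (intro edge_bounded_diff edge_bounded_mult weights_bounded edge_bounded_jump edge_bounded_tjump bp)
  let ?q = "\<lambda>a b T x. (\<epsilon> x $ 1 $ 1 * a T x + \<epsilon> x $ 1 $ 2 * b T x) * a T x
     + (\<epsilon> x $ 2 $ 1 * a T x + \<epsilon> x $ 2 $ 2 * b T x) * b T x"
  have element_eq: "((LINT x|lebesgue_on T. ?q q1 q2 T x) - (LINT x|lebesgue_on T. ?q p1 p2 T x)) / \<Delta>t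
    = curl_integral T (h T) (s1 T) (s2 T)
      + (boundary_integral T (\<lambda>e x. - (outward_normal T e $ 2) * Ef T e x * s1 T x)
      + boundary_integral T (\<lambda>e x. outward_normal T e $ 1 * Ef T e x * s2 T x))"
    if T: "T \<in> \<T>" for T
  proof -
    note eb = eps_ess_bounded[OF T] bp[THEN broken_poly_simplex(1), OF T] bs[THEN broken_poly_simplex(1), OF T]
      broken_poly_simplex(2)[OF bp(5) T]
    note int = ess_bounded_integrable_simplex[OF element[OF T]]
    have st: "s1 T \<in> poly_space N" "s2 T \<in> poly_space N" "(\<lambda>x. 0) \<in> poly_space N"
      using bs T poly_space_zero by (auto simp: broken_poly_def)
    define A where "A x = (\<epsilon> x $ 1 $ 1 * ((q1 T x - p1 T x) / \<Delta>t) + \<epsilon> x $ 1 $ 2 * ((q2 T x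
        - p2 T x) / \<Delta>t)) * s1 T x" for x
    define B where "B x = (\<epsilon> x $ 2 $ 1 * ((q1 T x - p1 T x) / \<Delta>t) + \<epsilon> x $ 2 $ 2 * ((q2 T x
        - p2 T x) / \<Delta>t)) * s2 T x" for x
    have fl: "boundary_integral T (\<lambda>e x. c e * E_flux \<Omega> \<T> \<epsilon>T \<mu>T N bc \<alpha> E1 E2 Hz T e x * u x)
       = boundary_integral T (\<lambda>e x. c e * Ef T e x * u x)" for c u
      unfolding boundary_integral_def
      by (intro sum.cong refl) (simp add: E_flux_eq[OF T] Ef_def p1_def p2_def h_def)
    have eA: "(LINT x|lebesgue_on T. A x) = (LINT x|lebesgue_on T. partial 2 (h T) x * s1 T x)
        + boundary_integral T (\<lambda>e x. - (outward_normal T e $ 2) * Ef T e x * s1 T x)"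
      and eB: "(LINT x|lebesgue_on T. B x) = - (LINT x|lebesgue_on T. partial 1 (h T) x * s2 T x)
        + boundary_integral T (\<lambda>e x. outward_normal T e $ 1 * Ef T e x * s2 T x)"
      using step[unfolded leapfrog_step_def, rule_format, OF T st] unfolding fl A_def B_def
      by (simp_all add: p1_def p2_def h_def q1_def q2_def)
    have iA: "integrable (lebesgue_on T) A" and iB: "integrable (lebesgue_on T) B"
      unfolding A_def[abs_def] B_def[abs_def]
      by (intro int ess_bounded_add ess_bounded_mult ess_bounded_divide_const ess_bounded_diff eb)+
    have iq: "integrable (lebesgue_on T) (?q p1 p2 T)" "integrable (lebesgue_on T) (?q q1 q2 T)"
      by (intro int ess_bounded_add ess_bounded_mult eb)+
    have "AE x in lebesgue_on T. A x + B x = (?q q1 q2 T x - ?q p1 p2 T x) / \<Delta>t"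
      using eps_admissible[OF T]
    proof eventually_elim
      case (elim x)
      have sym: "\<epsilon> x $ 1 $ 2 = \<epsilon> x $ 2 $ 1" using admissible_entries(1)[OF elim coeff_pos(1)] .
      have "(A x + B x) * \<Delta>t = ?q q1 q2 T x - ?q p1 p2 T x"
        using dt unfolding A_def B_def s1_def s2_def sym by (simp add: field_simps)
      then show ?case using dt by (simp add: field_simps)
    qed
    then have "(LINT x|lebesgue_on T. A x + B x) = (LINT x|lebesgue_on T. (?q q1 q2 T x - ?q p1 p2 T x) / \<Delta>t)"
      using iA iB iq by (intro integral_cong_AE) auto
    then have "(LINT x|lebesgue_on T. A x) + (LINT x|lebesgue_on T. B x)
      = ((LINT x|lebesgue_on T. ?q q1 q2 T x) - (LINT x|lebesgue_on T. ?q p1 p2 T x)) / \<Delta>t"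
      using iA iB Bochner_Integration.integral_diff[OF iq(2) iq(1)] by simp
    moreover have "curl_integral T (h T) (s1 T) (s2 T)
      = (LINT x|lebesgue_on T. partial 2 (h T) x * s1 T x) - (LINT x|lebesgue_on T. partial 1 (h T) x * s2 T x)"
      by (intro Bochner_Integration.integral_diff int ess_bounded_mult eb)
    ultimately show ?thesis using eA eB by linarith
  qed
  have sk: "skeleton (\<lambda>T e x. - (outward_normal T e $ 2) * Ef T e x * s1 T x)
      + skeleton (\<lambda>T e x. outward_normal T e $ 1 * Ef T e x * s2 T x)
      = flux_coupling h s1 s2 - E_dissipation p1 p2 s1 s2"
  proof -
    have "skeleton (\<lambda>T e x. - (outward_normal T e $ 2) * Ef T e x * s1 T x)
      + skeleton (\<lambda>T e x. outward_normal T e $ 1 * Ef T e x * s2 T x)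
      = skeleton (\<lambda>T e x. - (outward_normal T e $ 2) * Ef T e x * s1 T x
          + outward_normal T e $ 1 * Ef T e x * s2 T x)"
      by (intro skeleton_add[symmetric] edge_bounded_mult edge_bounded_const Ef_b broken_poly_edge_bounded bs)
    also have "\<dots> = skeleton (\<lambda>T e x. E_weight T e x * hjump h T e x * tangential s1 s2 T e x
         + (- (E_penalty T e x * tjump p1 p2 T e x * tangential s1 s2 T e x)))"
      by (rule skeleton_cong) (simp add: Ef_def tangential_def algebra_simps)
    also have "\<dots> = flux_coupling h s1 s2
        + skeleton (\<lambda>T e x. - (E_penalty T e x * tjump p1 p2 T e x * tangential s1 s2 T e x))"
      by (intro skeleton_add edge_bounded_minus edge_bounded_mult weights_bounded edge_bounded_jump
        edge_bounded_tjump
          edge_bounded_tangential bp bs)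
    finally show ?thesis unfolding skeleton_uminus E_dissipation_def by simp
  qed
  have "(eps_energy q1 q2 - eps_energy p1 p2) / \<Delta>t
    = (\<Sum>T\<in>\<T>. ((LINT x|lebesgue_on T. ?q q1 q2 T x) - (LINT x|lebesgue_on T. ?q p1 p2 T x)) / \<Delta>t)"
    unfolding eps_energy_def by (simp only: sum_subtractf sum_divide_distrib[symmetric])
  also have "\<dots> = (\<Sum>T\<in>\<T>. curl_integral T (h T) (s1 T) (s2 T)
      + (boundary_integral T (\<lambda>e x. - (outward_normal T e $ 2) * Ef T e x * s1 T x)
      + boundary_integral T (\<lambda>e x. outward_normal T e $ 1 * Ef T e x * s2 T x)))"
    by (intro sum.cong refl element_eq)
  also have "\<dots> = curl_form h s1 s2 - E_dissipation p1 p2 s1 s2"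
    using sk unfolding sum.distrib curl_form_def skeleton_def by simp
  finally show ?thesis using dt by (simp add: field_simps)
qed

text \<open>The electric field on the right is already the new one. The adjoint identity turns the form in which
  its curl is tested into \<open>-curl_form\<close>, so that the result can be added to that of \<open>E_step\<close>.\<close>

lemma H_step:
  assumes v: "Hz \<in> dg_scalar_space \<Omega> \<T> N" "Hz' \<in> dg_scalar_space \<Omega> \<T> N"
    "E1' \<in> dg_scalar_space \<Omega> \<T> N" "E2' \<in> dg_scalar_space \<Omega> \<T> N"
    and dt: "\<Delta>t > 0"
    and step: "leapfrog_step \<Omega> \<T> \<epsilon> \<mu> \<epsilon>T \<mu>T N bc \<alpha> \<Delta>t E1 E2 Hz E1' E2' Hz'"
  defines "h \<equiv> elem N Hz" and "g \<equiv> elem N Hz'" and "q1 \<equiv> elem N E1'" and "q2 \<equiv> elem N E2'"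
  defines "s \<equiv> \<lambda>T x. h T x + g T x"
  shows "mu_energy g - mu_energy h = \<Delta>t * (- curl_form s q1 q2 - H_dissipation h s)"
proof -
  have bp: "broken_poly h" "broken_poly g" "broken_poly q1" "broken_poly q2"
    using v broken_poly_elem by (auto simp: g_def q1_def q2_def h_def)
  let ?Hf = "\<lambda>T e x. H_weight T e x * tjump q1 q2 T e x - H_penalty T e x * hjump h T e x"
  have bs: "broken_poly s" unfolding s_def by (intro broken_poly_add bp)
  have element_eq: "((LINT x|lebesgue_on T. \<mu> x * (g T x)\<^sup>2) - (LINT x|lebesgue_on T. \<mu> x * (h T x)\<^sup>2)) / \<Delta>t
    = (LINT x|lebesgue_on T. (partial 2 (q1 T) x - partial 1 (q2 T) x) * s T x)
      + boundary_integral T (\<lambda>e x. ?Hf T e x * s T x)"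
    if T: "T \<in> \<T>" for T
  proof -
    note eb = mu_ess_bounded[OF T] bp[THEN broken_poly_simplex(1), OF T]
    note int = ess_bounded_integrable_simplex[OF element[OF T]]
    have st: "(\<lambda>x. 0) \<in> poly_space N" "s T \<in> poly_space N" using bs T poly_space_zero
        by (auto simp: broken_poly_def)
    have fl: "boundary_integral T (\<lambda>e x. H_flux \<Omega> \<T> \<epsilon>T \<mu>T N bc \<alpha> E1' E2' Hz T e x * s T x)
       = boundary_integral T (\<lambda>e x. ?Hf T e x * s T x)"
      unfolding boundary_integral_def
      by (intro sum.cong refl) (simp add: H_flux_eq[OF T] q1_def q2_def h_def)
    have e1: "(LINT x|lebesgue_on T. \<mu> x * ((g T x - h T x) / \<Delta>t) * s T x)
      = (LINT x|lebesgue_on T. (partial 2 (q1 T) x - partial 1 (q2 T) x) * s T x)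
      + boundary_integral T (\<lambda>e x. ?Hf T e x * s T x)"
      using step[unfolded leapfrog_step_def, rule_format, OF T st(1) st(1) st(2)] unfolding fl
      by (simp add: q1_def q2_def h_def g_def)
    have e2: "(LINT x|lebesgue_on T. \<mu> x * ((g T x - h T x) / \<Delta>t) * s T x)
      = (LINT x|lebesgue_on T. (\<mu> x * (g T x)\<^sup>2 - \<mu> x * (h T x)\<^sup>2) / \<Delta>t)"
      using dt by (intro Bochner_Integration.integral_cong refl) (simp add: s_def power2_eq_square field_simps)
    have e3: "(LINT x|lebesgue_on T. (\<mu> x * (g T x)\<^sup>2 - \<mu> x * (h T x)\<^sup>2) / \<Delta>t)
        = ((LINT x|lebesgue_on T. \<mu> x * (g T x)\<^sup>2) - (LINT x|lebesgue_on T. \<mu> x * (h T x)\<^sup>2)) / \<Delta>t"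
      by (subst integral_divide_zero, subst Bochner_Integration.integral_diff)
        (intro refl int ess_bounded_mult ess_bounded_power2 eb)+
    show ?thesis using e1 unfolding e2 e3 .
  qed
  have "skeleton (\<lambda>T e x. ?Hf T e x * s T x)
    = skeleton (\<lambda>T e x. H_weight T e x * tjump q1 q2 T e x * s T x
        + (- (H_penalty T e x * hjump h T e x * s T x)))"
    by (rule skeleton_cong) (simp add: algebra_simps)
  also have "\<dots> = skeleton (\<lambda>T e x. H_weight T e x * tjump q1 q2 T e x * s T x)
      + skeleton (\<lambda>T e x. - (H_penalty T e x * hjump h T e x * s T x))"
    by (intro skeleton_add edge_bounded_minus edge_bounded_mult weights_bounded edge_bounded_jump
      edge_bounded_tjump
          broken_poly_edge_bounded bp bs)
  finally have sk: "skeleton (\<lambda>T e x. ?Hf T e x * s T x)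
    = skeleton (\<lambda>T e x. H_weight T e x * tjump q1 q2 T e x * s T x) - H_dissipation h s"
    unfolding skeleton_uminus H_dissipation_def by simp
  have "(mu_energy g - mu_energy h) / \<Delta>t
    = (\<Sum>T\<in>\<T>. ((LINT x|lebesgue_on T. \<mu> x * (g T x)\<^sup>2) - (LINT x|lebesgue_on T. \<mu> x * (h T x)\<^sup>2)) / \<Delta>t)"
    unfolding mu_energy_def by (simp only: sum_subtractf sum_divide_distrib[symmetric])
  also have "\<dots> = (\<Sum>T\<in>\<T>. (LINT x|lebesgue_on T. (partial 2 (q1 T) x - partial 1 (q2 T) x) * s T x)
      + boundary_integral T (\<lambda>e x. ?Hf T e x * s T x))"
    by (intro sum.cong refl element_eq)
  also have "\<dots> = - curl_form s q1 q2 - H_dissipation h s"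
    using sk curl_form_adjoint[OF bs bp(3,4)] unfolding sum.distrib skeleton_def by simp
  finally show ?thesis using dt by (simp add: field_simps)
qed

definition discrete_energy where
  "discrete_energy \<Delta>t p1 p2 h = eps_energy p1 p2 + mu_energy h + \<Delta>t * curl_form h p1 p2
     - \<Delta>t / 2 * (E_dissipation p1 p2 p1 p2 + H_dissipation h h)"

text \<open>The decrease in one step is \<open>\<Delta>t / 2\<close> times the dissipation forms at the sums of the old and the new
  fields, which are nonnegative.\<close>

lemma discrete_energy_decreases:
  assumes v: "(E1, E2, Hz) \<in> dg_space \<Omega> \<T> N" "(E1', E2', Hz') \<in> dg_space \<Omega> \<T> N"
    and dt: "\<Delta>t > 0"
    and step: "leapfrog_step \<Omega> \<T> \<epsilon> \<mu> \<epsilon>T \<mu>T N bc \<alpha> \<Delta>t E1 E2 Hz E1' E2' Hz'"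
  shows "discrete_energy \<Delta>t (elem N E1') (elem N E2') (elem N Hz')
      \<le> discrete_energy \<Delta>t (elem N E1) (elem N E2) (elem N Hz)"
proof -
  define p1 p2 h q1 q2 g where "p1 = elem N E1" and "p2 = elem N E2" and "h = elem N Hz"
    and "q1 = elem N E1'" and "q2 = elem N E2'" and "g = elem N Hz'"
  have v': "E1 \<in> dg_scalar_space \<Omega> \<T> N" "E2 \<in> dg_scalar_space \<Omega> \<T> N" "Hz \<in> dg_scalar_space \<Omega> \<T> N"
    "E1' \<in> dg_scalar_space \<Omega> \<T> N" "E2' \<in> dg_scalar_space \<Omega> \<T> N" "Hz' \<in> dg_scalar_space \<Omega> \<T> N"
    using v by (auto simp: dg_space_def)
  have b: "broken_poly p1" "broken_poly p2" "broken_poly h" "broken_poly q1" "broken_poly q2" "broken_poly g"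
    unfolding p1_def p2_def h_def q1_def q2_def g_def using v' broken_poly_elem by auto
  define r1 r2 s where "r1 = (\<lambda>T x. p1 T x + q1 T x)" and "r2 = (\<lambda>T x. p2 T x + q2 T x)"
    and "s = (\<lambda>T x. h T x + g T x)"
  have br: "broken_poly r1" "broken_poly r2" "broken_poly s"
    unfolding r1_def r2_def s_def by (intro broken_poly_add b)+
  have 1: "eps_energy q1 q2 - eps_energy p1 p2 = \<Delta>t * (curl_form h r1 r2 - E_dissipation p1 p2 r1 r2)"
    using E_step[OF v'(1-5) dt step] unfolding p1_def p2_def h_def q1_def q2_def g_def r1_def r2_def .
  have 2: "mu_energy g - mu_energy h = \<Delta>t * (- curl_form s q1 q2 - H_dissipation h s)"
    using H_step[OF v'(3,6,4,5) dt step] unfolding p1_def p2_def h_def q1_def q2_def g_def s_def .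
  have 3: "curl_form h r1 r2 = curl_form h p1 p2 + curl_form h q1 q2"
    unfolding r1_def r2_def by (intro curl_form_add_right b)
  have 4: "curl_form s q1 q2 = curl_form h q1 q2 + curl_form g q1 q2"
    unfolding s_def by (intro curl_form_add_left b)
  have 5: "E_dissipation p1 p2 r1 r2 = E_dissipation p1 p2 p1 p2 + E_dissipation p1 p2 q1 q2"
    unfolding r1_def r2_def by (intro E_dissipation_add_right b)
  have 6: "H_dissipation h s = H_dissipation h h + H_dissipation h g"
    unfolding s_def by (intro H_dissipation_add_right b)
  have "E_dissipation r1 r2 (\<lambda>T x. p1 T x + q1 T x) (\<lambda>T x. p2 T x + q2 T x)
      = E_dissipation r1 r2 p1 p2 + E_dissipation r1 r2 q1 q2"
    by (intro E_dissipation_add_right b br)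
  moreover have "E_dissipation q1 q2 r1 r2 = E_dissipation q1 q2 p1 p2 + E_dissipation q1 q2 q1 q2"
    unfolding r1_def r2_def by (intro E_dissipation_add_right b)
  moreover note E_dissipation_commute[OF br(1,2) b(1,2)] E_dissipation_commute[OF br(1,2) b(4,5)]
    E_dissipation_commute[OF b(4,5) b(1,2)]
  ultimately have 7: "0 \<le> E_dissipation p1 p2 p1 p2 + 2 * E_dissipation p1 p2 q1 q2 + E_dissipation q1 q2 q1 q2"
    using E_dissipation_nonneg[OF br(1,2)] 5 unfolding r1_def[symmetric] r2_def[symmetric] by linarith
  have "H_dissipation s (\<lambda>T x. h T x + g T x) = H_dissipation s h + H_dissipation s g"
    by (intro H_dissipation_add_right b br)
  moreover have "H_dissipation g s = H_dissipation g h + H_dissipation g g"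
    unfolding s_def by (intro H_dissipation_add_right b)
  moreover note H_dissipation_commute[OF br(3) b(3)] H_dissipation_commute[OF br(3) b(6)]
    H_dissipation_commute[OF b(6) b(3)]
  ultimately have 8: "0 \<le> H_dissipation h h + 2 * H_dissipation h g + H_dissipation g g"
    using H_dissipation_nonneg[OF br(3)] 6 unfolding s_def[symmetric] by linarith
  have "discrete_energy \<Delta>t p1 p2 h - discrete_energy \<Delta>t q1 q2 g
     = \<Delta>t / 2 * ((E_dissipation p1 p2 p1 p2 + 2 * E_dissipation p1 p2 q1 q2 + E_dissipation q1 q2 q1 q2)
       + (H_dissipation h h + 2 * H_dissipation h g + H_dissipation g g))"
    using 1 2 unfolding 3 4 5 6 discrete_energy_def by (simp add: algebra_simps)
  moreover have "\<dots> \<ge> 0" using 7 8 dt by simp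
  ultimately show ?thesis unfolding p1_def p2_def h_def q1_def q2_def g_def by linarith
qed

lemma discrete_energy_solution:
  assumes "leapfrog_solution \<Omega> \<T> \<epsilon> \<mu> \<epsilon>T \<mu>T N bc \<alpha> \<Delta>t M E1 E2 Hz" "\<Delta>t > 0" "m \<le> M"
  shows "discrete_energy \<Delta>t (elem N (E1 m)) (elem N (E2 m)) (elem N (Hz m))
    \<le> discrete_energy \<Delta>t (elem N (E1 0)) (elem N (E2 0)) (elem N (Hz 0))"
  using assms(3)
proof (induction m)
  case (Suc m)
  have fields: "\<forall>m\<le>M. (E1 m, E2 m, Hz m) \<in> dg_space \<Omega> \<T> N"
    and steps: "\<forall>m<M. leapfrog_step \<Omega> \<T> \<epsilon> \<mu> \<epsilon>T \<mu>T N bc \<alpha> \<Delta>t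
               (E1 m) (E2 m) (Hz m) (E1 (Suc m)) (E2 (Suc m)) (Hz (Suc m))"
    using assms(1) unfolding leapfrog_solution_def by (rule conjunct1, rule conjunct2)
  have m: "m \<le> M" "Suc m \<le> M" "m < M" using Suc.prems by auto
  have "discrete_energy \<Delta>t (elem N (E1 (Suc m))) (elem N (E2 (Suc m))) (elem N (Hz (Suc m)))
      \<le> discrete_energy \<Delta>t (elem N (E1 m)) (elem N (E2 m)) (elem N (Hz m))"
    by (rule discrete_energy_decreases[OF fields[rule_format, OF m(1)] fields[rule_format, OF m(2)]
      assms(2) steps[rule_format, OF m(3)]])
  then show ?case using Suc.IH m(1) by simp
qed simp

lemma curl_inverse_bound:
  assumes C: "C_inv > 0" and inv: "\<And>T u. T \<in> \<T> \<Longrightarrow> u \<in> poly_space N \<Longrightarrow>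
          H1_norm T u \<le> C_inv * (real N)\<^sup>2 * inverse (diameter T) * L2_norm T u"
    and h: "broken_poly h" and p: "broken_poly p1" "broken_poly p2" and s: "\<bar>s\<bar> \<le> 1" and T: "T \<in> \<T>"
  shows "s * curl_integral T (h T) (p1 T) (p2 T)
    \<le> inverse (diameter T) * (1/2 * C_inv * (real N)\<^sup>2 *
       ((L2_norm T (p1 T))\<^sup>2 + (L2_norm T (p2 T))\<^sup>2 + (L2_norm T (h T))\<^sup>2))"
proof -
  let ?I = "curl_integral T (h T) (p1 T) (p2 T)"
  have hT: "h T \<in> poly_space N" using h T by (auto simp: broken_poly_def)
  have "C_inv * (real N)\<^sup>2 * inverse (diameter T) \<ge> 0" using C diameter_simplex_pos[OF element[OF T]] by simp
  note bound = curl_integral_bound[OF element[OF T] broken_poly_C1[OF h T] broken_poly_C1[OF p(1) T]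
    broken_poly_C1[OF p(2) T] this inv[OF T hT]]
  have "s * ?I \<le> \<bar>s\<bar> * \<bar>?I\<bar>" using abs_ge_self[of "s * ?I"] unfolding abs_mult .
  also have "\<dots> \<le> \<bar>?I\<bar>" using s by (intro mult_left_le_one_le) auto
  also note bound
  finally show ?thesis by (simp add: algebra_simps)
qed

lemma trace_bound_square:
  assumes C: "C_tau > 0" and tr: "\<And>T u. T \<in> \<T> \<Longrightarrow> u \<in> poly_space N \<Longrightarrow>
          L2_boundary_norm T u
            \<le> C_tau * sqrt ((real N + 1) * (real N + 2)) * diameter T powr (-1/2) * L2_norm T u"
    and p: "broken_poly p" and T: "T \<in> \<T>"
  shows "boundary_integral T (\<lambda>e x. (p T x)\<^sup>2)
    \<le> inverse (diameter T) * (C_tau\<^sup>2 * (real N + 1) * (real N + 2) * (L2_norm T (p T))\<^sup>2)"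
proof -
  have d: "diameter T > 0" using diameter_simplex_pos[OF element[OF T]] .
  have "(L2_boundary_norm T (p T))\<^sup>2
      \<le> (C_tau * sqrt ((real N + 1) * (real N + 2)) * diameter T powr (-1/2) * L2_norm T (p T))\<^sup>2"
    using tr[OF T, of "p T"] p T boundary_integral_square_nonneg
    by (intro power_mono) (auto simp: broken_poly_def L2_boundary_norm_def)
  also have "\<dots> = C_tau\<^sup>2 * ((real N + 1) * (real N + 2)) * (diameter T powr (-1/2))\<^sup>2 * (L2_norm T (p T))\<^sup>2"
    by (simp add: power_mult_distrib)
  also have "(diameter T powr (-1/2))\<^sup>2 = inverse (diameter T)"
  proof -
    have "(diameter T powr (-1/2))\<^sup>2 = diameter T powr (-1/2 + -1/2)"
      by (simp only: power2_eq_square powr_add)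
    then show ?thesis using d by (simp add: powr_minus)
  qed
  finally show ?thesis unfolding L2_boundary_norm_square by (simp add: algebra_simps)
qed

section \<open>Coercivity and stability\<close>


text \<open>On each element the inverse inequality gives the first summand of \<open>C_E\<close> and \<open>C_H\<close>, and the trace
  inequality applied to \<open>skeleton_bound\<close> the second one. The smallest diameter and the larger constant
  then serve all elements.\<close>

lemma coercivity:
  assumes C_tau: "C_tau > 0" "\<And>T u. T \<in> \<T> \<Longrightarrow> u \<in> poly_space N \<Longrightarrow>
          L2_boundary_norm T u
            \<le> C_tau * sqrt ((real N + 1) * (real N + 2)) * diameter T powr (-1/2) * L2_norm T u"
    and C_inv: "C_inv > 0" "\<And>T u. T \<in> \<T> \<Longrightarrow> u \<in> poly_space N \<Longrightarrow>
          H1_norm T u \<le> C_inv * (real N)\<^sup>2 * inverse (diameter T) * L2_norm T u"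
    and C_E: "C_E = 1/2 * C_inv * (real N)\<^sup>2 + C_tau\<^sup>2 * (real N + 1) * (real N + 2) * E_constant"
    and C_H: "C_H = 1/2 * C_inv * (real N)\<^sup>2 + C_tau\<^sup>2 * (real N + 1) * (real N + 2) * H_constant"
    and h: "broken_poly h" and p: "broken_poly p1" "broken_poly p2" and s: "\<bar>s\<bar> \<le> 1"
  shows "s * curl_form h p1 p2 + 1/2 * E_dissipation p1 p2 p1 p2 + 1/2 * H_dissipation h h
    \<le> max C_E C_H / Min (diameter ` \<T>) * (mesh_L2 p1 + mesh_L2 p2 + mesh_L2 h)"
proof -
  define K where "K = C_tau\<^sup>2 * (real N + 1) * (real N + 2)"
  define V where "V = 1/2 * C_inv * (real N)\<^sup>2"
  have K: "K \<ge> 0" and V: "V \<ge> 0" using C_inv(1) by (auto simp: K_def V_def)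
  have CEH: "C_E = V + K * E_constant" "C_H = V + K * H_constant" using C_E C_H by (simp_all add: K_def V_def)
  have max0: "max C_E C_H \<ge> 0" unfolding CEH using K V edge_constants by (simp add: le_max_iff_disj)
  define G where "G T e x = E_constant * ((p1 T x)\<^sup>2 + (p2 T x)\<^sup>2) + H_constant * (h T x)\<^sup>2"
    for T and e :: "point set" and x
  define I where "I T = curl_integral T (h T) (p1 T) (p2 T)" for T
  have "s * curl_form h p1 p2 + 1/2 * E_dissipation p1 p2 p1 p2 + 1/2 * H_dissipation h h
     \<le> (\<Sum>T\<in>\<T>. s * I T) + skeleton G"
    using skeleton_bound[OF h p s] unfolding curl_form_def G_def[abs_def] I_def
    by (simp add: distrib_left sum_distrib_left)
  also have "\<dots> = (\<Sum>T\<in>\<T>. s * I T + boundary_integral T (G T))"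
    by (simp add: skeleton_def sum.distrib)
  also have "\<dots> \<le> (\<Sum>T\<in>\<T>. max C_E C_H / Min (diameter ` \<T>) *
      ((L2_norm T (p1 T))\<^sup>2 + (L2_norm T (p2 T))\<^sup>2 + (L2_norm T (h T))\<^sup>2))"
  proof (rule sum_mono)
    fix T assume T: "T \<in> \<T>"
    define a b where "a = (L2_norm T (p1 T))\<^sup>2 + (L2_norm T (p2 T))\<^sup>2" and "b = (L2_norm T (h T))\<^sup>2"
    have ab: "a \<ge> 0" "b \<ge> 0" by (auto simp: a_def b_def)
    have d: "diameter T > 0" using diameter_simplex_pos[OF element[OF T]] .
    have I: "s * I T \<le> inverse (diameter T) * (V * (a + b))"
      using curl_inverse_bound[OF C_inv h p s T] unfolding I_def V_def a_def b_def .
    have "boundary_integral T (G T) = E_constant * (boundary_integral T (\<lambda>e x. (p1 T x)\<^sup>2)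
        + boundary_integral T (\<lambda>e x. (p2 T x)\<^sup>2)) + H_constant * boundary_integral T (\<lambda>e x. (h T x)\<^sup>2)"
    proof -
      have "(LINT x|edge_measure e. G T e x) = E_constant * ((LINT x|edge_measure e. (p1 T x)\<^sup>2)
          + (LINT x|edge_measure e. (p2 T x)\<^sup>2)) + H_constant * (LINT x|edge_measure e. (h T x)\<^sup>2)"
        if e: "e edge_of T" for e
      proof -
        have "integrable (edge_measure e) (\<lambda>x. (q T x)\<^sup>2)" if "broken_poly q" for q
          using broken_poly_edge_bounded[OF that] T e unfolding edge_bounded_def
          by (intro ess_bounded_integrable_edge ess_bounded_power2) auto
        then show ?thesis using p h unfolding G_def by simp
      qed
      then show ?thesis unfolding boundary_integral_def
        by (simp add: sum.distrib sum_distrib_left distrib_left)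
    qed
    also have "\<dots> \<le> E_constant * (inverse (diameter T) * (K * (L2_norm T (p1 T))\<^sup>2)
        + inverse (diameter T) * (K * (L2_norm T (p2 T))\<^sup>2)) + H_constant * (inverse (diameter T) * (K * b))"
      unfolding K_def b_def using edge_constants
      by (intro add_mono mult_left_mono trace_bound_square[OF C_tau] p h T) auto
    also have "\<dots> = inverse (diameter T) * (K * E_constant * a + K * H_constant * b)"
      by (simp add: a_def algebra_simps)
    finally have "s * I T + boundary_integral T (G T) \<le> inverse (diameter T) * (C_E * a + C_H * b)"
      using I unfolding CEH by (simp add: algebra_simps)
    also have "C_E * a + C_H * b \<le> max C_E C_H * (a + b)"
      using ab by (simp add: distrib_left add_mono mult_right_mono)
    also have "inverse (diameter T) * (max C_E C_H * (a + b))
        \<le> inverse (Min (diameter ` \<T>)) * (max C_E C_H * (a + b))"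
    proof (rule mult_right_mono)
      have "Min (diameter ` \<T>) \<in> diameter ` \<T>" using finite_mesh T by (intro Min_in) auto
      then have "Min (diameter ` \<T>) > 0" using diameter_simplex_pos element by auto
      moreover have "Min (diameter ` \<T>) \<le> diameter T" using finite_mesh T by simp
      ultimately show "inverse (diameter T) \<le> inverse (Min (diameter ` \<T>))" by (rule le_imp_inverse_le[rotated])
    qed (use max0 ab in simp)
    finally show "s * I T + boundary_integral T (G T) \<le> max C_E C_H / Min (diameter ` \<T>) *
      ((L2_norm T (p1 T))\<^sup>2 + (L2_norm T (p2 T))\<^sup>2 + (L2_norm T (h T))\<^sup>2)"
      using d by (simp add: a_def b_def divide_inverse mult.commute mult.left_commute)
  qed
  also have "\<dots> = max C_E C_H / Min (diameter ` \<T>) * (mesh_L2 p1 + mesh_L2 p2 + mesh_L2 h)"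
    unfolding mesh_L2_def by (simp only: sum_distrib_left[symmetric] sum.distrib)
  finally show ?thesis .
qed

text \<open>The bound \<open>bound\<close> keeps \<open>discrete_energy\<close> between multiples of the squared norm: with \<open>s = -1\<close> from
  below and with \<open>s = 1\<close> from above, where the dissipation terms may be dropped. A quantity that does not
  increase and is trapped in this way bounds the later norm by the earlier one.\<close>

lemma stability:
  assumes dt: "\<Delta>t > 0" and \<gamma>: "\<gamma> < min eps_lo mu_lo" "0 \<le> \<gamma>"
    and bound: "\<And>s h p1 p2. \<bar>s\<bar> \<le> 1 \<Longrightarrow> broken_poly h \<Longrightarrow> broken_poly p1 \<Longrightarrow> broken_poly p2 \<Longrightarrow>
      \<Delta>t * (s * curl_form h p1 p2 + 1/2 * E_dissipation p1 p2 p1 p2 + 1/2 * H_dissipation h h)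
      \<le> \<gamma> * (mesh_L2 p1 + mesh_L2 p2 + mesh_L2 h)"
    and sol: "leapfrog_solution \<Omega> \<T> \<epsilon> \<mu> \<epsilon>T \<mu>T N bc \<alpha> \<Delta>t M E1 E2 Hz"
  shows "(L2_norm \<Omega> (E1 M))\<^sup>2 + (L2_norm \<Omega> (E2 M))\<^sup>2 + (L2_norm \<Omega> (Hz M))\<^sup>2
    \<le> (max eps_hi mu_hi + \<gamma>) / (min eps_lo mu_lo - \<gamma>) *
      ((L2_norm \<Omega> (E1 0))\<^sup>2 + (L2_norm \<Omega> (E2 0))\<^sup>2 + (L2_norm \<Omega> (Hz 0))\<^sup>2)"
proof -
  define S where "S m = (L2_norm \<Omega> (E1 m))\<^sup>2 + (L2_norm \<Omega> (E2 m))\<^sup>2 + (L2_norm \<Omega> (Hz m))\<^sup>2" for m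
  define W where "W m = discrete_energy \<Delta>t (elem N (E1 m)) (elem N (E2 m)) (elem N (Hz m))" for m
  have fields: "\<forall>m\<le>M. (E1 m, E2 m, Hz m) \<in> dg_space \<Omega> \<T> N"
    using sol unfolding leapfrog_solution_def by (rule conjunct1)
  have two_sided: "(min eps_lo mu_lo - \<gamma>) * S m \<le> W m \<and> W m \<le> (max eps_hi mu_hi + \<gamma>) * S m"
    if "m \<le> M" for m
  proof -
    have v: "E1 m \<in> dg_scalar_space \<Omega> \<T> N" "E2 m \<in> dg_scalar_space \<Omega> \<T> N" "Hz m \<in> dg_scalar_space \<Omega> \<T> N"
      using fields[rule_format, OF that] by (auto simp: dg_space_def)
    define p1 p2 h where "p1 = elem N (E1 m)" and "p2 = elem N (E2 m)" and "h = elem N (Hz m)"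
    have b: "broken_poly p1" "broken_poly p2" "broken_poly h"
      unfolding p1_def p2_def h_def using v broken_poly_elem by auto
    have S: "S m = mesh_L2 p1 + mesh_L2 p2 + mesh_L2 h"
      unfolding S_def p1_def p2_def h_def using v by (simp add: L2_norm_mesh)
    have W: "W m = eps_energy p1 p2 + mu_energy h + \<Delta>t * curl_form h p1 p2
     - \<Delta>t / 2 * (E_dissipation p1 p2 p1 p2 + H_dissipation h h)"
      by (simp add: W_def discrete_energy_def p1_def p2_def h_def)
    have E: "eps_lo * (mesh_L2 p1 + mesh_L2 p2) \<le> eps_energy p1 p2"
      "eps_energy p1 p2 \<le> eps_hi * (mesh_L2 p1 + mesh_L2 p2)"
      "mu_lo * mesh_L2 h \<le> mu_energy h" "mu_energy h \<le> mu_hi * mesh_L2 h"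
      by (intro eps_energy_bounds mu_energy_bounds b)+
    have "min eps_lo mu_lo * (mesh_L2 p1 + mesh_L2 p2) \<le> eps_lo * (mesh_L2 p1 + mesh_L2 p2)"
      "eps_hi * (mesh_L2 p1 + mesh_L2 p2) \<le> max eps_hi mu_hi * (mesh_L2 p1 + mesh_L2 p2)"
      "min eps_lo mu_lo * mesh_L2 h \<le> mu_lo * mesh_L2 h"
      "mu_hi * mesh_L2 h \<le> max eps_hi mu_hi * mesh_L2 h"
      using mesh_L2_nonneg by (auto intro!: mult_right_mono add_nonneg_nonneg)
    then have EM: "min eps_lo mu_lo * S m \<le> eps_energy p1 p2 + mu_energy h"
      "eps_energy p1 p2 + mu_energy h \<le> max eps_hi mu_hi * S m"
      using E unfolding S distrib_left by linarith+
    have lower: "- (\<Delta>t * curl_form h p1 p2) + \<Delta>t / 2 * (E_dissipation p1 p2 p1 p2 + H_dissipation h h)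
        \<le> \<gamma> * S m"
      using bound[of "-1" h p1 p2] b unfolding S by (simp add: algebra_simps)
    have upper: "\<Delta>t * curl_form h p1 p2 + \<Delta>t / 2 * (E_dissipation p1 p2 p1 p2 + H_dissipation h h) \<le> \<gamma> * S m"
      using bound[of 1 h p1 p2] b unfolding S by (simp add: algebra_simps)
    have "0 \<le> \<Delta>t / 2 * (E_dissipation p1 p2 p1 p2 + H_dissipation h h)"
      using dt E_dissipation_nonneg H_dissipation_nonneg b by simp
    then show ?thesis using EM lower upper unfolding W left_diff_distrib distrib_right by linarith
  qed
  have "(min eps_lo mu_lo - \<gamma>) * S M \<le> W M" using two_sided[of M] by simp
  also have "W M \<le> W 0" unfolding W_def by (rule discrete_energy_solution[OF sol dt order_refl])
  also have "W 0 \<le> (max eps_hi mu_hi + \<gamma>) * S 0" using two_sided[of 0] by simp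
  finally have "S M \<le> (max eps_hi mu_hi + \<gamma>) * S 0 / (min eps_lo mu_lo - \<gamma>)"
    using \<gamma> by (simp add: pos_le_divide_eq mult.commute)
  then show ?thesis unfolding S_def by simp
qed

end

theorem theorem4p1:
  fixes \<Omega> :: "point set" and \<T> :: "point set set"
    and \<epsilon> :: "point \<Rightarrow> real^2^2" and \<mu> :: "point \<Rightarrow> real"
    and \<epsilon>T :: "point set \<Rightarrow> point \<Rightarrow> real^2^2" and \<mu>T :: "point set \<Rightarrow> point \<Rightarrow> real"
    and N :: nat and bc :: boundary_condition
    and eps_lo eps_hi mu_lo mu_hi \<tau> \<alpha> \<Delta>t C_tau C_inv C_E C_H :: real
  assumes domain: "polygonal_domain \<Omega>"
    and mesh: "conforming_mesh \<Omega> \<T>"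
    and shape: "\<tau> > 0" "shape_regular \<tau> \<T>"
    and coeff_meas: "\<epsilon> \<in> borel_measurable (lebesgue_on \<Omega>)" "\<mu> \<in> borel_measurable (lebesgue_on \<Omega>)"
    and coeff_pos: "eps_lo > 0" "eps_hi > 0" "mu_lo > 0" "mu_hi > 0"
    and eps_sym: "AE x in lebesgue_on \<Omega>. transpose (\<epsilon> x) = \<epsilon> x"
    and eps_bounds: "AE x in lebesgue_on \<Omega>. \<forall>\<xi>.
          eps_lo * (norm \<xi>)\<^sup>2 \<le> \<xi> \<bullet> (\<epsilon> x *v \<xi>) \<and> \<xi> \<bullet> (\<epsilon> x *v \<xi>) \<le> eps_hi * (norm \<xi>)\<^sup>2"
    and mu_bounds: "AE x in lebesgue_on \<Omega>. mu_lo \<le> \<mu> x \<and> \<mu> x \<le> mu_hi"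
    and eps_trace: "\<And>T e. T \<in> \<T> \<Longrightarrow> e edge_of T \<Longrightarrow> edge_trace \<epsilon> T e (\<epsilon>T T)"
    and mu_trace: "\<And>T e. T \<in> \<T> \<Longrightarrow> e edge_of T \<Longrightarrow> edge_trace \<mu> T e (\<mu>T T)"
    and alpha: "0 \<le> \<alpha>" "\<alpha> \<le> 1"
    and time_step: "\<Delta>t > 0"
    and trace_ineq: "C_tau > 0" "\<And>T u. T \<in> \<T> \<Longrightarrow> u \<in> poly_space N \<Longrightarrow>
          L2_boundary_norm T u
            \<le> C_tau * sqrt ((real N + 1) * (real N + 2)) * diameter T powr (-1/2) * L2_norm T u"
    and inverse_ineq: "C_inv > 0" "\<And>T u. T \<in> \<T> \<Longrightarrow> u \<in> poly_space N \<Longrightarrow>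
          H1_norm T u \<le> C_inv * (real N)\<^sup>2 * inverse (diameter T) * L2_norm T u"
    and C_E: "C_E = 1/2 * C_inv * (real N)\<^sup>2 + C_tau\<^sup>2 * (real N + 1) * (real N + 2) *
          (2 + beta2 bc + (2 * \<alpha> + beta1 bc \<alpha>) / (2 * Z_min \<T> \<epsilon>T \<mu>T))"
    and C_H: "C_H = 1/2 * C_inv * (real N)\<^sup>2 + C_tau\<^sup>2 * (real N + 1) * (real N + 2) *
          (2 + beta2 bc + (\<alpha> + beta2 bc * beta3 bc \<alpha>) / Y_min \<T> \<epsilon>T \<mu>T)"
    and CFL: "\<Delta>t < min eps_lo mu_lo / max C_E C_H * Min (diameter ` \<T>)"
  shows "\<exists>C>0. \<forall>M\<ge>1. \<forall>E1 E2 Hz.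
           leapfrog_solution \<Omega> \<T> \<epsilon> \<mu> \<epsilon>T \<mu>T N bc \<alpha> \<Delta>t M E1 E2 Hz \<longrightarrow>
           (L2_norm \<Omega> (E1 M))\<^sup>2 + (L2_norm \<Omega> (E2 M))\<^sup>2 + (L2_norm \<Omega> (Hz M))\<^sup>2
             \<le> C * ((L2_norm \<Omega> (E1 0))\<^sup>2 + (L2_norm \<Omega> (E2 0))\<^sup>2 + (L2_norm \<Omega> (Hz 0))\<^sup>2)"
proof -
  interpret maxwell_dg \<Omega> \<T> \<epsilon> \<mu> \<epsilon>T \<mu>T N bc eps_lo eps_hi mu_lo mu_hi \<alpha>
    by (rule maxwell_dg.intro[OF domain mesh coeff_meas coeff_pos eps_sym eps_bounds mu_bounds eps_trace mu_trace alpha])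
  define H where "H = Min (diameter ` \<T>)"
  have "H \<in> diameter ` \<T>" unfolding H_def using finite_mesh mesh_nonempty by (intro Min_in) auto
  then have H: "H > 0" using diameter_simplex_pos element by auto
  have "C_E > 0"
    unfolding C_E[folded E_constant_def] using edge_constants(3) trace_ineq(1) inverse_ineq(1)
    by (intro add_nonneg_pos mult_pos_pos) auto
  then have m: "max C_E C_H > 0" by (simp add: less_max_iff_disj)
  \<comment> \<open>The restriction of the time step says that \<open>\<gamma>\<close> is less than both lower bounds of the coefficients.\<close>
  define \<gamma> where "\<gamma> = \<Delta>t * (max C_E C_H / H)"
  have \<gamma>: "\<gamma> < min eps_lo mu_lo" "0 \<le> \<gamma>"
  proof -
    have "\<Delta>t < min eps_lo mu_lo * H / max C_E C_H" using CFL unfolding H_def by simp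
    then have "\<Delta>t * max C_E C_H < min eps_lo mu_lo * H" by (simp only: pos_less_divide_eq[OF m])
    then show "\<gamma> < min eps_lo mu_lo" by (simp only: \<gamma>_def times_divide_eq_right pos_divide_less_eq[OF H])
    show "0 \<le> \<gamma>" using m H time_step by (simp add: \<gamma>_def)
  qed
  have bound: "\<Delta>t * (s * curl_form h p1 p2 + 1/2 * E_dissipation p1 p2 p1 p2 + 1/2 * H_dissipation h h)
      \<le> \<gamma> * (mesh_L2 p1 + mesh_L2 p2 + mesh_L2 h)"
    if "\<bar>s\<bar> \<le> 1" "broken_poly h" "broken_poly p1" "broken_poly p2" for s h p1 p2
    using mult_left_mono[OF coercivity[OF trace_ineq inverse_ineq C_E[folded E_constant_def]
      C_H[folded H_constant_def] that(2-4) that(1)], of \<Delta>t] time_step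
    unfolding \<gamma>_def H_def by (simp only: mult.assoc less_imp_le)
  show ?thesis
  proof (intro exI conjI allI impI)
    show "(max eps_hi mu_hi + \<gamma>) / (min eps_lo mu_lo - \<gamma>) > 0"
      using \<gamma> coeff_pos by (intro divide_pos_pos) (auto simp: add_pos_nonneg less_max_iff_disj)
  qed (rule stability[OF time_step \<gamma> bound])
qed

end
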